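(* Let $\mathbf h\in\mathcal H$ be a fixed projection direction, and suppose the projected alternative holds: for every $\boldsymbol\rho'\in\mathcal H$ it is not the case that $\mathbb E[Y-\langle\mathbf X,\boldsymbol\rho'\rangle-\mathbf Z^\top\boldsymbol\beta\mid\mathbf X^{\mathbf h}]=0$ a.s. Assume the following. (A1) $m_k:=\mathbb E\|\mathbf X\|^k<\infty$ for all $k\ge1$ and $\sum_{k\ge1}m_k^{-1/k}=\infty$. (A2) $\mathbb E(\varepsilon\mid\mathbf X,\mathbf Z)=0$ a.s. and $\mathbb E(\varepsilon^2\mid\mathbf X,\mathbf Z)=\sigma_\varepsilon^2$ a.s. (B1) The $\mathbf X_i$ take values in a given compact set $\mathcal C\subset\mathcal H$ with $\mathcal C\subset\bigcup_{k=1}^{\tau_n}\mathcal B(x_k,l_n)$, where $\mathcal B(x,s)=\{x'\in\mathcal H:d(x',x)<s\}$, $x_k\in\mathcal H$, $\tau_n l_n^{\gamma}=C$ for real constants $\gamma,C>0$, and $\tau_n\to\infty$, $l_n\to0$ as $n\to\infty$. (B2) There are $C<\infty$ and $\alpha>0$ with $|f(u)-f(v)|\le C\,d(u,v)^\alpha$ for all $(u,v)\in\mathcal C\times\mathcal C$ and $f\in\{m,g_1,\dots,g_p\}$; there is $q\ge3$ with $\mathbb E|\varepsilon_1|^q+\mathbb E|\eta_{11}|^q+\dots+\mathbb E|\eta_{1p}|^q<\infty$; and $\mathbf B=\mathbb E(\boldsymbol\eta_1\boldsymbol\eta_1^\top)$ is positive definite. (B3) There are a positive function $\phi$ on $(0,\infty)$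 and constants $\alpha_0,\alpha_1,\alpha_2>0$ with $\int_0^1\phi(hs)\,ds>\alpha_0\phi(h)$ and $\alpha_1\phi(h)\le\mathbb P(\mathbf X\in\mathcal B(x,h))\le\alpha_2\phi(h)$ for all $x\in\mathcal C$ and all real $h>0$. (B4) The kernel $K$ has support $[0,1]$, is Lipschitz continuous on $[0,\infty)$, and there is $\theta>0$ with $-K'(u)>\theta$ for all $u\in[0,1]$; the bandwidth satisfies $nb^{4\alpha}\to0$, and $\phi(b)\ge n^{2/q+a-1}/(\log n)^2$ for $n$ large enough and some constant $a>0$ with $2/q+a>1/2$. (C1) $\sum_{j\ge1}\lambda_j^{-2}\langle\mathbb E(\mathbf XW),\mathbf e_j\rangle^2<\infty$ for $W=Y$ and $W=Z_j$, $j=1,\dots,p$. (C2) $\ker\Gamma=\{\mathbf 0\}$. (C3) $\mathbb E\|\mathbf X\|^2<\infty$ and $\mathbb E\|\mathbf Z\|^2<\infty$. (C4) $\sum_{l\ge1}|\langle\boldsymbol\rho,\mathbf e_l\rangle|<\infty$. (C5) For $j$ large enough, $\lambda_j=\lambda(j)$ with $\lambda(\cdot)$ a convex positive function. (C6) $\lambda_n n^4/\log n=O(1)$. (C7) $\inf\{|\langle\boldsymbol\rho,\mathbf e_{k_n}\rangle|,\ \lambda_{k_n}/\sqrt{k_n\log k_n}\}=O(n^{-1/2})$. (C8) $\sup_j\mathbb E|\xi_j|^5\le M<\infty$ for some $M\ge1$. (C9) There are $C_1,C_2>0$ with $C_1n^{-1/2}<c_n<C_2n^{-1/2}$ for every $n$.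 (i) $\lim_n\big(\sum_{j=1}^{k_n}\lambda_j^{-1}\langle\mathbf E_{x,\mathbf h},\mathbf e_j\rangle^2\big)^{1/2}<\infty$ for $x\in\mathbb R$. (ii) $\mathbb E\|\hat{\boldsymbol\rho}-\boldsymbol\rho\|^4=O(n^{-2})$. Then, for some $\boldsymbol\rho^*\in\mathcal H$ satisfying $\mathbb E\|\hat{\boldsymbol\rho}-\boldsymbol\rho^*\|=o(1)$, $$n^{-1/2}T_{n,\mathbf h}(x)\ \longrightarrow\ \mathbb E\big[(m(\mathbf X)-\langle\mathbf X,\boldsymbol\rho^*\rangle)\,\mathbf 1\{\mathbf X^{\mathbf h}\le x\}\big]\quad\text{in probability, uniformly in }x\in\mathbb R.$$
   Context: Model. $\mathcal H$ is a separable Hilbert space with inner product $\langle\cdot,\cdot\rangle$ and norm $\|\cdot\|$, and $d$ is a semi-metric on $\mathcal H$. The scalar $Y$, the real vector $\mathbf Z=(Z_1,\dots,Z_p)^\top$ and the $\mathcal H$-valued $\mathbf X$ satisfy $Y=\mathbf Z^\top\boldsymbol\beta+m(\mathbf X)+\varepsilon$ with $\boldsymbol\beta\in\mathbb R^p$ and $m:\mathcal H\to\mathbb R$ unknown and $\mathbb E(\varepsilon\mid\mathbf Z,\mathbf X)=0$ a.s. The observations $(Y_i,\mathbf Z_i,\mathbf X_i)$, $i=1,\dots,n$, are i.i.d. copies with errors $\varepsilon_i$. Write $\mathbf X^{\mathbf h}=\langle\mathbf X,\mathbf h\rangle$ and $\mathbf X^{\boldsymbol\rho}=\langle\mathbf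 X,\boldsymbol\rho\rangle$. Put $g_j(x)=\mathbb E(Z_{ij}\mid\mathbf X_i=x)$, $\eta_{ij}=Z_{ij}-g_j(\mathbf X_i)$, $\boldsymbol\eta_i=(\eta_{i1},\dots,\eta_{ip})^\top$. Covariance operator. $(\mathbf x\otimes\mathbf y)\mathbf z=\langle\mathbf z,\mathbf x\rangle\mathbf y$ and $\Gamma(\mathbf z)=\mathbb E[(\mathbf X\otimes\mathbf X)(\mathbf z)]$. $\Gamma$ has distinct eigenvalues $\lambda_1>\lambda_2>\dots>0$ with orthonormal eigenfunctions $\mathbf e_j$, and $\mathbf X=\sum_{j\ge1}\lambda_j^{1/2}\xi_j\mathbf e_j$ with centered real $\xi_j$ satisfying $\mathbb E[\xi_j\xi_{j'}]=\delta_{jj'}$. Also $\mathbf E_{x,\mathbf h}=\mathbb E(\mathbf 1\{\mathbf X^{\mathbf h}\le x\}\mathbf X)\in\mathcal H$. The coefficient $\boldsymbol\rho$ in (C4), (C7), (ii) is the one determined by the moment equation $\Gamma\boldsymbol\rho=\mathbb E[\mathbf X(Y-\mathbf Z^\top\boldsymbol\beta)]$, i.e. the minimizer of $\mathbb E|Y-\mathbf Z^\top\boldsymbol\beta-\langle\mathbf X,\boldsymbol\rho\rangle|^2$ over $\mathcal H$ (existence and uniqueness being ensured by (C1), (C2)). Estimator of $\boldsymbol\beta$. With bandwidth $b=b_n\to0$ and kernel $K:[0,\infty)\to[0,\infty)$, let $w_{n,b}(t,\mathbf X_i)=K(d(t,\mathbf X_i)/b)/\sum_{j=1}^nK(d(t,\mathbf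 X_j)/b)$, $\mathbf W_b=(w_{n,b}(\mathbf X_i,\mathbf X_j))_{i,j}$, $\mathcal Z=(\mathbf Z_1,\dots,\mathbf Z_n)^\top$, $\mathbf Y=(Y_1,\dots,Y_n)^\top$, $\widetilde{\mathbf Z}_b=\mathcal Z-\mathbf W_b\mathcal Z$, $\widetilde{\mathbf Y}_b=\mathbf Y-\mathbf W_b\mathbf Y$, and $\tilde{\boldsymbol\beta}=(\widetilde{\mathbf Z}_b^\top\widetilde{\mathbf Z}_b)^{-1}\widetilde{\mathbf Z}_b^\top\widetilde{\mathbf Y}_b$. Estimator $\hat{\boldsymbol\rho}$. Let $\Gamma_n=n^{-1}\sum_i\mathbf X_i\otimes\mathbf X_i$ have eigenvalues $\hat\lambda_j$ (in decreasing order) and eigenfunctions $\hat{\mathbf e}_j$. Let $\delta_1=\lambda_1-\lambda_2$, $\delta_j=\min(\lambda_j-\lambda_{j+1},\lambda_{j-1}-\lambda_j)$ for $j\ge2$; let $c_n\in(0,\lambda_1)$, $c_n\to0$; and $k_n=\sup\{j\in\mathbb N:\lambda_j+\delta_j/2\ge c_n\}$. Put $\Gamma_n^\dagger=\sum_{j=1}^{k_n}\hat\lambda_j^{-1}\hat{\mathbf e}_j\otimes\hat{\mathbf e}_j$, $\widetilde D_i=Y_i-\mathbf Z_i^\top\tilde{\boldsymbol\beta}$, and $\hat{\boldsymbol\rho}=\Gamma_n^\dagger\big(n^{-1}\sum_i\widetilde D_i\mathbf X_i\big)$. Process. $T_{n,\mathbf h}(x)=n^{-1/2}\sum_{i=1}^n\mathbf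 1\{\mathbf X_i^{\mathbf h}\le x\}\,(Y_i-\mathbf Z_i^\top\tilde{\boldsymbol\beta}-\mathbf X_i^{\hat{\boldsymbol\rho}})$, $x\in\mathbb R$. *)

theory Defs
  imports "HOL-Probability.Probability" "HOL-Library.Landau_Symbols"
begin

text \<open>
  The separable Hilbert space is a type of sort
  \<open>{real_inner, banach, second_countable_topology}\<close>; \<open>\<real>\<^sup>p\<close> is \<open>real ^ 'p\<close>. Observations,
  eigenvalues and eigenfunctions are sequences indexed by \<open>nat\<close>, of which only the indices
  \<open>\<ge> 1\<close> are used.
\<close>

subsection \<open>Semi-metrics\<close>

text \<open>
  A semi-metric may vanish off the diagonal. It need not be related to the norm topology, so
  Borel measurability of its sections is required explicitly: it makes
  \<open>{X \<in> dball d x s}\<close> an event.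
\<close>

definition semimetric :: "('h::topological_space \<Rightarrow> 'h \<Rightarrow> real) \<Rightarrow> bool" where
  "semimetric d \<longleftrightarrow>
     (\<forall>x y. 0 \<le> d x y) \<and> (\<forall>x. d x x = 0) \<and> (\<forall>x y. d x y = d y x) \<and>
     (\<forall>x y z. d x z \<le> d x y + d y z) \<and> (\<forall>x. d x \<in> borel_measurable borel)"

definition dball :: "('h \<Rightarrow> 'h \<Rightarrow> real) \<Rightarrow> 'h \<Rightarrow> real \<Rightarrow> 'h set" where
  "dball d x s = {x'. d x' x < s}"

subsection \<open>Probabilistic notions\<close>

definition iid_copies ::
  "'w measure \<Rightarrow> ('w \<Rightarrow> 'a::topological_space) \<Rightarrow> (nat \<Rightarrow> 'w \<Rightarrow> 'a) \<Rightarrow> bool" where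
  "iid_copies M U V \<longleftrightarrow>
     prob_space.indep_vars M (\<lambda>_. borel) V {1..} \<and>
     U \<in> borel_measurable M \<and> (\<forall>i\<ge>1. distr M borel (V i) = distr M borel U)"

definition cond_exp_given ::
  "'w measure \<Rightarrow> ('w \<Rightarrow> 'a::topological_space) \<Rightarrow> ('w \<Rightarrow> real) \<Rightarrow> 'w \<Rightarrow> real" where
  "cond_exp_given M U f = real_cond_exp M (vimage_algebra (space M) U borel) f"

text \<open>
  \<open>F n x\<close> tends to \<open>G x\<close> in probability, uniformly in \<open>x\<close>. The exceptional event is the event
  that the supremum over \<open>x\<close> of the deviation exceeds \<open>e\<close>. Its measurability is part of
  the notion because \<open>measure\<close> is \<open>0\<close> on non-measurable sets.
\<close>

definition unif_tendsto_in_prob ::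
  "'w measure \<Rightarrow> (nat \<Rightarrow> 'x \<Rightarrow> 'w \<Rightarrow> real) \<Rightarrow> ('x \<Rightarrow> real) \<Rightarrow> bool" where
  "unif_tendsto_in_prob M F G \<longleftrightarrow>
     (\<forall>e>0. (\<forall>n. {\<omega> \<in> space M. \<exists>x. \<bar>F n x \<omega> - G x\<bar> > e} \<in> sets M) \<and>
        (\<lambda>n. measure M {\<omega> \<in> space M. \<exists>x. \<bar>F n x \<omega> - G x\<bar> > e}) \<longlonglongrightarrow> 0)"

definition pos_def_matrix :: "real ^ 'p ^ 'p \<Rightarrow> bool" where
  "pos_def_matrix A \<longleftrightarrow> transpose A = A \<and> (\<forall>v. v \<noteq> 0 \<longrightarrow> v \<bullet> (A *v v) > 0)"

subsection \<open>Covariance operator and spectral quantities\<close>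

definition tensor :: "'h::real_inner \<Rightarrow> 'h \<Rightarrow> 'h \<Rightarrow> 'h" where
  "tensor x y = (\<lambda>z. (z \<bullet> x) *\<^sub>R y)"

definition cov_op ::
  "'w measure \<Rightarrow> ('w \<Rightarrow> 'h::{real_inner, banach, second_countable_topology}) \<Rightarrow> 'h \<Rightarrow> 'h" where
  "cov_op M X z = (\<integral>\<omega>. tensor (X \<omega>) (X \<omega>) z \<partial>M)"

definition partial_mean ::
  "'w measure \<Rightarrow> ('w \<Rightarrow> 'h::{real_inner, banach, second_countable_topology}) \<Rightarrow> 'h \<Rightarrow> real \<Rightarrow> 'h"
where
  "partial_mean M X h x = (\<integral>\<omega>. indicat_real {\<omega>. X \<omega> \<bullet> h \<le> x} \<omega> *\<^sub>R X \<omega> \<partial>M)"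

definition orthonormal_seq :: "(nat \<Rightarrow> 'h::real_inner) \<Rightarrow> bool" where
  "orthonormal_seq e \<longleftrightarrow> (\<forall>i\<ge>1. \<forall>j\<ge>1. e i \<bullet> e j = (if i = j then 1 else 0))"

definition eigen_gap :: "(nat \<Rightarrow> real) \<Rightarrow> nat \<Rightarrow> real" where
  "eigen_gap lam j =
     (if j = 1 then lam 1 - lam 2 else min (lam j - lam (j + 1)) (lam (j - 1) - lam j))"

definition cutoff :: "(nat \<Rightarrow> real) \<Rightarrow> real \<Rightarrow> nat" where
  "cutoff lam c = Sup {j. j \<ge> 1 \<and> lam j + eigen_gap lam j / 2 \<ge> c}"

definition emp_cov_op :: "nat \<Rightarrow> (nat \<Rightarrow> 'h::real_inner) \<Rightarrow> 'h \<Rightarrow> 'h" where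
  "emp_cov_op n x z = (1 / real n) *\<^sub>R (\<Sum>i=1..n. tensor (x i) (x i) z)"

text \<open>
  All eigenvalues of \<open>A\<close>, repeated according to multiplicity and in decreasing order, with
  orthonormal eigenfunctions; the spectral expansion of \<open>A\<close> says that no eigenvalue is left out.
\<close>

definition eigensystem ::
  "('h::real_inner \<Rightarrow> 'h) \<Rightarrow> (nat \<Rightarrow> real) \<Rightarrow> (nat \<Rightarrow> 'h) \<Rightarrow> bool" where
  "eigensystem A lam e \<longleftrightarrow>
     orthonormal_seq e \<and> (\<forall>j\<ge>1. A (e j) = lam j *\<^sub>R e j) \<and> (\<forall>j\<ge>1. lam (j + 1) \<le> lam j) \<and>
     (\<forall>z. (\<lambda>j. lam (Suc j) *\<^sub>R tensor (e (Suc j)) (e (Suc j)) z) sums A z)"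

text \<open>
  Since \<open>inverse 0 = 0\<close>, vanishing eigenvalues among the first \<open>k\<close> contribute nothing, as in the
  Moore--Penrose inverse.
\<close>

definition trunc_pinv :: "nat \<Rightarrow> (nat \<Rightarrow> real) \<Rightarrow> (nat \<Rightarrow> 'h::real_inner) \<Rightarrow> 'h \<Rightarrow> 'h" where
  "trunc_pinv k lam e z = (\<Sum>j=1..k. inverse (lam j) *\<^sub>R tensor (e j) (e j) z)"

subsection \<open>Estimators, as functions of the data \<open>(y\<^sub>i, z\<^sub>i, x\<^sub>i)\<close>, \<open>i = 1, \<dots>, n\<close>\<close>

definition kernel_weight ::
  "(real \<Rightarrow> real) \<Rightarrow> ('h \<Rightarrow> 'h \<Rightarrow> real) \<Rightarrow> real \<Rightarrow> nat \<Rightarrow> (nat \<Rightarrow> 'h) \<Rightarrow> 'h \<Rightarrow> nat \<Rightarrow> real" where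
  "kernel_weight K d b n x t i = K (d t (x i) / b) / (\<Sum>j=1..n. K (d t (x j) / b))"

text \<open>Row \<open>i\<close> of \<open>v - W\<^sub>b v\<close>, where \<open>v\<close> has rows \<open>v\<^sub>1, \<dots>, v\<^sub>n\<close>.\<close>

definition smooth_resid ::
  "(real \<Rightarrow> real) \<Rightarrow> ('h \<Rightarrow> 'h \<Rightarrow> real) \<Rightarrow> real \<Rightarrow> nat \<Rightarrow> (nat \<Rightarrow> 'h) \<Rightarrow>
   (nat \<Rightarrow> 'v::real_vector) \<Rightarrow> nat \<Rightarrow> 'v" where
  "smooth_resid K d b n x v i = v i - (\<Sum>j=1..n. kernel_weight K d b n x (x i) j *\<^sub>R v j)"

definition beta_tilde ::
  "(real \<Rightarrow> real) \<Rightarrow> ('h \<Rightarrow> 'h \<Rightarrow> real) \<Rightarrow> real \<Rightarrow> nat \<Rightarrow>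
   (nat \<Rightarrow> real) \<Rightarrow> (nat \<Rightarrow> real ^ 'p) \<Rightarrow> (nat \<Rightarrow> 'h) \<Rightarrow> real ^ 'p" where
  "beta_tilde K d b n y z x =
     (let zt = smooth_resid K d b n x z; yt = smooth_resid K d b n x y in
      matrix_inv (\<chi> k l. \<Sum>i=1..n. zt i $ k * zt i $ l) *v (\<chi> k. \<Sum>i=1..n. zt i $ k * yt i))"

definition rho_hat ::
  "nat \<Rightarrow> (nat \<Rightarrow> real) \<Rightarrow> (nat \<Rightarrow> 'h::real_inner) \<Rightarrow> nat \<Rightarrow>
   (nat \<Rightarrow> real) \<Rightarrow> (nat \<Rightarrow> real ^ 'p) \<Rightarrow> (nat \<Rightarrow> 'h) \<Rightarrow> real ^ 'p \<Rightarrow> 'h" where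
  "rho_hat k lam e n y z x bt =
     trunc_pinv k lam e ((1 / real n) *\<^sub>R (\<Sum>i=1..n. (y i - z i \<bullet> bt) *\<^sub>R x i))"

definition resid_process ::
  "nat \<Rightarrow> (nat \<Rightarrow> real) \<Rightarrow> (nat \<Rightarrow> real ^ 'p) \<Rightarrow> (nat \<Rightarrow> 'h::real_inner) \<Rightarrow>
   real ^ 'p \<Rightarrow> 'h \<Rightarrow> 'h \<Rightarrow> real \<Rightarrow> real" where
  "resid_process n y z x bt rh h t =
     (1 / sqrt (real n)) *
     (\<Sum>i=1..n. (if x i \<bullet> h \<le> t then 1 else 0) * (y i - z i \<bullet> bt - x i \<bullet> rh))"

end

theory Submission
  imports Defs
begin

text \<open>
  Take \<open>\<rho>' = \<rho>\<close>. Since \<open>\<C>\<close> is bounded, consistency of the estimators of \<open>\<beta>\<close> and \<open>\<rho>\<close> reduces the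
  claim to the empirical mean of \<open>\<epsilon> + m (X) - X \<bullet> \<rho>\<close> over \<open>X \<bullet> h \<le> x\<close>, to which a weighted
  Glivenko--Cantelli theorem applies. The estimator of \<open>\<rho>\<close> converges by (ii). For that of \<open>\<beta>\<close>,
  the point is \<open>E (\<Sum>\<^sub>j w\<^sub>i\<^sub>j f\<^sub>j)\<^sup>2 = O(1 / (n \<phi>(b)))\<close> for noise \<open>f\<close> centred given the \<open>X\<^sub>i\<close>: the cross terms
  vanish, and inverse moments of binomial counts of data points in small balls bound the squared weights.
\<close>

subsection \<open>Convergence in probability as convergence along a filter\<close>

text \<open>The weights of the smoother have random denominators built from the same data as the
  noise. Once the observations \<open>i\<close> and \<open>j\<close> are frozen, the others are
  still independent, so the number of them near \<open>i\<close> is binomial. A squared off-diagonal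
  weight then costs about \<open>1 / (n \<phi>(b))\<^sup>2\<close>, and integrating out the position
  of \<open>i\<close> gains a factor \<open>\<phi>(b)\<close>; summing \<open>n\<close> such terms
  leaves \<open>1 / (n \<phi>(b))\<close>, which vanishes since \<open>n \<phi>(b)\<close>
  eventually exceeds a multiple of \<open>n powr (1/4)\<close>. Three obstacles shape the setup. The
  kernel vanishes at the edge of its support, so only balls of radius \<delta> b with \<delta> < 1
  bound the denominators from below, and their mass must be compared with that of balls of radius b.
  The semi-metric is measurable in each argument separately, while Fubini's theorem and the
  measurability of the estimator call for joint measurability; hence the kernel is replaced by a
  jointly measurable version. Finally, the exceptional events must be measurable for every n, also
  where the Gram matrix is singular; Cramer's rule and right continuity in x provide this.\<close>

text \<open>
  The exceptional event \<open>E\<close> dispenses with measurability of \<open>Q\<close>; limits along this filter are limits in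
  probability, so the library rules for \<open>tendsto\<close> and \<open>uniform_limit\<close> apply.
\<close>

definition in_prob :: "'w measure \<Rightarrow> (nat \<times> 'w) filter" where
  "in_prob M = Abs_filter (\<lambda>Q. \<forall>\<delta>>0. \<forall>\<^sub>F n in sequentially.
     \<exists>E\<in>sets M. measure M E < \<delta> \<and> (\<forall>\<omega>\<in>space M - E. Q (n, \<omega>)))"

text \<open>The filter property of closure under conjunction is the union bound, with \<delta>/2
  allowed to either event.\<close>

lemma eventually_in_prob:
  assumes "prob_space M"
  shows "eventually Q (in_prob M) \<longleftrightarrow> (\<forall>\<delta>>0. \<forall>\<^sub>F n in sequentially.
     \<exists>E\<in>sets M. measure M E < \<delta> \<and> (\<forall>\<omega>\<in>space M - E. Q (n, \<omega>)))"
  unfolding in_prob_def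
proof (rule eventually_Abs_filter, rule is_filter.intro)
  interpret prob_space M by fact
  show "\<forall>\<delta>>0. \<forall>\<^sub>F n in sequentially. \<exists>E\<in>sets M. prob E < \<delta> \<and> (\<forall>\<omega>\<in>space M - E. True)"
    by (auto intro!: always_eventually bexI[of _ "{}"])
next
  interpret prob_space M by fact
  fix P Q :: "nat \<times> 'a \<Rightarrow> bool"
  assume P: "\<forall>\<delta>>0. \<forall>\<^sub>F n in sequentially. \<exists>E\<in>sets M. prob E < \<delta> \<and> (\<forall>\<omega>\<in>space M - E. P (n, \<omega>))"
  assume Q: "\<forall>\<delta>>0. \<forall>\<^sub>F n in sequentially. \<exists>E\<in>sets M. prob E < \<delta> \<and> (\<forall>\<omega>\<in>space M - E. Q (n, \<omega>))"
  show "\<forall>\<delta>>0. \<forall>\<^sub>F n in sequentially. \<exists>E\<in>sets M. prob E < \<delta> \<and>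
    (\<forall>\<omega>\<in>space M - E. P (n, \<omega>) \<and> Q (n, \<omega>))"
  proof (intro allI impI)
    fix \<delta> :: real assume "\<delta> > 0"
    then have "\<delta> / 2 > 0" by simp
    from P[rule_format, OF this] Q[rule_format, OF this]
    show "\<forall>\<^sub>F n in sequentially. \<exists>E\<in>sets M. prob E < \<delta> \<and>
      (\<forall>\<omega>\<in>space M - E. P (n, \<omega>) \<and> Q (n, \<omega>))"
    proof eventually_elim
      case (elim n)
      then obtain A B where "A \<in> sets M" "prob A < \<delta> / 2" "\<forall>\<omega>\<in>space M - A. P (n, \<omega>)"
        and "B \<in> sets M" "prob B < \<delta> / 2" "\<forall>\<omega>\<in>space M - B. Q (n, \<omega>)" by blast
      moreover from this have "prob (A \<union> B) < \<delta>"
        using measure_Un_le[of A M B] by simp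
      ultimately show ?case by (intro bexI[of _ "A \<union> B"]) auto
    qed
  qed
next
  interpret prob_space M by fact
  fix P Q :: "nat \<times> 'a \<Rightarrow> bool"
  assume PQ: "\<forall>x. P x \<longrightarrow> Q x"
    "\<forall>\<delta>>0. \<forall>\<^sub>F n in sequentially. \<exists>E\<in>sets M. prob E < \<delta> \<and> (\<forall>\<omega>\<in>space M - E. P (n, \<omega>))"
  show "\<forall>\<delta>>0. \<forall>\<^sub>F n in sequentially. \<exists>E\<in>sets M. prob E < \<delta> \<and> (\<forall>\<omega>\<in>space M - E. Q (n, \<omega>))"
  proof (intro allI impI)
    fix \<delta> :: real assume "\<delta> > 0"
    with PQ(2) have "\<forall>\<^sub>F n in sequentially. \<exists>E\<in>sets M. prob E < \<delta> \<and> (\<forall>\<omega>\<in>space M - E. P (n, \<omega>))"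
      by blast
    then show "\<forall>\<^sub>F n in sequentially. \<exists>E\<in>sets M. prob E < \<delta> \<and> (\<forall>\<omega>\<in>space M - E. Q (n, \<omega>))"
      by eventually_elim (use PQ(1) in blast)
  qed
qed

lemma eventually_in_probI:
  assumes "prob_space M" and "\<forall>\<^sub>F n in sequentially. \<forall>\<omega>\<in>space M. Q (n, \<omega>)"
  shows "eventually Q (in_prob M)"
proof -
  interpret prob_space M by fact
  show ?thesis
    unfolding eventually_in_prob[OF assms(1)]
  proof (intro allI impI)
    fix \<delta> :: real assume "\<delta> > 0"
    show "\<forall>\<^sub>F n in sequentially. \<exists>E\<in>sets M. prob E < \<delta> \<and> (\<forall>\<omega>\<in>space M - E. Q (n, \<omega>))"
      using assms(2) by eventually_elim (use \<open>\<delta> > 0\<close> in \<open>auto intro!: bexI[of _ "{}"]\<close>)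
  qed
qed

lemma tendsto_in_prob_deterministic:
  assumes "prob_space M" "f \<longlonglongrightarrow> l"
  shows "((\<lambda>(n, \<omega>). f n) \<longlongrightarrow> l) (in_prob M)"
proof (rule topological_tendstoI)
  fix S assume "open S" "l \<in> S"
  with assms(2) have "\<forall>\<^sub>F n in sequentially. f n \<in> S" by (rule topological_tendstoD)
  then show "\<forall>\<^sub>F x in in_prob M. (case x of (n, \<omega>) \<Rightarrow> f n) \<in> S"
    by (intro eventually_in_probI assms) (auto elim: eventually_mono)
qed

text \<open>Markov's inequality: the exceptional event at level \<open>e\<close> has probability at
  most \<open>a n / e\<close>.\<close>

lemma tendsto_0_in_prob_L1:
  fixes f :: "nat \<Rightarrow> 'w \<Rightarrow> real"
  assumes "prob_space M"
    and ev: "\<forall>\<^sub>F n in sequentially. integrable M (f n) \<and> (\<forall>\<omega>\<in>space M. 0 \<le> f n \<omega>) \<and> (\<integral>\<omega>. f n \<omega> \<partial>M) \<le> a n"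
    and a: "a \<longlonglongrightarrow> 0"
  shows "((\<lambda>(n, \<omega>). f n \<omega>) \<longlongrightarrow> 0) (in_prob M)"
proof (rule tendstoI)
  interpret prob_space M by fact
  fix e :: real assume e: "e > 0"
  show "\<forall>\<^sub>F x in in_prob M. dist (case x of (n, \<omega>) \<Rightarrow> f n \<omega>) 0 < e"
    unfolding eventually_in_prob[OF assms(1)]
  proof (intro allI impI)
    fix \<delta> :: real assume "\<delta> > 0"
    then have "\<forall>\<^sub>F n in sequentially. a n < \<delta> * e"
      using order_tendstoD(2)[OF a, of "\<delta> * e"] e by simp
    with ev show "\<forall>\<^sub>F n in sequentially. \<exists>E\<in>sets M. prob E < \<delta> \<and>
      (\<forall>\<omega>\<in>space M - E. dist (case (n, \<omega>) of (n, \<omega>) \<Rightarrow> f n \<omega>) 0 < e)"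
    proof eventually_elim
      case (elim n)
      let ?E = "{\<omega> \<in> space M. e \<le> f n \<omega>}"
      from elim have [measurable]: "f n \<in> borel_measurable M" by auto
      have "prob ?E \<le> (\<integral>\<omega>. f n \<omega> \<partial>M) / e"
        by (rule integral_Markov_inequality_measure[where A="space M" and u="f n", simplified])
          (use elim e in auto)
      also have "\<dots> < \<delta>" using elim e by (simp add: field_simps)
      finally show ?case using elim by (intro bexI[of _ ?E]) auto
    qed
  qed
qed

lemma tendsto_0_sandwich:
  fixes f g :: "'a \<Rightarrow> real"
  assumes "(g \<longlongrightarrow> 0) F" "\<forall>\<^sub>F x in F. \<bar>f x\<bar> \<le> g x"
  shows "(f \<longlongrightarrow> 0) F"
  by (rule Lim_null_comparison[OF _ assms(1)]) (use assms(2) in simp)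

text \<open>The common law \<open>P\<close> is itself the space of single observations. Expectations
  of one observation are integrals against \<open>P\<close>, and the first \<open>n\<close>
  observations are distributed as a power of \<open>P\<close>.\<close>

definition iid_seq :: "'w measure \<Rightarrow> 's measure \<Rightarrow> (nat \<Rightarrow> 'w \<Rightarrow> 's) \<Rightarrow> bool" where
  "iid_seq M P V \<longleftrightarrow> prob_space M \<and> prob_space.indep_vars M (\<lambda>_. P) V {1..} \<and>
     (\<forall>i\<ge>1. V i \<in> measurable M P \<and> distr M P (V i) = P)"

definition avg :: "nat \<Rightarrow> (nat \<Rightarrow> 'v::real_vector) \<Rightarrow> 'v" where
  "avg n v = (1 / real n) *\<^sub>R (\<Sum>i=1..n. v i)"

lemma iid_seq_integrable:
  fixes f :: "'s \<Rightarrow> real"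
  assumes "iid_seq M P V" "i \<ge> 1" "integrable P f"
  shows "integrable M (\<lambda>\<omega>. f (V i \<omega>))"
  using assms integrable_distr[of "V i" M P f] unfolding iid_seq_def by auto

lemma iid_seq_integral:
  fixes f :: "'s \<Rightarrow> real"
  assumes "iid_seq M P V" "i \<ge> 1" "f \<in> borel_measurable P"
  shows "(\<integral>\<omega>. f (V i \<omega>) \<partial>M) = (\<integral>u. f u \<partial>P)"
  using assms integral_distr[of "V i" M P f] unfolding iid_seq_def by auto

lemma iid_seq_prob_space:
  assumes "iid_seq M P V" shows "prob_space M" "prob_space P"
proof -
  show M: "prob_space M" using assms by (simp add: iid_seq_def)
  have "V 1 \<in> measurable M P" "distr M P (V 1) = P" using assms by (auto simp: iid_seq_def)
  then show "prob_space P" using prob_space.prob_space_distr[OF M] by metis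
qed

lemma integral_avg:
  fixes f :: "'s \<Rightarrow> real"
  assumes "iid_seq M P V" "integrable P f" "n \<ge> 1"
  shows "(\<integral>\<omega>. avg n (\<lambda>i. f (V i \<omega>)) \<partial>M) = (\<integral>u. f u \<partial>P)"
    and "integrable M (\<lambda>\<omega>. avg n (\<lambda>i. f (V i \<omega>)))"
proof -
  show "integrable M (\<lambda>\<omega>. avg n (\<lambda>i. f (V i \<omega>)))"
    unfolding avg_def using iid_seq_integrable[OF assms(1) _ assms(2)]
    by (intro integrable_scaleR_right Bochner_Integration.integrable_sum) auto
  show "(\<integral>\<omega>. avg n (\<lambda>i. f (V i \<omega>)) \<partial>M) = (\<integral>u. f u \<partial>P)"
    unfolding avg_def
    using iid_seq_integrable[OF assms(1) _ assms(2)] iid_seq_integral[OF assms(1), of _ f] assms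
    by (simp add: Bochner_Integration.integral_sum)
qed

text \<open>Hoeffding's inequality for a sum of variables with values in [-B, B], whose squared
  ranges add up to \<open>4 * n * B\<^sup>2\<close>, at the deviation \<open>n * e\<close>.\<close>

lemma wlln_bounded:
  fixes f :: "'s \<Rightarrow> real"
  assumes "iid_seq M P V" and [measurable]: "f \<in> borel_measurable P" and B: "\<And>u. \<bar>f u\<bar> \<le> B"
    and e: "e > 0" and n: "n \<ge> 1" and "B > 0"
  shows "measure M {\<omega> \<in> space M. e \<le> \<bar>avg n (\<lambda>i. f (V i \<omega>)) - (\<integral>u. f u \<partial>P)\<bar>}
    \<le> 2 * exp (- (real n * e\<^sup>2 / (2 * B\<^sup>2)))"
proof -
  interpret prob_space M using assms(1) by (simp add: iid_seq_def)
  have V[measurable]: "\<And>i. i \<ge> 1 \<Longrightarrow> V i \<in> measurable M P" and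
    iv: "indep_vars (\<lambda>_. P) V {1..}"
    using assms(1) by (auto simp: iid_seq_def)
  interpret H: Hoeffding_ineq M "{1..n}" "\<lambda>i \<omega>. f (V i \<omega>)" "\<lambda>_. -B" "\<lambda>_. B"
     "\<Sum>i\<in>{1..n}. expectation (\<lambda>\<omega>. f (V i \<omega>))"
  proof unfold_locales
    show "indep_vars (\<lambda>_. borel) (\<lambda>i \<omega>. f (V i \<omega>)) {1..n}"
      using indep_vars_compose2[OF indep_vars_subset[OF iv, of "{1..n}"], of "\<lambda>_. f" "\<lambda>_. borel"] by auto
    show "AE x in M. f (V i x) \<in> {- B..B}" for i
      using B[THEN abs_le_D1] B[THEN abs_le_D2] by (intro AE_I2) (auto simp: minus_le_iff)
  qed auto
  have ex: "(\<Sum>i\<in>{1..n}. expectation (\<lambda>\<omega>. f (V i \<omega>))) = real n * (\<integral>u. f u \<partial>P)"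
    using iid_seq_integral[OF assms(1)] by simp
  have "prob {x \<in> space M. real n * e \<le> \<bar>(\<Sum>i = 1..n. f (V i x)) - real n * (\<integral>u. f u \<partial>P)\<bar>}
     \<le> 2 * exp (- 2 * (real n * e)\<^sup>2 / (\<Sum>i = 1..n. (B - - B)\<^sup>2))"
    using H.Hoeffding_ineq_abs_ge[of "real n * e"] e n \<open>B > 0\<close> unfolding ex by simp
  also have "- 2 * (real n * e)\<^sup>2 / (\<Sum>i = 1..n. (B - - B)\<^sup>2) = - (real n * e\<^sup>2 / (2 * B\<^sup>2))"
    using n \<open>B > 0\<close> by (simp add: power2_eq_square field_simps)
  also have "{x \<in> space M. real n * e \<le> \<bar>(\<Sum>i = 1..n. f (V i x)) - real n * (\<integral>u. f u \<partial>P)\<bar>}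
    = {\<omega> \<in> space M. e \<le> \<bar>avg n (\<lambda>i. f (V i \<omega>)) - (\<integral>u. f u \<partial>P)\<bar>}"
  proof -
    have "real n * e \<le> \<bar>s - real n * t\<bar> \<longleftrightarrow> e \<le> \<bar>s / real n - t\<bar>" for s t
    proof -
      have "\<bar>s - real n * t\<bar> = real n * \<bar>s / real n - t\<bar>"
        using n by (simp add: abs_mult[of "real n", simplified, symmetric] field_simps)
      then show ?thesis using n by simp
    qed
    then show ?thesis by (simp add: avg_def)
  qed
  finally show ?thesis .
qed

text \<open>Truncation makes a first moment enough: Hoeffding's inequality handles the truncated
  part \<open>tr B\<close>, and the remainder \<open>r\<close> has small mean, so Markov's
  inequality handles its average.\<close>

theorem weak_law_of_large_numbers:
  fixes f :: "'s \<Rightarrow> real"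
  assumes iid: "iid_seq M P V" and f: "integrable P f"
  shows "((\<lambda>(n, \<omega>). avg n (\<lambda>i. f (V i \<omega>))) \<longlongrightarrow> (\<integral>u. f u \<partial>P)) (in_prob M)"
proof (rule tendstoI)
  interpret M: prob_space M using assms(1) by (simp add: iid_seq_def)
  have [measurable]: "f \<in> borel_measurable P" using f by auto
  have V[measurable]: "\<And>i. i \<ge> 1 \<Longrightarrow> V i \<in> measurable M P" using iid by (auto simp: iid_seq_def)
  interpret P: prob_space P using iid_seq_prob_space[OF iid] by simp
  fix e :: real assume e: "e > 0"
  show "\<forall>\<^sub>F x in in_prob M. dist (case x of (n, \<omega>) \<Rightarrow> avg n (\<lambda>i. f (V i \<omega>))) (\<integral>u. f u \<partial>P) < e"
    unfolding eventually_in_prob[OF M.prob_space_axioms]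
  proof (intro allI impI)
    fix \<delta> :: real assume d: "\<delta> > 0"
    define tr where "tr B u = max (- B) (min B (f u))" for B u
    have trm[measurable]: "tr B \<in> borel_measurable P" for B unfolding tr_def by measurable
    have "(\<lambda>n. \<integral>u. \<bar>f u - tr (real n) u\<bar> \<partial>P) \<longlonglongrightarrow> (\<integral>u. 0 \<partial>P)"
    proof (rule integral_dominated_convergence[where w="\<lambda>u. \<bar>f u\<bar>"])
      show "AE u in P. (\<lambda>n. \<bar>f u - tr (real n) u\<bar>) \<longlonglongrightarrow> 0"
      proof (rule AE_I2)
        fix u
        obtain N :: nat where "\<bar>f u\<bar> \<le> real N" using real_arch_simple by blast
        then have "\<forall>n\<ge>N. \<bar>f u - tr (real n) u\<bar> = 0" by (auto simp: tr_def)
        then show "(\<lambda>n. \<bar>f u - tr (real n) u\<bar>) \<longlonglongrightarrow> 0"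
          by (intro tendsto_eventually) (auto simp: eventually_sequentially)
      qed
      show "AE u in P. norm \<bar>f u - tr (real n) u\<bar> \<le> \<bar>f u\<bar>" for n by (rule AE_I2) (auto simp: tr_def)
    qed (use f in auto)
    then have "(\<lambda>n. \<integral>u. \<bar>f u - tr (real n) u\<bar> \<partial>P) \<longlonglongrightarrow> 0" by simp
    \<comment> \<open>Below \<open>e/3\<close>, the mean of the remainder bounds the bias of
      truncation by a third of \<open>e\<close>; below \<open>\<delta> * e / 6\<close>, Markov's
      inequality at level \<open>e/3\<close> gives an event of probability less than
      \<delta>/2.\<close>
    moreover have "min (e/3) (\<delta> * e / 6) > 0" using e d by simp
    ultimately have "\<forall>\<^sub>F n in sequentially. (\<integral>u. \<bar>f u - tr (real n) u\<bar> \<partial>P) < min (e/3) (\<delta> * e / 6)"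
      by (rule order_tendstoD)
    then have "\<forall>\<^sub>F n in sequentially. (\<integral>u. \<bar>f u - tr (real n) u\<bar> \<partial>P) < min (e/3) (\<delta> * e / 6) \<and> n > 0"
      by (intro eventually_conj eventually_gt_at_top)
    then obtain N :: nat where N: "(\<integral>u. \<bar>f u - tr (real N) u\<bar> \<partial>P) < min (e/3) (\<delta> * e / 6)" "N > 0"
      using eventually_happens'[OF sequentially_bot] by blast
    define B where "B = real N"
    have B: "B > 0" using N by (simp add: B_def)
    have trB: "\<bar>tr B u\<bar> \<le> B" for u using B by (auto simp: tr_def)
    have itr: "integrable P (tr B)" using trB by (intro P.integrable_const_bound[where B=B]) auto
    define r where "r u = \<bar>f u - tr B u\<bar>" for u
    have ir: "integrable P r" unfolding r_def using f itr by auto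
    have r1: "(\<integral>u. r u \<partial>P) < e/3" "(\<integral>u. r u \<partial>P) < \<delta> * e / 6" using N by (auto simp: r_def B_def)
    have "(\<lambda>n. 2 * exp (- (real n * (e/3)\<^sup>2 / (2 * B\<^sup>2)))) \<longlonglongrightarrow> 0"
    proof -
      have "(\<lambda>n. 2 * exp (- ((e/3)\<^sup>2 / (2 * B\<^sup>2))) ^ n) \<longlonglongrightarrow> 2 * 0"
        using e B by (intro tendsto_mult tendsto_const LIMSEQ_realpow_zero) auto
      then show ?thesis by (simp add: exp_of_nat_mult[symmetric] mult.commute)
    qed
    then have "\<forall>\<^sub>F n in sequentially. 2 * exp (- (real n * (e/3)\<^sup>2 / (2 * B\<^sup>2))) < \<delta> / 2"
      by (rule order_tendstoD) (use d in simp)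
    with eventually_ge_at_top[of "1::nat"]
    show "\<forall>\<^sub>F n in sequentially. \<exists>E\<in>sets M. measure M E < \<delta> \<and> (\<forall>\<omega>\<in>space M - E.
        dist (case (n, \<omega>) of (n, \<omega>) \<Rightarrow> avg n (\<lambda>i. f (V i \<omega>))) (\<integral>u. f u \<partial>P) < e)"
    proof eventually_elim
      case (elim n)
      define E1 where "E1 = {\<omega> \<in> space M. e/3 \<le> \<bar>avg n (\<lambda>i. tr B (V i \<omega>)) - (\<integral>u. tr B u \<partial>P)\<bar>}"
      define E2 where "E2 = {\<omega> \<in> space M. e/3 \<le> avg n (\<lambda>i. r (V i \<omega>))}"
      have am: "(\<lambda>\<omega>. avg n (\<lambda>i. tr B (V i \<omega>))) \<in> borel_measurable M"
        and iavg: "integrable M (\<lambda>\<omega>. avg n (\<lambda>i. r (V i \<omega>)))"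
        using integral_avg(2)[OF iid itr elim(1)] integral_avg(2)[OF iid ir elim(1)] by auto
      then have E12: "E1 \<in> sets M" "E2 \<in> sets M" unfolding E1_def E2_def by measurable
      have m1: "measure M E1 < \<delta> / 2"
        unfolding E1_def using wlln_bounded[OF iid trm[of B] trB _ elim(1) B, of "e/3"] e elim(2) by simp
      have rnn: "0 \<le> r u" for u by (simp add: r_def)
      have "measure M E2 \<le> (\<integral>\<omega>. avg n (\<lambda>i. r (V i \<omega>)) \<partial>M) / (e/3)"
        unfolding E2_def
        by (rule integral_Markov_inequality_measure[where A="space M", simplified])
          (use iavg e rnn in \<open>auto simp: avg_def intro!: sum_nonneg divide_nonneg_nonneg\<close>)
      also have "\<dots> < \<delta> / 2" using integral_avg(1)[OF iid ir elim(1)] r1(2) e d by (simp add: field_simps)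
      finally have m2: "measure M E2 < \<delta> / 2" .
      have "measure M (E1 \<union> E2) < \<delta>" using measure_Un_le[OF E12] m1 m2 by linarith
      moreover have "\<bar>avg n (\<lambda>i. f (V i \<omega>)) - (\<integral>u. f u \<partial>P)\<bar> < e" if w: "\<omega> \<in> space M - (E1 \<union> E2)" for \<omega>
      proof -
        have a: "\<bar>avg n (\<lambda>i. tr B (V i \<omega>)) - (\<integral>u. tr B u \<partial>P)\<bar> < e/3" "avg n (\<lambda>i. r (V i \<omega>)) < e/3"
          using w by (auto simp: E1_def E2_def)
        have "\<bar>avg n (\<lambda>i. f (V i \<omega>)) - avg n (\<lambda>i. tr B (V i \<omega>))\<bar> \<le> avg n (\<lambda>i. r (V i \<omega>))"
        proof -
          have "avg n (\<lambda>i. f (V i \<omega>)) - avg n (\<lambda>i. tr B (V i \<omega>)) = (1 / real n) * (\<Sum>i=1..n. f (V i \<omega>) - tr B (V i \<omega>))"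
            by (simp add: avg_def sum_subtractf diff_divide_distrib)
          then show ?thesis
            by (simp add: avg_def r_def abs_mult divide_right_mono sum_abs)
        qed
        moreover have "\<bar>(\<integral>u. f u \<partial>P) - (\<integral>u. tr B u \<partial>P)\<bar> \<le> (\<integral>u. r u \<partial>P)"
        proof -
          have "(\<integral>u. f u \<partial>P) - (\<integral>u. tr B u \<partial>P) = (\<integral>u. f u - tr B u \<partial>P)" using f itr by simp
          then show ?thesis using integral_abs_bound[of P "\<lambda>u. f u - tr B u"] by (simp add: r_def)
        qed
        ultimately show ?thesis using a r1(1) by linarith
      qed
      ultimately show ?case using E12 by (intro bexI[of _ "E1 \<union> E2"]) (auto simp: dist_real_def)
    qed
  qed
qed

subsection \<open>Uniform convergence of weighted empirical processes\<close>

lemma (in finite_measure) decseq_empty_measure_small: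
  assumes "range A \<subseteq> sets M" "decseq A" "(\<Inter>i. A i) = {}" "\<epsilon> > 0"
  shows "\<exists>i::nat. measure M (A i) < \<epsilon>"
proof -
  have "(\<lambda>i. measure M (A i)) \<longlonglongrightarrow> 0"
    using finite_Lim_measure_decseq[OF assms(1,2)] assms(3) by simp
  then have "\<forall>\<^sub>F i in sequentially. measure M (A i) < \<epsilon>"
    by (rule order_tendstoD) (use assms in simp)
  then show ?thesis using eventually_happens'[OF sequentially_bot] by blast
qed

text \<open>
  Bracketing of the half-lines: every \<open>t\<close> has one-sided neighbourhoods of small mass, so has each
  end of the line, and compactness leaves finitely many.
\<close>

lemma finite_half_line_brackets:
  fixes \<mu> :: "real measure"
  assumes "finite_measure \<mu>" and sets: "sets \<mu> = sets borel" and e: "\<epsilon> > 0"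
  obtains B where "finite B"
    "\<And>L U. (L, U) \<in> B \<Longrightarrow> L \<in> sets borel \<and> U \<in> sets borel \<and> L \<subseteq> U \<and> measure \<mu> (U - L) < \<epsilon>"
    "\<And>x. \<exists>L U. (L, U) \<in> B \<and> L \<subseteq> {..x} \<and> {..x} \<subseteq> U"
proof -
  interpret finite_measure \<mu> by fact
  \<comment> \<open>The point \<open>t\<close> may be an atom of large mass, so no neighbourhood
    containing it need be small; only the two open sides are.\<close>
  have near: "\<exists>r>0. measure \<mu> ({t - r<..<t + r} - {t}) < \<epsilon>" for t
  proof -
    have "\<exists>i::nat. measure \<mu> ({t - 1 / real (Suc i)<..<t + 1 / real (Suc i)} - {t}) < \<epsilon>"
    proof (rule decseq_empty_measure_small[OF _ _ _ e])
      show "decseq (\<lambda>i::nat. {t - 1 / real (Suc i)<..<t + 1 / real (Suc i)} - {t})"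
      proof (rule decseq_SucI)
        fix i :: nat
        have "1 / real (Suc (Suc i)) \<le> 1 / real (Suc i)" by (simp add: field_simps)
        then show "{t - 1 / real (Suc (Suc i))<..<t + 1 / real (Suc (Suc i))} - {t}
          \<subseteq> {t - 1 / real (Suc i)<..<t + 1 / real (Suc i)} - {t}" by auto
      qed
      show "(\<Inter>i::nat. {t - 1 / real (Suc i)<..<t + 1 / real (Suc i)} - {t}) = {}"
      proof (rule equals0I)
        fix y assume y: "y \<in> (\<Inter>i::nat. {t - 1 / real (Suc i)<..<t + 1 / real (Suc i)} - {t})"
        then have "\<bar>y - t\<bar> > 0" by auto
        then obtain i :: nat where "1 / real (Suc i) < \<bar>y - t\<bar>" using nat_approx_posE by blast
        moreover from y have "t - 1 / real (Suc i) < y" "y < t + 1 / real (Suc i)" by auto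
        ultimately show False by linarith
      qed
    qed (auto simp: sets)
    then obtain i :: nat where "measure \<mu> ({t - 1 / real (Suc i)<..<t + 1 / real (Suc i)} - {t}) < \<epsilon>" ..
    then show ?thesis by (intro exI[of _ "1 / real (Suc i)"]) simp
  qed
  have "\<exists>i::nat. measure \<mu> {real i<..} < \<epsilon>"
  proof (rule decseq_empty_measure_small[OF _ _ _ e])
    show "(\<Inter>i::nat. {real i<..}) = {}"
    proof (rule equals0I)
      fix y assume y: "y \<in> (\<Inter>i::nat. {real i<..})"
      obtain i :: nat where "y < real i" using reals_Archimedean2 by blast
      moreover from y have "real i < y" by auto
      ultimately show False by simp
    qed
  qed (auto simp: sets decseq_def)
  then obtain top :: nat where top: "measure \<mu> {real top<..} < \<epsilon>" ..
  have "\<exists>i::nat. measure \<mu> {..<- real i} < \<epsilon>"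
  proof (rule decseq_empty_measure_small[OF _ _ _ e])
    show "(\<Inter>i::nat. {..<- real i}) = {}"
    proof (rule equals0I)
      fix y assume y: "y \<in> (\<Inter>i::nat. {..<- real i})"
      obtain i :: nat where "- y < real i" using reals_Archimedean2 by blast
      moreover from y have "y < - real i" by auto
      ultimately show False by simp
    qed
  qed (auto simp: sets decseq_def)
  then obtain bot :: nat where bot: "measure \<mu> {..<- real bot} < \<epsilon>" ..
  obtain \<rho> where \<rho>: "\<And>t. \<rho> t > 0" "\<And>t. measure \<mu> ({t - \<rho> t<..<t + \<rho> t} - {t}) < \<epsilon>" using near by metis
  define l r where "l t = t - \<rho> t" and "r t = t + \<rho> t" for t
  have l: "l t < t" "measure \<mu> {l t<..<t} < \<epsilon>" and r: "r t > t" "measure \<mu> {t<..<r t} < \<epsilon>" for t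
    using \<rho>[of t] by (auto simp: l_def r_def sets intro!: le_less_trans[OF finite_measure_mono \<rho>(2)[of t]])
  have cover: "{- real bot..real top} \<subseteq> (\<Union>t\<in>UNIV. {l t<..<r t})"
    using l(1) r(1) by (meson UN_I UNIV_I greaterThanLessThan_iff subsetI)
  obtain T where T: "finite T" "{- real bot..real top} \<subseteq> (\<Union>t\<in>T. {l t<..<r t})"
    by (rule compactE_image[OF compact_Icc[of "- real bot" "real top"] _ cover]) auto
  \<comment> \<open>Either pair attached to \<open>t\<close> has as difference an open interval on
    one side of \<open>t\<close>, so that an atom at \<open>t\<close> belongs to both members of a
    pair or to neither. The first two pairs serve the points beyond \<open>- bot\<close> and
    \<open>top\<close>.\<close>
  define B where "B = insert ({}, {..<- real bot}) (insert ({..real top}, UNIV)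
     ((\<lambda>t. ({..l t}, {..<t})) ` T \<union> (\<lambda>t. ({..t}, {..<r t})) ` T))"
  have "finite B" using T by (simp add: B_def)
  moreover have "\<forall>(L, U)\<in>B. L \<in> sets borel \<and> U \<in> sets borel \<and> L \<subseteq> U \<and> measure \<mu> (U - L) < \<epsilon>"
  proof -
    have eqs: "{..<t} - {..l t} = {l t<..<t}" "{..<r t} - {..t} = {t<..<r t}" "UNIV - {..u} = {u<..}"
      for t u :: real by auto
    have "l t < t" "t < r t" for t using l(1) r(1) by auto
    then have "{..l t} \<subseteq> {..<t}" "{..t} \<subseteq> {..<r t}" for t
      by (meson atMost_iff lessThan_iff le_less_trans subsetI)+
    then show ?thesis
      unfolding B_def using l(2) r(2) top bot
      by (simp add: eqs ball_Un)
  qed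
  moreover have "\<exists>L U. (L, U) \<in> B \<and> L \<subseteq> {..x} \<and> {..x} \<subseteq> U" for x
  proof -
    consider "x < - real bot" | "x > real top" | "x \<in> {- real bot..real top}" by force
    then show ?thesis
    proof cases
      case 1
      then show ?thesis by (intro exI[of _ "{}"] exI[of _ "{..<- real bot}"]) (auto simp: B_def)
    next
      case 2
      then show ?thesis by (intro exI[of _ "{..real top}"] exI[of _ "UNIV"]) (auto simp: B_def)
    next
      case 3
      then obtain t where t: "t \<in> T" "l t < x" "x < r t" using T by auto
      show ?thesis
      proof (cases "x < t")
        case True
        then show ?thesis using t by (intro exI[of _ "{..l t}"] exI[of _ "{..<t}"]) (auto simp: B_def)
      next
        case False
        then show ?thesis using t by (intro exI[of _ "{..t}"] exI[of _ "{..<r t}"]) (auto simp: B_def)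
      qed
    qed
  qed
  ultimately show ?thesis by (intro that[of B]) auto
qed

section \<open>Averages and products of square-integrable functions\<close>

lemma avg_mono: "(\<And>i. v i \<le> (w i::real)) \<Longrightarrow> avg n v \<le> avg n w"
  by (simp add: avg_def sum_mono divide_right_mono)

lemma abs_avg_le: "\<bar>avg n v\<bar> \<le> avg n (\<lambda>i. \<bar>v i\<bar> :: real)"
  by (simp add: avg_def abs_mult divide_right_mono sum_abs)

lemma abs_mult_le_sum_squares: "\<bar>x * y\<bar> \<le> x\<^sup>2 + (y::real)\<^sup>2"
proof -
  have "0 \<le> (\<bar>x\<bar> - \<bar>y\<bar>)\<^sup>2 + \<bar>x\<bar> * \<bar>y\<bar>" by simp
  then show ?thesis by (simp add: power2_diff abs_mult)
qed

lemma integrable_mult_square_integrable: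
  fixes f g :: "'a \<Rightarrow> real"
  assumes "f \<in> borel_measurable M" "g \<in> borel_measurable M"
    "integrable M (\<lambda>x. (f x)\<^sup>2)" "integrable M (\<lambda>x. (g x)\<^sup>2)"
  shows "integrable M (\<lambda>x. f x * g x)"
proof (rule Bochner_Integration.integrable_bound)
  show "integrable M (\<lambda>x. (f x)\<^sup>2 + (g x)\<^sup>2)" using assms by auto
  show "AE x in M. norm (f x * g x) \<le> norm ((f x)\<^sup>2 + (g x)\<^sup>2)"
    using abs_mult_le_sum_squares by (intro AE_I2) simp
qed (use assms in measurable)

lemma integrable_bounded_mult:
  fixes f \<psi> :: "'a \<Rightarrow> real"
  assumes "integrable M f" "\<psi> \<in> borel_measurable M" "\<And>x. \<bar>\<psi> x\<bar> \<le> 1"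
  shows "integrable M (\<lambda>x. \<psi> x * f x)"
  by (rule Bochner_Integration.integrable_bound[OF assms(1)])
    (use assms in \<open>auto simp: abs_mult mult_left_le_one_le\<close>)

lemma avg_diff: "avg n v - avg n w = avg n (\<lambda>i. v i - w i)"
  by (simp add: avg_def sum_subtractf scaleR_diff_right)

text \<open>The weight \<open>f\<close> may change sign, so the half-lines are bracketed with
  respect to the image under \<open>T\<close> of the measure with density |f|. The error inside a
  bracket is then dominated by the mass of its gap, empirical or exact, and the law of large numbers
  is needed for finitely many averages only.\<close>

theorem weighted_Glivenko_Cantelli:
  fixes f T :: "'s \<Rightarrow> real"
  assumes iid: "iid_seq M P V" and f: "integrable P f" and T[measurable]: "T \<in> borel_measurable P"
  shows "uniform_limit UNIV (\<lambda>(n, \<omega>) x. avg n (\<lambda>i. indicator {..x} (T (V i \<omega>)) * f (V i \<omega>)))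
    (\<lambda>x. \<integral>u. indicator {..x} (T u) * f u \<partial>P) (in_prob M)"
proof (rule uniform_limitI)
  fix \<epsilon> :: real assume e: "\<epsilon> > 0"
  have [measurable]: "f \<in> borel_measurable P" using f by auto
  define \<mu> where "\<mu> = distr (density P (\<lambda>u. ennreal \<bar>f u\<bar>)) borel T"
  have if1: "integrable P (\<lambda>u. indicator A (T u) * f u)" and
    if2: "integrable P (\<lambda>u. indicator A (T u) * \<bar>f u\<bar>)" if [measurable]: "A \<in> sets borel" for A
    by (rule Bochner_Integration.integrable_bound[OF f]; auto simp: indicator_def)+
  have em: "emeasure \<mu> A = ennreal (\<integral>u. indicator A (T u) * \<bar>f u\<bar> \<partial>P)"
    if [measurable]: "A \<in> sets borel" for A
  proof -
    have "emeasure \<mu> A = (\<integral>\<^sup>+u. ennreal \<bar>f u\<bar> * indicator (T -` A \<inter> space P) u \<partial>P)"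
      unfolding \<mu>_def by (simp add: emeasure_distr emeasure_density)
    also have "\<dots> = (\<integral>\<^sup>+u. ennreal (indicator A (T u) * \<bar>f u\<bar>) \<partial>P)"
      by (intro nn_integral_cong) (auto simp: indicator_def)
    also have "\<dots> = ennreal (\<integral>u. indicator A (T u) * \<bar>f u\<bar> \<partial>P)"
      using if2[OF that] by (intro nn_integral_eq_integral) auto
    finally show ?thesis .
  qed
  have me: "measure \<mu> A = (\<integral>u. indicator A (T u) * \<bar>f u\<bar> \<partial>P)" if "A \<in> sets borel" for A
    unfolding measure_def em[OF that] by (simp add: integral_nonneg_AE)
  have "finite_measure \<mu>"
  proof
    show "emeasure \<mu> (space \<mu>) \<noteq> \<infinity>" using em[of UNIV] by (simp add: \<mu>_def)
  qed
  moreover have "sets \<mu> = sets borel" by (simp add: \<mu>_def)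
  moreover have "\<epsilon> / 4 > 0" using e by simp
  ultimately obtain B where B: "finite B"
    "\<And>L U. (L, U) \<in> B \<Longrightarrow> L \<in> sets borel \<and> U \<in> sets borel \<and> L \<subseteq> U \<and> measure \<mu> (U - L) < \<epsilon> / 4"
    "\<And>x. \<exists>L U. (L, U) \<in> B \<and> L \<subseteq> {..x} \<and> {..x} \<subseteq> U"
    by (rule finite_half_line_brackets[of \<mu> "\<epsilon> / 4"]) blast
  define dev where "dev A h p = \<bar>(case p of (n, \<omega>) \<Rightarrow> avg n (\<lambda>i. indicator A (T (V i \<omega>)) * h (V i \<omega>)))
    - (\<integral>u. indicator A (T u) * h u \<partial>P)\<bar>" for A and h :: "'s \<Rightarrow> real" and p
  \<comment> \<open>Four quarters of \<epsilon> are spent: two on the empirical mass of the gap (its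
    exact mass and its deviation), one on the difference of the two integrals, one on the deviation
    at the lower bracket \<open>L\<close>.\<close>
  have "\<forall>\<^sub>F p in in_prob M. \<forall>b\<in>B. dev (fst b) f p < \<epsilon> / 4 \<and> dev (snd b - fst b) (\<lambda>u. \<bar>f u\<bar>) p < \<epsilon> / 4"
  proof (intro eventually_ball_finite[OF B(1)] ballI eventually_conj)
    fix b assume b: "b \<in> B"
    then have s: "fst b \<in> sets borel" "snd b - fst b \<in> sets borel" using B(2)[of "fst b" "snd b"] by auto
    show "\<forall>\<^sub>F p in in_prob M. dev (fst b) f p < \<epsilon> / 4"
      using tendstoD[OF weak_law_of_large_numbers[OF iid if1[OF s(1)]] \<open>\<epsilon> / 4 > 0\<close>] by (simp add: dist_real_def dev_def)
    show "\<forall>\<^sub>F p in in_prob M. dev (snd b - fst b) (\<lambda>u. \<bar>f u\<bar>) p < \<epsilon> / 4"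
      using tendstoD[OF weak_law_of_large_numbers[OF iid if2[OF s(2)]] \<open>\<epsilon> / 4 > 0\<close>] by (simp add: dist_real_def dev_def)
  qed
  then show "\<forall>\<^sub>F p in in_prob M. \<forall>x\<in>UNIV. dist ((case p of (n, \<omega>) \<Rightarrow> \<lambda>x. avg n (\<lambda>i. indicator {..x} (T (V i \<omega>)) * f (V i \<omega>))) x)
     (\<integral>u. indicator {..x} (T u) * f u \<partial>P) < \<epsilon>"
  proof eventually_elim
    case (elim p)
    obtain n \<omega> where p: "p = (n, \<omega>)" by (cases p)
    show ?case
    proof
      fix x :: real
      obtain L U where LU: "(L, U) \<in> B" "L \<subseteq> {..x}" "{..x} \<subseteq> U" using B(3)[of x] by auto
      note b = B(2)[OF LU(1)]
      have ind: "\<bar>indicator {..x} t * y - indicator L t * y\<bar> \<le> indicator (U - L) t * \<bar>y\<bar>" for t y :: real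
        using LU by (auto simp: indicator_def)
      have 1: "\<bar>avg n (\<lambda>i. indicator {..x} (T (V i \<omega>)) * f (V i \<omega>)) - avg n (\<lambda>i. indicator L (T (V i \<omega>)) * f (V i \<omega>))\<bar>
         \<le> avg n (\<lambda>i. indicator (U - L) (T (V i \<omega>)) * \<bar>f (V i \<omega>)\<bar>)"
        unfolding avg_diff using ind by (intro order_trans[OF abs_avg_le] avg_mono)
      have "\<bar>(\<integral>u. indicator {..x} (T u) * f u \<partial>P) - (\<integral>u. indicator L (T u) * f u \<partial>P)\<bar>
        = \<bar>\<integral>u. indicator {..x} (T u) * f u - indicator L (T u) * f u \<partial>P\<bar>"
        using if1[of "{..x}"] if1[of L] b by simp
      also have "\<dots> \<le> (\<integral>u. indicator (U - L) (T u) * \<bar>f u\<bar> \<partial>P)"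
        using if1[of "{..x}"] if1[of L] if2[of "U - L"] b ind
        by (intro order_trans[OF integral_abs_bound] integral_mono) auto
      finally have 2: "\<bar>(\<integral>u. indicator {..x} (T u) * f u \<partial>P) - (\<integral>u. indicator L (T u) * f u \<partial>P)\<bar> < \<epsilon> / 4"
        using b me[of "U - L"] by auto
      from bspec[OF elim LU(1)] have
        3: "\<bar>avg n (\<lambda>i. indicator L (T (V i \<omega>)) * f (V i \<omega>)) - (\<integral>u. indicator L (T u) * f u \<partial>P)\<bar> < \<epsilon> / 4"
        "\<bar>avg n (\<lambda>i. indicator (U - L) (T (V i \<omega>)) * \<bar>f (V i \<omega>)\<bar>) - (\<integral>u. indicator (U - L) (T u) * \<bar>f u\<bar> \<partial>P)\<bar> < \<epsilon> / 4"
        by (auto simp: p dev_def)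
      have "(\<integral>u. indicator (U - L) (T u) * \<bar>f u\<bar> \<partial>P) < \<epsilon> / 4" using b me[of "U - L"] by auto
      with 1 2 3 show "dist ((case p of (n, \<omega>) \<Rightarrow> \<lambda>x. avg n (\<lambda>i. indicator {..x} (T (V i \<omega>)) * f (V i \<omega>))) x)
         (\<integral>u. indicator {..x} (T u) * f u \<partial>P) < \<epsilon>"
        unfolding p dist_real_def prod.case by linarith
    qed
  qed
qed

subsection \<open>Second moments of kernel averages of noise\<close>

text \<open>
  For a binomial count \<open>S\<close> with mean at least \<open>m p\<close>, bound \<open>1 / (1 + S)\<^sup>2\<close> by \<open>16 / (m p)\<^sup>2\<close> when
  \<open>S \<ge> m p / 4\<close> and by the exponential weight \<open>exp (m p / 4) 2\<^sup>-\<^sup>S\<close> otherwise; the latter factorizes.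
\<close>

lemma nn_integral_inverse_square_count_le:
  assumes "prob_space P" and A[measurable]: "A \<in> sets P" and p: "p \<le> measure P A" "p > 0"
    and L: "finite L" "card L \<ge> 1"
  shows "(\<integral>\<^sup>+x. ennreal (1 / (1 + real (card {l\<in>L. x l \<in> A}))\<^sup>2) \<partial>PiM L (\<lambda>_. P))
    \<le> ennreal (48 / (real (card L) * p)\<^sup>2)"
proof -
  interpret P: prob_space P by fact
  interpret PP: product_prob_space "\<lambda>_. P" L by unfold_locales
  define y where "y = real (card L) * p"
  have y: "y > 0" using L p by (auto simp: y_def)
  have pw: "1 / (1 + real (card {l\<in>L. x l \<in> A}))\<^sup>2
     \<le> 16 / y\<^sup>2 + exp (y / 4) * (\<Prod>l\<in>L. if x l \<in> A then 1 / 2 else 1)" for x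
  proof -
    define S where "S = card {l\<in>L. x l \<in> A}"
    have pr: "(\<Prod>l\<in>L. if x l \<in> A then 1 / 2 else 1) = (1 / 2 :: real) ^ S"
      using L(1) by (simp add: S_def prod.If_cases Int_def)
    show ?thesis
    proof (cases "real S \<ge> y / 4")
      case True
      then have "(y / 4)\<^sup>2 \<le> (1 + real S)\<^sup>2" using y by (intro power_mono) auto
      then have "1 / (1 + real S)\<^sup>2 \<le> 1 / (y / 4)\<^sup>2" using y by (intro divide_left_mono) auto
      also have "\<dots> = 16 / y\<^sup>2" by (simp add: power_divide)
      also have "\<dots> \<le> 16 / y\<^sup>2 + exp (y / 4) * (1 / 2) ^ S" by simp
      finally show ?thesis unfolding pr S_def .
    next
      case False
      have "(2::real) ^ S \<le> exp 1 ^ S" using exp_ge_add_one_self[of 1] by (intro power_mono) auto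
      also have "\<dots> = exp (real S)" by (simp add: exp_of_nat_mult[symmetric])
      also have "\<dots> \<le> exp (y / 4)" using False by simp
      finally have "1 \<le> exp (y / 4) * (1 / 2) ^ S" by (simp add: power_divide)
      moreover have "1 / (1 + real S)\<^sup>2 \<le> 1" by (simp add: divide_le_eq)
      moreover have "0 \<le> 16 / y\<^sup>2" by simp
      ultimately show ?thesis unfolding pr S_def by linarith
    qed
  qed
  \<comment> \<open>Each coordinate contributes \<open>1 - P(A)/2\<close>, at most exp(-p/2). The
    product exp(-y/2) beats the factor exp(y/4) of the exponential weight and leaves
    exp(-y/4).\<close>
  have one: "(\<integral>\<^sup>+u. ennreal (if u \<in> A then 1 / 2 else 1) \<partial>P) \<le> ennreal (exp (- (p / 2)))"
  proof -
    have "(\<integral>\<^sup>+u. ennreal (if u \<in> A then 1 / 2 else 1) \<partial>P) = ennreal (\<integral>u. (if u \<in> A then 1 / 2 else 1) \<partial>P)"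
      by (intro nn_integral_eq_integral P.integrable_const_bound[where B=1]) auto
    also have "(\<integral>u. (if u \<in> A then 1 / 2 else 1) \<partial>P) = (\<integral>u. 1 - indicat_real A u / 2 \<partial>P)"
      by (intro Bochner_Integration.integral_cong) (auto simp: indicator_def)
    also have "\<dots> = 1 - measure P A / 2"
      using A by (subst Bochner_Integration.integral_diff)
        (auto simp: P.prob_space intro!: integrable_real_indicator simp: less_top[symmetric])
    also have "\<dots> \<le> 1 + (- (p / 2))" using p by simp
    also have "\<dots> \<le> exp (- (p / 2))" by (rule exp_ge_add_one_self)
    finally show ?thesis by (simp add: ennreal_leI)
  qed
  have "(\<integral>\<^sup>+x. (\<Prod>l\<in>L. ennreal (if x l \<in> A then 1 / 2 else 1)) \<partial>PiM L (\<lambda>_. P))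
     = (\<Prod>l\<in>L. \<integral>\<^sup>+u. ennreal (if u \<in> A then 1 / 2 else 1) \<partial>P)"
    using L by (intro PP.product_nn_integral_prod) auto
  also have "\<dots> \<le> (\<Prod>l\<in>L. ennreal (exp (- (p / 2))))"
    using one by (intro prod_mono_ennreal)
  also have "\<dots> = ennreal (exp (- (y / 2)))"
    by (simp add: ennreal_power y_def exp_of_nat_mult[symmetric] algebra_simps)
  finally have prod_le: "(\<integral>\<^sup>+x. (\<Prod>l\<in>L. ennreal (if x l \<in> A then 1 / 2 else 1)) \<partial>PiM L (\<lambda>_. P))
    \<le> ennreal (exp (- (y / 2)))" .
  have "(\<integral>\<^sup>+x. ennreal (1 / (1 + real (card {l\<in>L. x l \<in> A}))\<^sup>2) \<partial>PiM L (\<lambda>_. P))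
    \<le> (\<integral>\<^sup>+x. ennreal (16 / y\<^sup>2) + ennreal (exp (y / 4)) * (\<Prod>l\<in>L. ennreal (if x l \<in> A then 1 / 2 else 1)) \<partial>PiM L (\<lambda>_. P))"
  proof (intro nn_integral_mono)
    fix x
    have nn: "0 \<le> (\<Prod>l\<in>L. if x l \<in> A then 1 / 2 else (1::real))" by (intro prod_nonneg) auto
    have "ennreal (1 / (1 + real (card {l\<in>L. x l \<in> A}))\<^sup>2)
      \<le> ennreal (16 / y\<^sup>2 + exp (y / 4) * (\<Prod>l\<in>L. if x l \<in> A then 1 / 2 else 1))"
      by (intro ennreal_leI pw)
    also have "\<dots> = ennreal (16 / y\<^sup>2) + ennreal (exp (y / 4)) * ennreal (\<Prod>l\<in>L. if x l \<in> A then 1 / 2 else 1)"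
      using nn by (simp add: ennreal_plus ennreal_mult)
    also have "ennreal (\<Prod>l\<in>L. if x l \<in> A then 1 / 2 else 1) = (\<Prod>l\<in>L. ennreal (if x l \<in> A then 1 / 2 else 1))"
      by (intro prod_ennreal[symmetric]) auto
    finally show "ennreal (1 / (1 + real (card {l\<in>L. x l \<in> A}))\<^sup>2)
      \<le> ennreal (16 / y\<^sup>2) + ennreal (exp (y / 4)) * (\<Prod>l\<in>L. ennreal (if x l \<in> A then 1 / 2 else 1))" .
  qed
  also have "\<dots> = ennreal (16 / y\<^sup>2) + ennreal (exp (y / 4)) * (\<integral>\<^sup>+x. (\<Prod>l\<in>L. ennreal (if x l \<in> A then 1 / 2 else 1)) \<partial>PiM L (\<lambda>_. P))"
    using L by (subst nn_integral_add) (auto simp: nn_integral_cmult PP.P.emeasure_space_1)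
  also have "\<dots> \<le> ennreal (16 / y\<^sup>2) + ennreal (exp (y / 4)) * ennreal (exp (- (y / 2)))"
    by (intro add_left_mono mult_left_mono prod_le) simp
  also have "ennreal (16 / y\<^sup>2) + ennreal (exp (y / 4)) * ennreal (exp (- (y / 2))) = ennreal (16 / y\<^sup>2 + exp (- (y / 4)))"
    by (simp flip: ennreal_plus ennreal_mult exp_add)
  also have "\<dots> \<le> ennreal (48 / y\<^sup>2)"
  proof (rule ennreal_leI)
    \<comment> \<open>From exp t \<ge> t^2/2 at t = y/4, the exponential term is at most
      \<open>32 / y\<^sup>2\<close>; with the 16 of the other case this makes 48.\<close>
    have "(y / 4)\<^sup>2 / 2 \<le> exp (y / 4)" using exp_lower_Taylor_quadratic[of "y / 4"] y by simp
    then have "exp (- (y / 4)) \<le> 1 / ((y / 4)\<^sup>2 / 2)" using y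
      by (simp add: exp_minus divide_simps)
    also have "\<dots> = 32 / y\<^sup>2" by (simp add: power_divide)
    finally show "16 / y\<^sup>2 + exp (- (y / 4)) \<le> 48 / y\<^sup>2" by simp
  qed
  finally show ?thesis unfolding y_def .
qed

text \<open>The Nadaraya-Watson weight given to point \<open>j\<close> in the local average around
  point \<open>i\<close>. A vanishing denominator yields the value 0.\<close>

definition nw_weight :: "('h \<Rightarrow> 'h \<Rightarrow> real) \<Rightarrow> nat set \<Rightarrow> (nat \<Rightarrow> 'h) \<Rightarrow> nat \<Rightarrow> nat \<Rightarrow> real" where
  "nw_weight \<kappa> I v i j = \<kappa> (v i) (v j) / (\<Sum>l\<in>I. \<kappa> (v i) (v l))"

lemma nw_weight_bounds:
  assumes "\<And>x y. 0 \<le> \<kappa> x y" "finite I" "j \<in> I"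
  shows "0 \<le> nw_weight \<kappa> I v i j" "nw_weight \<kappa> I v i j \<le> 1"
proof -
  have "\<kappa> (v i) (v j) \<le> (\<Sum>l\<in>I. \<kappa> (v i) (v l))"
    using assms by (intro member_le_sum) auto
  moreover have "0 \<le> (\<Sum>l\<in>I. \<kappa> (v i) (v l))" using assms by (intro sum_nonneg) auto
  ultimately show "nw_weight \<kappa> I v i j \<le> 1" "0 \<le> nw_weight \<kappa> I v i j"
    using assms by (auto simp: nw_weight_def divide_le_eq_1)
qed

text \<open>In the application \<open>p\<close> and \<open>p'\<close> are multiples of the
  small-ball function at the bandwidth: \<open>p\<close> bounds from below the mass on which the
  kernel reaches the level \<open>\<kappa>\<^sub>0\<close>, and \<open>p'\<close> bounds from above
  the mass of its support. The second alternative in \<open>\<kappa>_diag\<close> admits kernels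
  that are cut off to 0 outside a given set.\<close>

locale kernel_smoother = prob_space P for P :: "'s measure" +
  fixes \<pi> :: "'s \<Rightarrow> 'h::second_countable_topology" and \<kappa> :: "'h \<Rightarrow> 'h \<Rightarrow> real"
    and B \<kappa>\<^sub>0 p p' :: real
  assumes \<pi>_measurable[measurable]: "\<pi> \<in> borel_measurable P"
    and \<kappa>_measurable[measurable]: "(\<lambda>(x, y). \<kappa> x y) \<in> borel_measurable (borel \<Otimes>\<^sub>M borel)"
    and \<kappa>_nonneg: "\<And>x y. 0 \<le> \<kappa> x y" and \<kappa>_le: "\<And>x y. \<kappa> x y \<le> B"
    and \<kappa>\<^sub>0_pos: "\<kappa>\<^sub>0 > 0" and p_pos: "p > 0" and p'_nonneg: "p' \<ge> 0"
    and \<kappa>_diag: "\<And>x. \<kappa>\<^sub>0 \<le> \<kappa> x x \<or> (\<forall>y. \<kappa> x y = 0)"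
    and mass_ge: "\<And>x. \<kappa>\<^sub>0 \<le> \<kappa> x x \<Longrightarrow> p \<le> prob {u \<in> space P. \<kappa>\<^sub>0 \<le> \<kappa> x (\<pi> u)}"
    and mass_le: "\<And>y. prob {u \<in> space P. \<kappa> (\<pi> u) y \<noteq> 0} \<le> p'"
begin

abbreviation w where "w I x i j \<equiv> nw_weight \<kappa> I (\<lambda>l. \<pi> (x l)) i j"

lemma \<kappa>_measurable'[measurable (raw)]:
  "f \<in> borel_measurable N \<Longrightarrow> g \<in> borel_measurable N \<Longrightarrow> (\<lambda>z. \<kappa> (f z) (g z)) \<in> borel_measurable N"
  using measurable_compose[OF _ \<kappa>_measurable, of "\<lambda>z. (f z, g z)" N] by simp

lemma w_measurable:
  assumes "i \<in> I" "j \<in> I"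
  shows "(\<lambda>x. w I x i j) \<in> borel_measurable (PiM I (\<lambda>_. P))"
  unfolding nw_weight_def using assms by measurable

text \<open>The point \<open>i\<close> itself and every counted point of \<open>L\<close> add at
  least \<open>\<kappa>\<^sub>0\<close> to the denominator. The indicator of a nonzero numerator is
  retained because integrating it later yields the factor \<open>p'\<close>; \<open>L\<close> omits
  \<open>i\<close> so that the count stays random when \<open>i\<close> is frozen.\<close>

lemma nw_weight_square_le:
  assumes "finite I" "i \<in> I" "L \<subseteq> I - {i}"
  shows "(nw_weight \<kappa> I v i j)\<^sup>2
    \<le> (B / \<kappa>\<^sub>0)\<^sup>2 * of_bool (\<kappa> (v i) (v j) \<noteq> 0) * (1 / (1 + real (card {l\<in>L. \<kappa>\<^sub>0 \<le> \<kappa> (v i) (v l)}))\<^sup>2)"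
proof (cases "\<kappa>\<^sub>0 \<le> \<kappa> (v i) (v i) \<and> \<kappa> (v i) (v j) \<noteq> 0")
  case False
  then have "\<kappa> (v i) (v j) = 0" using \<kappa>_diag[of "v i"] by auto
  then show ?thesis by (simp add: nw_weight_def)
next
  case True
  define S where "S = card {l\<in>L. \<kappa>\<^sub>0 \<le> \<kappa> (v i) (v l)}"
  have fL: "finite L" using assms finite_subset by blast
  have "\<kappa>\<^sub>0 * real S = (\<Sum>l\<in>{l\<in>L. \<kappa>\<^sub>0 \<le> \<kappa> (v i) (v l)}. \<kappa>\<^sub>0)" by (simp add: S_def)
  also have "\<dots> \<le> (\<Sum>l\<in>{l\<in>L. \<kappa>\<^sub>0 \<le> \<kappa> (v i) (v l)}. \<kappa> (v i) (v l))" by (intro sum_mono) auto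
  also have "\<dots> \<le> (\<Sum>l\<in>I-{i}. \<kappa> (v i) (v l))"
    using assms \<kappa>_nonneg by (intro sum_mono2) auto
  finally have "\<kappa>\<^sub>0 * (1 + real S) \<le> \<kappa> (v i) (v i) + (\<Sum>l\<in>I-{i}. \<kappa> (v i) (v l))"
    using True by (simp add: algebra_simps)
  also have "\<dots> = (\<Sum>l\<in>I. \<kappa> (v i) (v l))" using assms by (simp add: sum.remove)
  finally have D: "\<kappa>\<^sub>0 * (1 + real S) \<le> (\<Sum>l\<in>I. \<kappa> (v i) (v l))" .
  have "0 < \<kappa>\<^sub>0 * (1 + real S)" using \<kappa>\<^sub>0_pos by simp
  moreover have "0 \<le> B" using order_trans[OF \<kappa>_nonneg \<kappa>_le] .
  ultimately have "nw_weight \<kappa> I v i j \<le> B / (\<kappa>\<^sub>0 * (1 + real S))"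
    unfolding nw_weight_def using D \<kappa>_nonneg \<kappa>_le by (intro frac_le) auto
  moreover have "0 \<le> nw_weight \<kappa> I v i j"
    unfolding nw_weight_def using \<kappa>_nonneg by (intro divide_nonneg_nonneg sum_nonneg) auto
  ultimately have "(nw_weight \<kappa> I v i j)\<^sup>2 \<le> (B / (\<kappa>\<^sub>0 * (1 + real S)))\<^sup>2" by (rule power_mono)
  also have "\<dots> = (B / \<kappa>\<^sub>0)\<^sup>2 * (1 / (1 + real S)\<^sup>2)" by (simp add: power_divide power_mult_distrib)
  finally show ?thesis using True by (simp add: S_def)
qed

lemma count_le:
  assumes "finite L" "card L \<ge> 1"
  shows "(\<integral>\<^sup>+x. ennreal (of_bool (\<kappa> y z \<noteq> 0) * (1 / (1 + real (card {l\<in>L. \<kappa>\<^sub>0 \<le> \<kappa> y (\<pi> (x l))}))\<^sup>2)) \<partial>PiM L (\<lambda>_. P))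
    \<le> ennreal (48 / (real (card L) * p)\<^sup>2) * indicator {z. \<kappa> y z \<noteq> 0} z"
proof (cases "\<kappa>\<^sub>0 \<le> \<kappa> y y")
  case False
  then show ?thesis using \<kappa>_diag[of y] by simp
next
  case True
  let ?A = "{u \<in> space P. \<kappa>\<^sub>0 \<le> \<kappa> y (\<pi> u)}"
  have A: "?A \<in> sets P" by measurable
  have "(\<integral>\<^sup>+x. ennreal (1 / (1 + real (card {l\<in>L. \<kappa>\<^sub>0 \<le> \<kappa> y (\<pi> (x l))}))\<^sup>2) \<partial>PiM L (\<lambda>_. P))
    = (\<integral>\<^sup>+x. ennreal (1 / (1 + real (card {l\<in>L. x l \<in> ?A}))\<^sup>2) \<partial>PiM L (\<lambda>_. P))"
    by (intro nn_integral_cong arg_cong[where f=ennreal] arg_cong[where f="\<lambda>s. 1 / (1 + real (card s))\<^sup>2"])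
      (auto simp: space_PiM PiE_def Pi_def)
  also have "\<dots> \<le> ennreal (48 / (real (card L) * p)\<^sup>2)"
    by (intro nn_integral_inverse_square_count_le prob_space_axioms A mass_ge True p_pos assms)
  finally show ?thesis by (cases "\<kappa> y z = 0") auto
qed

lemma nn_integral_section_le:
  assumes I: "finite I" "i \<in> I" and L: "L \<subseteq> I - {i}" "card L \<ge> 1" and a: "a \<ge> 0"
    and v: "\<And>x. v x i = y" "\<And>x. v x j = z" "\<And>x l. l \<in> L \<Longrightarrow> v x l = \<pi> (x l)"
  shows "(\<integral>\<^sup>+x. ennreal ((nw_weight \<kappa> I (v x) i j)\<^sup>2 * a) \<partial>PiM L (\<lambda>_. P))
    \<le> ennreal ((B / \<kappa>\<^sub>0)\<^sup>2) * ennreal a * (ennreal (48 / (real (card L) * p)\<^sup>2) * indicator {z. \<kappa> y z \<noteq> 0} z)"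
proof -
  have fL: "finite L" using I(1) L(1) finite_subset by blast
  define \<tau> where "\<tau> x = of_bool (\<kappa> y z \<noteq> 0) * (1 / (1 + real (card {l\<in>L. \<kappa>\<^sub>0 \<le> \<kappa> y (\<pi> (x l))}))\<^sup>2)" for x
  have \<tau>0: "0 \<le> \<tau> x" for x by (simp add: \<tau>_def)
  have "(\<integral>\<^sup>+x. ennreal ((nw_weight \<kappa> I (v x) i j)\<^sup>2 * a) \<partial>PiM L (\<lambda>_. P))
    \<le> (\<integral>\<^sup>+x. ennreal ((B / \<kappa>\<^sub>0)\<^sup>2) * ennreal a * ennreal (\<tau> x) \<partial>PiM L (\<lambda>_. P))"
  proof (intro nn_integral_mono)
    fix x
    have "{l\<in>L. \<kappa>\<^sub>0 \<le> \<kappa> (v x i) (v x l)} = {l\<in>L. \<kappa>\<^sub>0 \<le> \<kappa> y (\<pi> (x l))}" using v by auto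
    then have "(nw_weight \<kappa> I (v x) i j)\<^sup>2 \<le> (B / \<kappa>\<^sub>0)\<^sup>2 * \<tau> x"
      using nw_weight_square_le[OF I L(1), of "v x" j] by (simp add: \<tau>_def v mult.assoc)
    then have "(nw_weight \<kappa> I (v x) i j)\<^sup>2 * a \<le> (B / \<kappa>\<^sub>0)\<^sup>2 * \<tau> x * a" using a by (rule mult_right_mono)
    then show "ennreal ((nw_weight \<kappa> I (v x) i j)\<^sup>2 * a) \<le> ennreal ((B / \<kappa>\<^sub>0)\<^sup>2) * ennreal a * ennreal (\<tau> x)"
      using a \<tau>0 by (simp add: ennreal_mult[symmetric] mult_ac ennreal_leI)
  qed
  also have "\<dots> = ennreal ((B / \<kappa>\<^sub>0)\<^sup>2) * ennreal a * (\<integral>\<^sup>+x. ennreal (\<tau> x) \<partial>PiM L (\<lambda>_. P))"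
    unfolding \<tau>_def using fL by (intro nn_integral_cmult) measurable
  also have "\<dots> \<le> ennreal ((B / \<kappa>\<^sub>0)\<^sup>2) * ennreal a * (ennreal (48 / (real (card L) * p)\<^sup>2) * indicator {z. \<kappa> y z \<noteq> 0} z)"
    unfolding \<tau>_def by (intro mult_left_mono count_le fL L(2)) simp
  finally show ?thesis .
qed

text \<open>The points other than \<open>i\<close> and \<open>j\<close> are integrated out first,
  then \<open>i\<close>, then \<open>j\<close>. As \<open>f\<close> sees only \<open>j\<close>, the
  integral over \<open>i\<close> meets just the indicator that the kernel at \<open>(i, j)\<close>
  is nonzero, and this is the source of the factor \<open>p'\<close>.\<close>

lemma nn_integral_w_offdiag_le:
  assumes I: "finite I" "i \<in> I" "j \<in> I" "i \<noteq> j" "card I \<ge> 3" and f[measurable]: "f \<in> borel_measurable P"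
  shows "(\<integral>\<^sup>+x. ennreal ((w I x i j)\<^sup>2 * (f (x j))\<^sup>2) \<partial>PiM I (\<lambda>_. P))
    \<le> ennreal ((B / \<kappa>\<^sub>0)\<^sup>2 * (48 / (real (card I - 2) * p)\<^sup>2) * p') * (\<integral>\<^sup>+u. ennreal ((f u)\<^sup>2) \<partial>P)"
proof -
  define L where "L = I - {i, j}"
  have L: "finite L" "i \<notin> L" "j \<notin> insert i L" "I = insert j (insert i L)" "L \<subseteq> I - {i}" "card L = card I - 2"
    using I by (auto simp: L_def card_Diff_subset)
  interpret PP: product_prob_space "\<lambda>_. P" by unfold_locales
  have [measurable]: "(\<lambda>x. w I x i j) \<in> borel_measurable (PiM I (\<lambda>_. P))"
    using I by (intro w_measurable)
  let ?c = "ennreal ((B / \<kappa>\<^sub>0)\<^sup>2)" and ?q = "ennreal (48 / (real (card L) * p)\<^sup>2)"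
  have I': "I = insert i (insert j L)" using L by auto
  have meas: "(\<lambda>x. ennreal ((w I x i j)\<^sup>2 * (f (x j))\<^sup>2)) \<in> borel_measurable (PiM (insert j (insert i L)) (\<lambda>_. P))"
    unfolding L(4)[symmetric] using I by measurable
  have upd: "(\<lambda>x. x(j := u)) \<in> measurable (PiM (insert i L) (\<lambda>_. P)) (PiM (insert j (insert i L)) (\<lambda>_. P))"
    if "u \<in> space P" for u
    using that by (intro measurable_fun_upd[where J="insert i L"]) auto
  have "(\<integral>\<^sup>+x. ennreal ((w I x i j)\<^sup>2 * (f (x j))\<^sup>2) \<partial>PiM I (\<lambda>_. P))
     = (\<integral>\<^sup>+u. (\<integral>\<^sup>+x. ennreal ((w I (x(j := u)) i j)\<^sup>2 * (f u)\<^sup>2) \<partial>PiM (insert i L) (\<lambda>_. P)) \<partial>P)"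
    using PP.product_nn_integral_insert_rev[OF _ L(3) meas] L(1) by (simp add: L(4)[symmetric])
  also have "\<dots> = (\<integral>\<^sup>+u. (\<integral>\<^sup>+v. (\<integral>\<^sup>+x. ennreal ((w I (x(i := v, j := u)) i j)\<^sup>2 * (f u)\<^sup>2) \<partial>PiM L (\<lambda>_. P)) \<partial>P) \<partial>P)"
  proof (intro nn_integral_cong)
    fix u assume u: "u \<in> space P"
    have "(\<lambda>x. ennreal ((w I (x(j := u)) i j)\<^sup>2 * (f u)\<^sup>2)) \<in> borel_measurable (PiM (insert i L) (\<lambda>_. P))"
      using measurable_compose[OF upd[OF u] meas] by simp
    from PP.product_nn_integral_insert_rev[OF L(1,2) this]
    show "(\<integral>\<^sup>+x. ennreal ((w I (x(j := u)) i j)\<^sup>2 * (f u)\<^sup>2) \<partial>PiM (insert i L) (\<lambda>_. P)) =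
      (\<integral>\<^sup>+v. (\<integral>\<^sup>+x. ennreal ((w I (x(i := v, j := u)) i j)\<^sup>2 * (f u)\<^sup>2) \<partial>PiM L (\<lambda>_. P)) \<partial>P)" .
  qed
  also have "\<dots> \<le> (\<integral>\<^sup>+u. (\<integral>\<^sup>+v. ?c * ennreal ((f u)\<^sup>2) * (?q * indicator {v \<in> space P. \<kappa> (\<pi> v) (\<pi> u) \<noteq> 0} v) \<partial>P) \<partial>P)"
  proof (intro nn_integral_mono)
    fix u v assume u: "u \<in> space P" and v: "v \<in> space P"
    have "(\<integral>\<^sup>+x. ennreal ((w I (x(i := v, j := u)) i j)\<^sup>2 * (f u)\<^sup>2) \<partial>PiM L (\<lambda>_. P))
      \<le> ?c * ennreal ((f u)\<^sup>2) * (?q * indicator {z. \<kappa> (\<pi> v) z \<noteq> 0} (\<pi> u))"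
      by (rule nn_integral_section_le[OF I(1,2) L(5)]) (use I(4,5) L(2,3,6) in auto)
    also have "indicator {z. \<kappa> (\<pi> v) z \<noteq> 0} (\<pi> u) = (indicator {v \<in> space P. \<kappa> (\<pi> v) (\<pi> u) \<noteq> 0} v :: ennreal)"
      using v by (simp add: indicator_def)
    finally show "(\<integral>\<^sup>+x. ennreal ((w I (x(i := v, j := u)) i j)\<^sup>2 * (f u)\<^sup>2) \<partial>PiM L (\<lambda>_. P))
      \<le> ?c * ennreal ((f u)\<^sup>2) * (?q * indicator {v \<in> space P. \<kappa> (\<pi> v) (\<pi> u) \<noteq> 0} v)" .
  qed
  also have "\<dots> = (\<integral>\<^sup>+u. ?c * ennreal ((f u)\<^sup>2) * (?q * emeasure P {v \<in> space P. \<kappa> (\<pi> v) (\<pi> u) \<noteq> 0}) \<partial>P)"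
  proof (intro nn_integral_cong)
    fix u assume "u \<in> space P"
    then have [measurable]: "{v \<in> space P. \<kappa> (\<pi> v) (\<pi> u) \<noteq> 0} \<in> sets P" by measurable
    show "(\<integral>\<^sup>+v. ?c * ennreal ((f u)\<^sup>2) * (?q * indicator {v \<in> space P. \<kappa> (\<pi> v) (\<pi> u) \<noteq> 0} v) \<partial>P)
      = ?c * ennreal ((f u)\<^sup>2) * (?q * emeasure P {v \<in> space P. \<kappa> (\<pi> v) (\<pi> u) \<noteq> 0})"
      by (simp add: nn_integral_cmult)
  qed
  also have "\<dots> \<le> (\<integral>\<^sup>+u. ?c * ennreal ((f u)\<^sup>2) * (?q * ennreal p') \<partial>P)"
    using mass_le by (intro nn_integral_mono mult_left_mono) (auto simp: emeasure_eq_measure intro!: ennreal_leI)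
  also have "\<dots> = (\<integral>\<^sup>+u. (?c * ?q * ennreal p') * ennreal ((f u)\<^sup>2) \<partial>P)"
    by (intro nn_integral_cong) (simp add: mult_ac)
  also have "\<dots> = (?c * ?q * ennreal p') * (\<integral>\<^sup>+u. ennreal ((f u)\<^sup>2) \<partial>P)"
    by (intro nn_integral_cmult) measurable
  also have "?c * ?q * ennreal p' = ennreal ((B / \<kappa>\<^sub>0)\<^sup>2 * (48 / (real (card I - 2) * p)\<^sup>2) * p')"
    unfolding L(6) using p'_nonneg by (subst ennreal_mult[symmetric], simp, simp)+ simp
  finally show ?thesis .
qed

text \<open>Only one point is frozen, so there is no second position to integrate and no factor
  \<open>p'\<close> is gained; this is affordable because a row has a single diagonal term.\<close>

lemma nn_integral_w_diag_le:
  assumes I: "finite I" "i \<in> I" "card I \<ge> 2" and f[measurable]: "f \<in> borel_measurable P"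
  shows "(\<integral>\<^sup>+x. ennreal ((w I x i i)\<^sup>2 * (f (x i))\<^sup>2) \<partial>PiM I (\<lambda>_. P))
    \<le> ennreal ((B / \<kappa>\<^sub>0)\<^sup>2 * (48 / (real (card I - 1) * p)\<^sup>2)) * (\<integral>\<^sup>+u. ennreal ((f u)\<^sup>2) \<partial>P)"
proof -
  define L where "L = I - {i}"
  have L: "finite L" "i \<notin> L" "I = insert i L" "L \<subseteq> I - {i}" "card L = card I - 1"
    using I by (auto simp: L_def card_Diff_subset)
  interpret PP: product_prob_space "\<lambda>_. P" by unfold_locales
  have [measurable]: "(\<lambda>x. w I x i i) \<in> borel_measurable (PiM I (\<lambda>_. P))"
    using I by (intro w_measurable)
  let ?c = "ennreal ((B / \<kappa>\<^sub>0)\<^sup>2)" and ?q = "ennreal (48 / (real (card L) * p)\<^sup>2)"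
  have meas: "(\<lambda>x. ennreal ((w I x i i)\<^sup>2 * (f (x i))\<^sup>2)) \<in> borel_measurable (PiM (insert i L) (\<lambda>_. P))"
    unfolding L(3)[symmetric] using I by measurable
  have "(\<integral>\<^sup>+x. ennreal ((w I x i i)\<^sup>2 * (f (x i))\<^sup>2) \<partial>PiM I (\<lambda>_. P))
     = (\<integral>\<^sup>+u. (\<integral>\<^sup>+x. ennreal ((w I (x(i := u)) i i)\<^sup>2 * (f u)\<^sup>2) \<partial>PiM L (\<lambda>_. P)) \<partial>P)"
    using PP.product_nn_integral_insert_rev[OF L(1,2) meas] by (simp add: L(3)[symmetric])
  also have "\<dots> \<le> (\<integral>\<^sup>+u. (?c * ?q) * ennreal ((f u)\<^sup>2) \<partial>P)"
  proof (intro nn_integral_mono)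
    fix u assume u: "u \<in> space P"
    have "(\<integral>\<^sup>+x. ennreal ((w I (x(i := u)) i i)\<^sup>2 * (f u)\<^sup>2) \<partial>PiM L (\<lambda>_. P))
      \<le> ?c * ennreal ((f u)\<^sup>2) * (?q * indicator {z. \<kappa> (\<pi> u) z \<noteq> 0} (\<pi> u))"
      by (rule nn_integral_section_le[OF I(1,2) L(4)]) (use I(3) L(2,5) in auto)
    also have "\<dots> \<le> (?c * ?q) * ennreal ((f u)\<^sup>2)"
    proof -
      have "?c * ennreal ((f u)\<^sup>2) * (?q * indicator {z. \<kappa> (\<pi> u) z \<noteq> 0} (\<pi> u)) \<le> ?c * ennreal ((f u)\<^sup>2) * (?q * 1)"
        by (intro mult_left_mono) (simp_all split: split_indicator)
      then show ?thesis unfolding mult_1_right by (simp only: mult_ac)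
    qed
    finally show "(\<integral>\<^sup>+x. ennreal ((w I (x(i := u)) i i)\<^sup>2 * (f u)\<^sup>2) \<partial>PiM L (\<lambda>_. P))
      \<le> (?c * ?q) * ennreal ((f u)\<^sup>2)" .
  qed
  also have "\<dots> = (?c * ?q) * (\<integral>\<^sup>+u. ennreal ((f u)\<^sup>2) \<partial>P)"
    by (intro nn_integral_cmult) measurable
  also have "?c * ?q = ennreal ((B / \<kappa>\<^sub>0)\<^sup>2 * (48 / (real (card I - 1) * p)\<^sup>2))"
    unfolding L(5) by (subst ennreal_mult[symmetric], simp, simp)+ simp
  finally show ?thesis .
qed

end

text \<open>Conditional centering of \<open>f\<close> given \<pi>, expressed by bounded test
  functions: in this form it applies directly to the weights, which as functions of one covariate
  are Borel and bounded by 1.\<close>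

definition centered_given :: "'s measure \<Rightarrow> ('s \<Rightarrow> 'h::topological_space) \<Rightarrow> ('s \<Rightarrow> real) \<Rightarrow> bool" where
  "centered_given P \<pi> f \<longleftrightarrow>
     (\<forall>\<psi>\<in>borel_measurable borel. (\<forall>y. \<bar>\<psi> y\<bar> \<le> 1) \<longrightarrow> (\<integral>u. \<psi> (\<pi> u) * f u \<partial>P) = 0)"

context kernel_smoother begin

lemma integrable_component:
  fixes g :: "'s \<Rightarrow> real"
  assumes "integrable P g" "j \<in> I"
  shows "integrable (PiM I (\<lambda>_. P)) (\<lambda>x. g (x j))"
proof -
  interpret PP: product_prob_space "\<lambda>_. P" I by unfold_locales
  have "distr (PiM I (\<lambda>_. P)) P (\<lambda>x. x j) = P" using PP.PiM_component[OF assms(2)] .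
  then show ?thesis
    using integrable_distr[of "\<lambda>x. x j" "PiM I (\<lambda>_. P)" P g] assms by simp
qed

lemma nw_weight_abs_le_1: "finite I \<Longrightarrow> j \<in> I \<Longrightarrow> \<bar>nw_weight \<kappa> I v i j\<bar> \<le> 1"
  using nw_weight_bounds[of \<kappa> I j v i] \<kappa>_nonneg by simp

text \<open>One diagonal term and at most \<open>n\<close> off-diagonal ones; \<open>n - 1\<close>
  and \<open>n - 2\<close> count the points left free. If \<open>p\<close> and \<open>p'\<close> are
  of the same order and \<open>n * p\<close> is bounded away from 0, the whole is of order
  \<open>1 / (n * p)\<close>.\<close>

definition smooth_bound :: "nat \<Rightarrow> real" where
  "smooth_bound n = (B / \<kappa>\<^sub>0)\<^sup>2 * 48 * (1 / (real (n - 1) * p)\<^sup>2 + real n * p' / (real (n - 2) * p)\<^sup>2)"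

context
  fixes f :: "'s \<Rightarrow> real"
  assumes f[measurable]: "f \<in> borel_measurable P" and f2: "integrable P (\<lambda>u. (f u)\<^sup>2)"
    and orth: "centered_given P \<pi> f"
begin

lemma integrable_w_cross:
  assumes I: "finite I" "i \<in> I" "j \<in> I" "l \<in> I"
  shows "integrable (PiM I (\<lambda>_. P)) (\<lambda>x. w I x i j * w I x i l * (f (x j) * f (x l)))"
proof (rule integrable_bounded_mult)
  have comp: "(\<lambda>x. f (x k)) \<in> borel_measurable (PiM I (\<lambda>_. P))" if "k \<in> I" for k
    using that by measurable
  show "integrable (PiM I (\<lambda>_. P)) (\<lambda>x. f (x j) * f (x l))"
    using I by (intro integrable_mult_square_integrable comp integrable_component[OF f2])
  show "(\<lambda>x. w I x i j * w I x i l) \<in> borel_measurable (PiM I (\<lambda>_. P))"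
    using I by (intro borel_measurable_times w_measurable)
  fix x
  have "\<bar>w I x i j * w I x i l\<bar> \<le> 1 * 1"
    unfolding abs_mult using I by (intro mult_mono nw_weight_abs_le_1) auto
  then show "\<bar>w I x i j * w I x i l\<bar> \<le> 1" by simp
qed

text \<open>The coordinate \<open>j\<close> is integrated first. The weights depend on the
  observation \<open>j\<close> only through its covariate, so with the other coordinates frozen
  their product is an admissible test function, while \<open>f (x l)\<close> is a constant. The
  argument also covers \<open>i = j\<close> and \<open>i = l\<close>.\<close>

lemma integral_w_cross_eq_0:
  assumes I: "finite I" "i \<in> I" "j \<in> I" "l \<in> I" "j \<noteq> l"
  shows "(\<integral>x. w I x i j * w I x i l * (f (x j) * f (x l)) \<partial>PiM I (\<lambda>_. P)) = 0"
proof -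
  interpret PP: product_prob_space "\<lambda>_. P" by unfold_locales
  define L where "L = I - {j}"
  have L: "finite L" "j \<notin> L" and IL: "insert j L = I" using I by (auto simp: L_def)
  note int = integrable_w_cross[OF I(1-4)]
  have "(\<integral>x. w I x i j * w I x i l * (f (x j) * f (x l)) \<partial>PiM I (\<lambda>_. P))
    = (\<integral>x. (\<integral>y. w I (x(j := y)) i j * w I (x(j := y)) i l * (f y * f (x l)) \<partial>P) \<partial>PiM L (\<lambda>_. P))"
    using PP.product_integral_insert[OF L, of "\<lambda>x. w I x i j * w I x i l * (f (x j) * f (x l))"] int I(5)
    unfolding IL by simp
  also have "\<dots> = (\<integral>x. 0 \<partial>PiM L (\<lambda>_. P))"
  proof (intro Bochner_Integration.integral_cong refl)
    fix x
    define \<psi> where "\<psi> h = nw_weight \<kappa> I ((\<lambda>l. \<pi> (x l))(j := h)) i j * nw_weight \<kappa> I ((\<lambda>l. \<pi> (x l))(j := h)) i l" for h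
    have upd: "(\<lambda>h. ((\<lambda>l. \<pi> (x l))(j := h)) k) \<in> borel_measurable borel" for k
      by (cases "k = j") auto
    have "\<psi> \<in> borel_measurable borel"
      unfolding \<psi>_def nw_weight_def
      by (intro borel_measurable_times borel_measurable_divide borel_measurable_sum \<kappa>_measurable' upd)
    moreover have "\<bar>\<psi> h\<bar> \<le> 1" for h
    proof -
      have "\<bar>\<psi> h\<bar> \<le> 1 * 1"
        unfolding \<psi>_def abs_mult using I by (intro mult_mono nw_weight_abs_le_1) auto
      then show ?thesis by simp
    qed
    ultimately have \<psi>0: "(\<integral>u. \<psi> (\<pi> u) * f u \<partial>P) = 0" using orth by (simp add: centered_given_def)
    have eq: "w I (x(j := y)) i j * w I (x(j := y)) i l * (f y * f (x l)) = (\<psi> (\<pi> y) * f y) * f (x l)" for y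
    proof -
      have "(\<lambda>l. \<pi> ((x(j := y)) l)) = (\<lambda>l. \<pi> (x l))(j := \<pi> y)" by auto
      then show ?thesis by (simp add: \<psi>_def)
    qed
    show "(\<integral>y. w I (x(j := y)) i j * w I (x(j := y)) i l * (f y * f (x l)) \<partial>P) = 0"
      unfolding eq by (simp only: integral_mult_left_zero \<psi>0 mult_zero_left)
  qed
  finally show ?thesis by simp
qed

lemma smooth_square_expand:
  "(\<Sum>j\<in>I. w I x i j * f (x j))\<^sup>2 = (\<Sum>j\<in>I. \<Sum>l\<in>I. w I x i j * w I x i l * (f (x j) * f (x l)))"
  unfolding power2_eq_square sum_product by (intro sum.cong) (auto simp: mult_ac)

text \<open>Only the squares survive the expansion. Three points are required so that at least one
  remains after \<open>i\<close> and \<open>j\<close> are frozen and the count has positive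
  mean.\<close>

lemma integral_smooth_square_le:
  assumes I: "finite I" "i \<in> I" "card I \<ge> 3"
  shows "integrable (PiM I (\<lambda>_. P)) (\<lambda>x. (\<Sum>j\<in>I. w I x i j * f (x j))\<^sup>2)"
    and "(\<integral>x. (\<Sum>j\<in>I. w I x i j * f (x j))\<^sup>2 \<partial>PiM I (\<lambda>_. P)) \<le> smooth_bound (card I) * (\<integral>u. (f u)\<^sup>2 \<partial>P)"
proof -
  note int = integrable_w_cross[OF I(1,2)]
  show "integrable (PiM I (\<lambda>_. P)) (\<lambda>x. (\<Sum>j\<in>I. w I x i j * f (x j))\<^sup>2)"
    unfolding smooth_square_expand using int by (intro Bochner_Integration.integrable_sum)
  define a where "a = (B / \<kappa>\<^sub>0)\<^sup>2 * (48 / (real (card I - 1) * p)\<^sup>2)"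
  define b where "b = (B / \<kappa>\<^sub>0)\<^sup>2 * (48 / (real (card I - 2) * p)\<^sup>2) * p'"
  define F where "F = (\<integral>u. (f u)\<^sup>2 \<partial>P)"
  have F: "F \<ge> 0" by (simp add: F_def)
  have a0: "a \<ge> 0" by (simp add: a_def)
  have b0: "b \<ge> 0" using p'_nonneg by (simp add: b_def)
  have nF: "(\<integral>\<^sup>+u. ennreal ((f u)\<^sup>2) \<partial>P) = ennreal F"
    unfolding F_def using f2 by (intro nn_integral_eq_integral) auto
  have diag: "(\<integral>x. (w I x i i)\<^sup>2 * (f (x i))\<^sup>2 \<partial>PiM I (\<lambda>_. P)) \<le> a * F"
    using nn_integral_w_diag_le[OF I(1,2) _ f, unfolded nF, folded a_def] I(3) F a0
    by (intro integral_real_bounded) (simp_all only: ennreal_mult[of a F], simp_all)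
  have off: "(\<integral>x. (w I x i j)\<^sup>2 * (f (x j))\<^sup>2 \<partial>PiM I (\<lambda>_. P)) \<le> b * F" if "j \<in> I - {i}" for j
    using nn_integral_w_offdiag_le[OF I(1,2) _ _ I(3) f, of j, unfolded nF, folded b_def] that F b0
    by (intro integral_real_bounded) (simp_all only: ennreal_mult[of b F], auto)
  have "(\<integral>x. (\<Sum>j\<in>I. w I x i j * f (x j))\<^sup>2 \<partial>PiM I (\<lambda>_. P))
    = (\<Sum>j\<in>I. \<Sum>l\<in>I. \<integral>x. w I x i j * w I x i l * (f (x j) * f (x l)) \<partial>PiM I (\<lambda>_. P))"
    unfolding smooth_square_expand using int
    by (simp add: Bochner_Integration.integral_sum)
  also have "\<dots> = (\<Sum>j\<in>I. \<Sum>l\<in>I. if l = j then \<integral>x. (w I x i j)\<^sup>2 * (f (x j))\<^sup>2 \<partial>PiM I (\<lambda>_. P) else 0)"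
    using integral_w_cross_eq_0[OF I(1,2)]
    by (intro sum.cong refl) (auto simp: power2_eq_square mult_ac)
  also have "\<dots> = (\<Sum>j\<in>I. \<integral>x. (w I x i j)\<^sup>2 * (f (x j))\<^sup>2 \<partial>PiM I (\<lambda>_. P))"
    using I(1) by (intro sum.cong) (auto simp: sum.delta)
  also have "\<dots> \<le> a * F + (\<Sum>j\<in>I-{i}. b * F)"
    unfolding sum.remove[OF I(1,2), of "\<lambda>j. \<integral>x. (w I x i j)\<^sup>2 * (f (x j))\<^sup>2 \<partial>PiM I (\<lambda>_. P)"]
    by (intro add_mono sum_mono diag off)
  also have "\<dots> \<le> a * F + real (card I) * (b * F)"
  proof -
    have "real (card (I - {i})) * (b * F) \<le> real (card I) * (b * F)"
      using F b0 I by (intro mult_right_mono) (auto intro: card_mono)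
    then show ?thesis by simp
  qed
  also have "\<dots> = smooth_bound (card I) * F"
    unfolding smooth_bound_def a_def b_def by (simp add: ring_distribs mult_ac add_divide_distrib)
  finally show "(\<integral>x. (\<Sum>j\<in>I. w I x i j * f (x j))\<^sup>2 \<partial>PiM I (\<lambda>_. P)) \<le> smooth_bound (card I) * (\<integral>u. (f u)\<^sup>2 \<partial>P)"
    by (simp add: F_def)
qed

lemma integral_avg_smooth_square_le:
  assumes iid: "iid_seq M P V" and n: "n \<ge> 3"
  shows "integrable M (\<lambda>\<omega>. avg n (\<lambda>i. (\<Sum>j=1..n. w {1..n} (\<lambda>l. V l \<omega>) i j * f (V j \<omega>))\<^sup>2))"
    and "(\<integral>\<omega>. avg n (\<lambda>i. (\<Sum>j=1..n. w {1..n} (\<lambda>l. V l \<omega>) i j * f (V j \<omega>))\<^sup>2) \<partial>M)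
      \<le> smooth_bound n * (\<integral>u. (f u)\<^sup>2 \<partial>P)"
proof -
  interpret M: prob_space M using iid by (simp add: iid_seq_def)
  have V: "\<And>i. i \<ge> 1 \<Longrightarrow> V i \<in> measurable M P" "\<And>i. i \<ge> 1 \<Longrightarrow> distr M P (V i) = P"
    and iv: "M.indep_vars (\<lambda>_. P) V {1..}"
    using iid by (auto simp: iid_seq_def)
  let ?I = "{1..n}" and ?R = "\<lambda>\<omega>. \<lambda>i\<in>{1..n}. V i \<omega>"
  have R: "?R \<in> measurable M (PiM ?I (\<lambda>_. P))"
    using V(1) by (intro measurable_restrict) auto
  \<comment> \<open>Independence makes the joint law of the first \<open>n\<close> observations the
    product measure, so the bounds on the product space carry over to \<open>M\<close>.\<close>
  have "distr M (PiM ?I (\<lambda>_. P)) ?R = PiM ?I (\<lambda>i. distr M P (V i))"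
    using V(1) n M.indep_vars_subset[OF iv, of ?I]
    by (intro iffD1[OF M.indep_vars_iff_distr_eq_PiM']) auto
  also have "\<dots> = PiM ?I (\<lambda>_. P)" using V by (intro PiM_cong) auto
  finally have D: "distr M (PiM ?I (\<lambda>_. P)) ?R = PiM ?I (\<lambda>_. P)" .
  define S where "S i x = (\<Sum>j\<in>?I. w ?I x i j * f (x j))\<^sup>2" for i x
  have Seq: "S i (?R \<omega>) = (\<Sum>j=1..n. w ?I (\<lambda>l. V l \<omega>) i j * f (V j \<omega>))\<^sup>2" if "i \<in> ?I" for i \<omega>
    unfolding S_def using that
    by (intro arg_cong[where f="\<lambda>x. x\<^sup>2"] sum.cong) (auto simp: nw_weight_def)
  have S: "integrable M (\<lambda>\<omega>. S i (?R \<omega>))" "(\<integral>\<omega>. S i (?R \<omega>) \<partial>M) \<le> smooth_bound n * (\<integral>u. (f u)\<^sup>2 \<partial>P)"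
    if "i \<in> ?I" for i
  proof -
    have b: "integrable (PiM ?I (\<lambda>_. P)) (S i)"
      "(\<integral>x. S i x \<partial>PiM ?I (\<lambda>_. P)) \<le> smooth_bound n * (\<integral>u. (f u)\<^sup>2 \<partial>P)"
      using integral_smooth_square_le[of ?I i] that n unfolding S_def by auto
    show "integrable M (\<lambda>\<omega>. S i (?R \<omega>))"
      using integrable_distr[OF R, of "S i"] b(1) unfolding D by simp
    have "(\<integral>x. S i x \<partial>distr M (PiM ?I (\<lambda>_. P)) ?R) = (\<integral>\<omega>. S i (?R \<omega>) \<partial>M)"
      using b(1) by (intro integral_distr R) auto
    then show "(\<integral>\<omega>. S i (?R \<omega>) \<partial>M) \<le> smooth_bound n * (\<integral>u. (f u)\<^sup>2 \<partial>P)" using b(2) unfolding D by simp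
  qed
  have eq: "avg n (\<lambda>i. (\<Sum>j=1..n. w {1..n} (\<lambda>l. V l \<omega>) i j * f (V j \<omega>))\<^sup>2) = (1 / real n) * (\<Sum>i\<in>?I. S i (?R \<omega>))" for \<omega>
    unfolding avg_def using Seq[of _ \<omega>] by (simp del: restrict_apply)
  show "integrable M (\<lambda>\<omega>. avg n (\<lambda>i. (\<Sum>j=1..n. w {1..n} (\<lambda>l. V l \<omega>) i j * f (V j \<omega>))\<^sup>2))"
    unfolding eq using S(1) by (intro integrable_mult_right Bochner_Integration.integrable_sum)
  have "(\<integral>\<omega>. (1 / real n) * (\<Sum>i\<in>?I. S i (?R \<omega>)) \<partial>M) = (1 / real n) * (\<Sum>i\<in>?I. \<integral>\<omega>. S i (?R \<omega>) \<partial>M)"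
    using S(1) by (subst integral_mult_right_zero, subst Bochner_Integration.integral_sum) auto
  also have "\<dots> \<le> (1 / real n) * (\<Sum>i\<in>?I. smooth_bound n * (\<integral>u. (f u)\<^sup>2 \<partial>P))"
    using S(2) by (intro mult_left_mono sum_mono) auto
  also have "\<dots> = smooth_bound n * (\<integral>u. (f u)\<^sup>2 \<partial>P)" using n by simp
  finally show "(\<integral>\<omega>. avg n (\<lambda>i. (\<Sum>j=1..n. w {1..n} (\<lambda>l. V l \<omega>) i j * f (V j \<omega>))\<^sup>2) \<partial>M)
      \<le> smooth_bound n * (\<integral>u. (f u)\<^sup>2 \<partial>P)" unfolding eq .
qed

end
end

subsection \<open>Kernels, small balls and least squares\<close>

text \<open>The support condition gives \<open>K = 0\<close> strictly beyond 1, and continuity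
  extends this to 1 itself. The Lipschitz bound and the slope condition, both read backwards from
  \<open>K 1 = 0\<close>, then bound \<open>K\<close> from above and from below.\<close>

lemma kernel_bounds:
  fixes K :: "real \<Rightarrow> real"
  assumes nonneg: "\<forall>u\<ge>0. K u \<ge> 0"
    and supp: "closure {u. u \<ge> 0 \<and> K u \<noteq> 0} = {0..1}"
    and lip: "L-lipschitz_on {0..} K"
    and der: "\<forall>u\<in>{0..1}. \<exists>D. (K has_real_derivative D) (at u within {0..1}) \<and> - D > \<theta>"
  shows "\<And>u. u \<ge> 1 \<Longrightarrow> K u = 0" and "\<And>u. u \<ge> 0 \<Longrightarrow> K u \<le> L"
    and "\<And>u. 0 \<le> u \<Longrightarrow> u < 1 \<Longrightarrow> \<theta> * (1 - u) < K u"
proof -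
  have gt1: "K u = 0" if "u > 1" for u
  proof (rule ccontr)
    assume "K u \<noteq> 0"
    then have "u \<in> closure {u. u \<ge> 0 \<and> K u \<noteq> 0}"
      using that by (intro closure_subset[THEN subsetD]) auto
    then show False using supp that by simp
  qed
  have L0: "L \<ge> 0" using lip by (rule lipschitz_on_nonneg)
  have lipD: "\<bar>K u - K v\<bar> \<le> L * \<bar>u - v\<bar>" if "u \<ge> 0" "v \<ge> 0" for u v
    using lipschitz_onD[OF lip, of u v] that by (simp add: dist_real_def)
  have K1: "K 1 = 0"
  proof (rule ccontr)
    assume "K 1 \<noteq> 0"
    with nonneg have pos: "K 1 > 0" by (simp add: order_less_le)
    \<comment> \<open>At distance \<open>t\<close> from 1 the Lipschitz bound allows a drop of at
      most half of \<open>K 1\<close>, although \<open>K\<close> already vanishes there. The summand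
      1 keeps the denominator positive when \<open>L = 0\<close>.\<close>
    define t where "t = K 1 / (2 * (L + 1))"
    have t: "t > 0" using pos L0 by (simp add: t_def)
    have "K 1 \<le> L * t" using lipD[of 1 "1 + t"] gt1[of "1 + t"] t by simp
    also have "\<dots> \<le> (L + 1) * t" using t by simp
    also have "\<dots> = K 1 / 2" using L0 by (simp add: t_def field_simps)
    finally show False using pos by simp
  qed
  show ge1: "K u = 0" if "u \<ge> 1" for u using gt1 K1 that by (cases "u = 1") auto
  show "K u \<le> L" if "u \<ge> 0" for u
  proof (cases "u \<ge> 1")
    case True then show ?thesis using ge1 L0 by simp
  next
    case False
    then have "K u \<le> L * \<bar>u - 1\<bar>" using lipD[of u 1] that K1 by simp
    also have "\<dots> \<le> L * 1" using False that L0 by (intro mult_left_mono) auto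
    finally show ?thesis by simp
  qed
  show "\<theta> * (1 - u) < K u" if u: "0 \<le> u" "u < 1" for u
  proof -
    \<comment> \<open>\<open>K\<close> plus the line of slope \<theta> is strictly decreasing, since
      at interior points the derivative within [0, 1] is two-sided.\<close>
    have "K 1 + \<theta> * 1 < K u + \<theta> * u"
    proof (rule DERIV_neg_imp_decreasing_open[OF u(2)])
      fix x assume x: "u < x" "x < 1"
      then obtain D where D: "(K has_real_derivative D) (at x within {0..1})" "- D > \<theta>"
        using der u by (metis atLeastAtMost_iff less_eq_real_def order_trans)
      have "at x within {0..1} = at x" using x u by (intro at_within_interior) auto
      with D have "((\<lambda>x. K x + \<theta> * x) has_real_derivative D + \<theta>) (at x)"
        by (auto intro!: derivative_eq_intros)
      then show "\<exists>y. ((\<lambda>x. K x + \<theta> * x) has_real_derivative y) (at x) \<and> y < 0" using D(2) by force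
    next
      have "continuous_on {u..1} K"
        using continuous_on_subset[OF lipschitz_on_continuous_on[OF lip]] u by auto
      then show "continuous_on {u..1} (\<lambda>x. K x + \<theta> * x)" by (intro continuous_intros)
    qed
    then show ?thesis using K1 by (simp add: algebra_simps)
  qed
qed

text \<open>
  The integral condition forbids \<open>\<phi>\<close> to concentrate its growth near \<open>r\<close>: splitting the integral
  at \<open>\<delta>\<close> close to \<open>1\<close> bounds \<open>\<phi> (\<delta> r)\<close> from below.
\<close>

lemma small_ball_ratio:
  fixes \<phi> :: "real \<Rightarrow> real"
  assumes pos: "\<And>s. s > 0 \<Longrightarrow> \<phi> s > 0" and \<alpha>0: "\<alpha>\<^sub>0 > 0"
    and almost_mono: "\<And>s r. 0 < s \<Longrightarrow> s \<le> r \<Longrightarrow> \<phi> s \<le> \<kappa> * \<phi> r"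
    and int: "\<And>r. r > 0 \<Longrightarrow> (\<lambda>s. \<phi> (r * s)) integrable_on {0..1} \<and> integral {0..1} (\<lambda>s. \<phi> (r * s)) > \<alpha>\<^sub>0 * \<phi> r"
  shows "\<exists>\<delta> c. 0 < \<delta> \<and> \<delta> < 1 \<and> c > 0 \<and> (\<forall>r>0. c * \<phi> r \<le> \<phi> (\<delta> * r))"
proof -
  have "\<phi> 1 \<le> \<kappa> * \<phi> 1" using almost_mono[of 1 1] by simp
  then have \<kappa>: "\<kappa> \<ge> 1" using pos[of 1] by simp
  \<comment> \<open>The part of the integral over [\<delta>, 1] is at most (1 - \<delta>) \<kappa>
    \<phi>(r), and this choice makes it at most half of the guaranteed value; the minimum with 1/2
    keeps \<delta> positive.\<close>
  define \<delta> where "\<delta> = 1 - min (1/2) (\<alpha>\<^sub>0 / (2 * \<kappa>))"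
  have "min (1/2) (\<alpha>\<^sub>0 / (2 * \<kappa>)) > 0" using \<alpha>0 \<kappa> by simp
  then have \<delta>: "0 < \<delta>" "\<delta> < 1" by (auto simp: \<delta>_def)
  have "(1 - \<delta>) * \<kappa> \<le> \<alpha>\<^sub>0 / (2 * \<kappa>) * \<kappa>" using \<kappa> by (intro mult_right_mono) (auto simp: \<delta>_def)
  also have "\<dots> = \<alpha>\<^sub>0 / 2" using \<kappa> by simp
  finally have d\<kappa>: "(1 - \<delta>) * \<kappa> \<le> \<alpha>\<^sub>0 / 2" .
  have "\<alpha>\<^sub>0 / (2 * \<kappa>) * \<phi> r \<le> \<phi> (\<delta> * r)" if r: "r > 0" for r
  proof -
    \<comment> \<open>Positivity and almost monotonicity of \<phi> concern positive arguments, so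
      the value at 0 is overwritten; a single point does not affect the integral.\<close>
    define f where "f s = (if s = 0 then 0 else \<phi> (r * s))" for s
    have spike: "\<And>s. s \<in> {0..1} - {0} \<Longrightarrow> f s = \<phi> (r * s)" by (simp add: f_def)
    have fi: "f integrable_on {0..1}"
      using integrable_spike_finite[of "{0}" "{0..1}" f "\<lambda>s. \<phi> (r * s)"] int[OF r] spike by auto
    have "integral {0..1} (\<lambda>s. \<phi> (r * s)) = integral {0..1} f"
      using spike by (intro integral_spike[of "{0}"]) auto
    also have "\<dots> = integral {0..\<delta>} f + integral {\<delta>..1} f"
      using \<delta> fi by (intro Henstock_Kurzweil_Integration.integral_combine[symmetric]) auto
    also have "integral {0..\<delta>} f \<le> integral {0..\<delta>} (\<lambda>s. \<kappa> * \<phi> (\<delta> * r))"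
    proof (rule integral_le)
      show "f integrable_on {0..\<delta>}" using integrable_subinterval_real[OF fi] \<delta> by auto
      fix s assume s: "s \<in> {0..\<delta>}"
      have "0 \<le> \<kappa> * \<phi> (\<delta> * r)" using pos[of "\<delta> * r"] \<delta> r \<kappa> by simp
      moreover have "\<phi> (r * s) \<le> \<kappa> * \<phi> (\<delta> * r)" if "s \<noteq> 0"
        using s that r by (intro almost_mono) (auto simp: mult.commute)
      ultimately show "f s \<le> \<kappa> * \<phi> (\<delta> * r)" by (simp add: f_def)
    qed (rule integrable_const_ivl)
    also have "integral {\<delta>..1} f \<le> integral {\<delta>..1} (\<lambda>s. \<kappa> * \<phi> r)"
    proof (rule integral_le)
      show "f integrable_on {\<delta>..1}" using integrable_subinterval_real[OF fi] \<delta> by auto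
      fix s assume s: "s \<in> {\<delta>..1}"
      have "\<phi> (r * s) \<le> \<kappa> * \<phi> r" using s r \<delta> by (intro almost_mono) auto
      then show "f s \<le> \<kappa> * \<phi> r" using s \<delta> by (simp add: f_def)
    qed (rule integrable_const_ivl)
    also have "integral {0..\<delta>} (\<lambda>s. \<kappa> * \<phi> (\<delta> * r)) + integral {\<delta>..1} (\<lambda>s. \<kappa> * \<phi> r) = \<delta> * (\<kappa> * \<phi> (\<delta> * r)) + (1 - \<delta>) * \<kappa> * \<phi> r"
      using \<delta> by simp
    finally have "integral {0..1} (\<lambda>s. \<phi> (r * s)) \<le> \<delta> * (\<kappa> * \<phi> (\<delta> * r)) + (1 - \<delta>) * \<kappa> * \<phi> r"
      by simp
    also have "\<dots> \<le> 1 * (\<kappa> * \<phi> (\<delta> * r)) + \<alpha>\<^sub>0 / 2 * \<phi> r"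
      using \<delta> \<kappa> r pos[of r] pos[of "\<delta> * r"] d\<kappa> by (intro add_mono mult_right_mono) auto
    finally have "\<alpha>\<^sub>0 * \<phi> r < \<kappa> * \<phi> (\<delta> * r) + \<alpha>\<^sub>0 / 2 * \<phi> r" using int[OF r] by simp
    then have "\<alpha>\<^sub>0 / 2 * \<phi> r < \<kappa> * \<phi> (\<delta> * r)" by simp
    then show ?thesis using \<kappa> by (simp add: field_simps)
  qed
  moreover have "\<alpha>\<^sub>0 / (2 * \<kappa>) > 0" using \<alpha>0 \<kappa> by simp
  ultimately show ?thesis using \<delta> by blast
qed

text \<open>Multiplied by n, the hypothesis reads n^s / (ln n)^2 with s > 1/2. The squared logarithm
  is absorbed by a quarter power, which leaves at least n^(1/4) / 64.\<close>

lemma polynomial_rate_at_top: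
  fixes \<psi> :: "nat \<Rightarrow> real"
  assumes s: "1 / 2 < s" and ev: "\<forall>\<^sub>F n in sequentially. \<psi> n \<ge> real n powr (s - 1) / (ln (real n))\<^sup>2"
  shows "filterlim (\<lambda>n. real n * \<psi> n) at_top sequentially"
proof (rule filterlim_at_top_mono)
  have "filterlim (\<lambda>n. real n powr (1/4)) at_top sequentially"
  proof (rule filterlim_cong[THEN iffD1, OF refl refl])
    show "filterlim (\<lambda>n. exp ((1/4) * ln (real n))) at_top sequentially"
      by (intro filterlim_compose[OF exp_at_top] filterlim_tendsto_pos_mult_at_top[OF tendsto_const]
        filterlim_compose[OF ln_at_top filterlim_real_sequentially]) simp
    show "\<forall>\<^sub>F n in sequentially. exp ((1/4) * ln (real n)) = real n powr (1/4)"
      using eventually_gt_at_top[of 0] by eventually_elim (simp add: powr_def)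
  qed
  then show "filterlim (\<lambda>n. (1/64) * real n powr (1/4)) at_top sequentially"
    by (intro filterlim_tendsto_pos_mult_at_top[OF tendsto_const]) auto
  show "\<forall>\<^sub>F n in sequentially. (1/64) * real n powr (1/4) \<le> real n * \<psi> n"
    using ev eventually_ge_at_top[of 2]
  proof eventually_elim
    case (elim n)
    then have n: "real n \<ge> 2" by simp
    define x where "x = real n"
    have x: "x \<ge> 2" using n by (simp add: x_def)
    \<comment> \<open>The exponent 1/8 becomes 1/4 after squaring, which is half of the available
      1/2; the factor 8 becomes 64.\<close>
    have "ln x \<le> x powr (1/8) / (1/8)" using x by (intro ln_powr_bound) auto
    then have "(ln x)\<^sup>2 \<le> (8 * x powr (1/8))\<^sup>2" using x by (intro power_mono) auto
    also have "\<dots> = 64 * (x powr (1/8) * x powr (1/8))" by (simp add: power2_eq_square)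
    also have "x powr (1/8) * x powr (1/8) = x powr (1/4)" unfolding powr_add[symmetric] by simp
    finally have ln: "(ln x)\<^sup>2 \<le> 64 * x powr (1/4)" .
    have lnp: "(ln x)\<^sup>2 > 0" using x by simp
    have "(1/64) * x powr (1/4) = x powr (1/2) / (64 * x powr (1/4))"
    proof -
      have "x powr (1/2) = x powr (1/4) * x powr (1/4)" unfolding powr_add[symmetric] by simp
      then show ?thesis using x by simp
    qed
    also have "\<dots> \<le> x powr s / (ln x)\<^sup>2"
      using s x ln lnp by (intro frac_le powr_mono) auto
    also have "x powr s = x * x powr (s - 1)" using x by (simp add: powr_diff)
    finally have "(1/64) * x powr (1/4) \<le> x * (x powr (s - 1) / (ln x)\<^sup>2)" by simp
    also have "\<dots> \<le> x * \<psi> n" using elim x by (intro mult_left_mono) (auto simp: x_def)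
    finally show ?case by (simp add: x_def)
  qed
qed

text \<open>
  A semi-metric need not be jointly measurable, but on a set that is totally bounded for it, it is the
  infimum over countably many centres of jointly measurable functions.
\<close>

lemma semimetric_eq_INF:
  fixes d :: "'h::topological_space \<Rightarrow> 'h \<Rightarrow> real" and z :: "nat \<Rightarrow> nat \<Rightarrow> 'h"
  assumes d: "semimetric d" and l: "l \<longlonglongrightarrow> 0"
    and cover: "\<And>n. n \<ge> (1::nat) \<Longrightarrow> C \<subseteq> (\<Union>i. dball d (z n i) (l n))"
    and xy: "x \<in> C"
  shows "(INF (n, i). d (z n i) x + d (z n i) y) = d x y"
proof (rule antisym)
  have d_nn: "0 \<le> d x y" and d_sym: "d x y = d y x" and d_tri: "d x z \<le> d x y + d y z" for x y z
    using d by (auto simp: semimetric_def)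
  show "d x y \<le> (INF (n, i). d (z n i) x + d (z n i) y)"
  proof (intro cINF_greatest)
    fix p :: "nat \<times> nat"
    show "d x y \<le> (case p of (n, i) \<Rightarrow> d (z n i) x + d (z n i) y)"
      using d_tri[of x y "z (fst p) (snd p)"] d_sym[of x "z (fst p) (snd p)"] by (simp add: case_prod_unfold)
  qed simp
  show "(INF (n, i). d (z n i) x + d (z n i) y) \<le> d x y"
  proof (rule field_le_epsilon)
    fix e :: real assume "e > 0"
    then have "\<forall>\<^sub>F n in sequentially. l n < e / 2" using l by (intro order_tendstoD) auto
    then have "\<forall>\<^sub>F n in sequentially. l n < e / 2 \<and> n \<ge> 1"
      by (intro eventually_conj eventually_ge_at_top)
    then obtain n where n: "l n < e / 2" "n \<ge> 1" using eventually_happens'[OF sequentially_bot] by blast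
    \<comment> \<open>Going through a centre within \<open>l n\<close> of \<open>x\<close>
      overshoots the distance by at most twice \<open>l n\<close>, which is less than
      \<open>e\<close>.\<close>
    with cover xy obtain i where i: "d x (z n i) < l n" by (auto simp: dball_def)
    have bdd: "bdd_below (range (\<lambda>(n, i). d (z n i) x + d (z n i) y))"
      using d_nn by (auto intro!: bdd_belowI[where m=0] add_nonneg_nonneg)
    have "(INF (n, i). d (z n i) x + d (z n i) y) \<le> d (z n i) x + d (z n i) y"
      using cINF_lower[OF bdd, of "(n, i)"] by simp
    also have "\<dots> \<le> d x (z n i) + (d x (z n i) + d x y)"
      using d_tri[of "z n i" y x] d_sym[of x "z n i"] by simp
    also have "\<dots> \<le> d x y + e" using i n by simp
    finally show "(INF (n, i). d (z n i) x + d (z n i) y) \<le> d x y + e" .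
  qed
qed

text \<open>\<open>matrix_inv\<close> is a choice from the set of inverses. For every singular
  matrix this set is empty, so the choice is always the same as for the matrix 0. The formula is
  therefore valid everywhere, and measurability in \<open>A\<close> can be read off from
  determinants.\<close>

lemma matrix_inv_mult_Cramer:
  fixes A :: "real ^ 'n ^ 'n"
  shows "matrix_inv A *v v = (if det A = 0 then matrix_inv 0 *v v
    else (\<chi> k. det (\<chi> i j. if j = k then v $ i else A $ i $ j) / det A))"
proof (cases "det A = 0")
  case True
  have "\<not> invertible A" "\<not> invertible (0 :: real ^ 'n ^ 'n)"
    using True det_0[where 'a=real and 'n='n] by (simp_all add: invertible_det_nz mat_def zero_vec_def)
  then have "(\<lambda>B. A ** B = mat 1 \<and> B ** A = mat 1) = (\<lambda>B. 0 ** B = mat 1 \<and> B ** (0 :: real ^ 'n ^ 'n) = mat 1)"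
    unfolding invertible_def by blast
  then have "matrix_inv A = matrix_inv 0" unfolding matrix_inv_def by (rule arg_cong)
  then show ?thesis using True by simp
next
  case False
  then have "\<exists>B. A ** B = mat 1 \<and> B ** A = mat 1" by (simp add: invertible_det_nz[symmetric] invertible_def)
  then have "A ** matrix_inv A = mat 1" unfolding matrix_inv_def by (rule someI2_ex) simp
  then have "A *v (matrix_inv A *v v) = v" by (simp add: matrix_vector_mul_assoc)
  then show ?thesis using False by (simp add: cramer)
qed

lemma borel_measurable_vecI:
  fixes f :: "'a \<Rightarrow> real ^ 'n"
  assumes "\<And>k. (\<lambda>x. f x $ k) \<in> borel_measurable M"
  shows "f \<in> borel_measurable M"
proof (rule iffD2[OF borel_measurable_euclidean_space], rule ballI)
  fix i :: "real ^ 'n" assume "i \<in> Basis"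
  then obtain k u where i: "i = axis k u" "u \<in> (Basis :: real set)" unfolding Basis_vec_def by blast
  have eq: "(\<lambda>x. f x \<bullet> i) = (\<lambda>x. f x $ k)" using i(2) by (intro ext) (simp add: i(1) inner_axis)
  show "(\<lambda>x. f x \<bullet> i) \<in> borel_measurable M" unfolding eq by (rule assms)
qed

lemma borel_measurable_det:
  fixes A :: "'a \<Rightarrow> real ^ 'n ^ 'n"
  assumes "\<And>i j. (\<lambda>x. A x $ i $ j) \<in> borel_measurable M"
  shows "(\<lambda>x. det (A x)) \<in> borel_measurable M"
  unfolding det_def by (intro borel_measurable_sum borel_measurable_times borel_measurable_prod borel_measurable_const assms)

lemma borel_measurable_matrix_inv_mult:
  fixes A :: "'a \<Rightarrow> real ^ 'n ^ 'n" and v :: "'a \<Rightarrow> real ^ 'n"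
  assumes A: "\<And>i j. (\<lambda>x. A x $ i $ j) \<in> borel_measurable M" and v: "\<And>i. (\<lambda>x. v x $ i) \<in> borel_measurable M"
  shows "(\<lambda>x. matrix_inv (A x) *v v x) \<in> borel_measurable M"
proof (rule borel_measurable_vecI)
  fix k
  have [measurable]: "(\<lambda>x. det (A x)) \<in> borel_measurable M" by (rule borel_measurable_det[OF A])
  have [measurable]: "(\<lambda>x. det (\<chi> i j. if j = k then v x $ i else A x $ i $ j)) \<in> borel_measurable M"
  proof (rule borel_measurable_det)
    fix i j show "(\<lambda>x. (\<chi> i j. if j = k then v x $ i else A x $ i $ j) $ i $ j) \<in> borel_measurable M"
      using A v by (cases "j = k") auto
  qed
  have [measurable]: "(\<lambda>x. (matrix_inv 0 *v v x) $ k) \<in> borel_measurable M"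
    unfolding matrix_vector_mult_def vec_lambda_beta
    by (intro borel_measurable_sum borel_measurable_times borel_measurable_const v)
  have eq: "(matrix_inv (A x) *v v x) $ k = (if det (A x) = 0 then (matrix_inv 0 *v v x) $ k
    else det (\<chi> i j. if j = k then v x $ i else A x $ i $ j) / det (A x))" for x
    by (cases "det (A x) = 0") (simp_all only: matrix_inv_mult_Cramer[of "A x"] if_True if_False vec_lambda_beta simp_thms)
  show "(\<lambda>x. (matrix_inv (A x) *v v x) $ k) \<in> borel_measurable M"
    by (rule measurable_cong[THEN iffD2, OF eq]) measurable
qed

lemma tendsto_det:
  fixes A :: "'a \<Rightarrow> real ^ 'n ^ 'n"
  assumes "\<And>i j. ((\<lambda>x. A x $ i $ j) \<longlongrightarrow> B $ i $ j) F"
  shows "((\<lambda>x. det (A x)) \<longlongrightarrow> det B) F"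
  unfolding det_def by (intro tendsto_sum tendsto_mult tendsto_const tendsto_prod assms)

lemma pos_def_matrix_det_nonzero:
  fixes A :: "real ^ 'n ^ 'n"
  assumes "pos_def_matrix A" shows "det A \<noteq> 0"
proof
  assume "det A = 0"
  then have "\<not> (\<exists>B. B ** A = mat 1)" by (metis invertible_det_nz invertible_left_inverse)
  then obtain v where "v \<noteq> 0" "A *v v = 0" using matrix_left_invertible_ker[of A] by auto
  then show False using assms by (auto simp: pos_def_matrix_def)
qed

text \<open>By Cramer's rule each entry is a quotient of determinants. In the limit the numerator
  has a zero column, while the denominator stays away from 0.\<close>

lemma tendsto_matrix_inv_mult_0:
  fixes A :: "'a \<Rightarrow> real ^ 'n ^ 'n" and v :: "'a \<Rightarrow> real ^ 'n"
  assumes A: "\<And>i j. ((\<lambda>x. A x $ i $ j) \<longlongrightarrow> B $ i $ j) F" and v: "\<And>i. ((\<lambda>x. v x $ i) \<longlongrightarrow> 0) F"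
    and B: "det B \<noteq> 0"
  shows "((\<lambda>x. matrix_inv (A x) *v v x) \<longlongrightarrow> 0) F"
proof -
  have detA: "((\<lambda>x. det (A x)) \<longlongrightarrow> det B) F" by (rule tendsto_det[OF A])
  have ev: "\<forall>\<^sub>F x in F. det (A x) \<noteq> 0" using tendsto_imp_eventually_ne[OF detA B] .
  have "((\<lambda>x. \<chi> k. det (\<chi> i j. if j = k then v x $ i else A x $ i $ j) / det (A x)) \<longlongrightarrow> 0) F"
  proof (rule vec_tendstoI)
    fix k
    let ?B = "\<chi> i j. if j = k then 0 else B $ i $ j"
    have "((\<lambda>x. det (\<chi> i j. if j = k then v x $ i else A x $ i $ j) / det (A x)) \<longlongrightarrow> det ?B / det B) F"
    proof (rule tendsto_divide[OF tendsto_det detA B])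
      fix i j show "((\<lambda>x. (\<chi> i j. if j = k then v x $ i else A x $ i $ j) $ i $ j) \<longlongrightarrow> ?B $ i $ j) F"
        using A v by (cases "j = k") auto
    qed
    moreover have "det ?B = 0"
      by (rule det_zero_column(1)[of k]) (simp add: column_def vec_eq_iff)
    ultimately show "((\<lambda>x. (\<chi> k. det (\<chi> i j. if j = k then v x $ i else A x $ i $ j) / det (A x)) $ k) \<longlongrightarrow> 0 $ k) F"
      by simp
  qed
  then show ?thesis
  proof (rule Lim_transform_eventually)
    show "\<forall>\<^sub>F x in F. (\<chi> k. det (\<chi> i j. if j = k then v x $ i else A x $ i $ j) / det (A x)) = matrix_inv (A x) *v v x"
      using ev by eventually_elim (simp add: matrix_inv_mult_Cramer)
  qed
qed

lemma avg_add: "avg n (\<lambda>i. v i + w i) = avg n v + avg n w"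
  by (simp add: avg_def sum.distrib scaleR_add_right)

lemma abs_avg_mult_le:
  fixes v w :: "nat \<Rightarrow> real"
  shows "\<bar>avg n (\<lambda>i. v i * w i)\<bar> \<le> sqrt (avg n (\<lambda>i. (v i)\<^sup>2)) * sqrt (avg n (\<lambda>i. (w i)\<^sup>2))"
proof -
  have "(avg n (\<lambda>i. v i * w i))\<^sup>2 = (1 / real n)\<^sup>2 * (\<Sum>i=1..n. v i * w i)\<^sup>2"
    by (simp add: avg_def power_divide)
  also have "\<dots> \<le> (1 / real n)\<^sup>2 * ((\<Sum>i=1..n. (v i)\<^sup>2) * (\<Sum>i=1..n. (w i)\<^sup>2))"
    by (intro mult_left_mono Cauchy_Schwarz_ineq_sum) simp
  also have "\<dots> = avg n (\<lambda>i. (v i)\<^sup>2) * avg n (\<lambda>i. (w i)\<^sup>2)"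
    by (simp add: avg_def power2_eq_square)
  finally show ?thesis unfolding real_sqrt_mult[symmetric]
    by (metis real_sqrt_abs real_sqrt_le_mono)
qed

text \<open>The perturbations \<open>r\<close> and \<open>s\<close> vanish in quadratic mean only.
  By Cauchy-Schwarz every mixed term is bounded by a product of quadratic means, one of which tends
  to 0 while the other converges.\<close>

lemma tendsto_avg_mult_perturbed:
  fixes a b r s :: "'x \<Rightarrow> nat \<Rightarrow> real" and N :: "'x \<Rightarrow> nat"
  assumes a: "((\<lambda>x. avg (N x) (\<lambda>i. (a x i)\<^sup>2)) \<longlongrightarrow> A) F" and b: "((\<lambda>x. avg (N x) (\<lambda>i. (b x i)\<^sup>2)) \<longlongrightarrow> B) F"
    and r: "((\<lambda>x. avg (N x) (\<lambda>i. (r x i)\<^sup>2)) \<longlongrightarrow> 0) F" and s: "((\<lambda>x. avg (N x) (\<lambda>i. (s x i)\<^sup>2)) \<longlongrightarrow> 0) F"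
    and ab: "((\<lambda>x. avg (N x) (\<lambda>i. a x i * b x i)) \<longlongrightarrow> c) F"
  shows "((\<lambda>x. avg (N x) (\<lambda>i. (a x i + r x i) * (b x i + s x i))) \<longlongrightarrow> c) F"
proof -
  have cross: "((\<lambda>x. avg (N x) (\<lambda>i. v x i * w x i)) \<longlongrightarrow> 0) F"
    if v: "((\<lambda>x. avg (N x) (\<lambda>i. (v x i)\<^sup>2)) \<longlongrightarrow> V) F" and w: "((\<lambda>x. avg (N x) (\<lambda>i. (w x i)\<^sup>2)) \<longlongrightarrow> W) F"
      and VW: "V * W = 0" for v w :: "'x \<Rightarrow> nat \<Rightarrow> real" and V W
  proof (rule tendsto_0_sandwich)
    have "((\<lambda>x. sqrt (avg (N x) (\<lambda>i. (v x i)\<^sup>2)) * sqrt (avg (N x) (\<lambda>i. (w x i)\<^sup>2))) \<longlongrightarrow> sqrt V * sqrt W) F"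
      by (intro tendsto_intros v w)
    then show "((\<lambda>x. sqrt (avg (N x) (\<lambda>i. (v x i)\<^sup>2)) * sqrt (avg (N x) (\<lambda>i. (w x i)\<^sup>2))) \<longlongrightarrow> 0) F"
      using VW by (simp add: real_sqrt_mult[symmetric])
  qed (intro always_eventually allI abs_avg_mult_le)
  have "((\<lambda>x. avg (N x) (\<lambda>i. a x i * b x i) + avg (N x) (\<lambda>i. a x i * s x i)
     + (avg (N x) (\<lambda>i. r x i * b x i) + avg (N x) (\<lambda>i. r x i * s x i))) \<longlongrightarrow> c + 0 + (0 + 0)) F"
    by (intro tendsto_intros ab cross[OF a s] cross[OF r b] cross[OF r s]) auto
  then show ?thesis by (simp add: avg_add[symmetric] algebra_simps)
qed

subsection \<open>Consistency of the partially linear estimator\<close>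

text \<open>The conditions on kernel, bandwidth and small balls in the form used below. The centres
  \<open>z\<close> with radii \<open>l\<close> make \<open>d\<close> jointly measurable on
  \<open>C\<close>; \<delta> and \<open>c\<close> come from the comparison of small balls; the rate
  drives the variance of the smoother to 0.\<close>

locale kernel_regression =
  fixes M :: "'w measure" and P :: "'s measure" and V :: "nat \<Rightarrow> 'w \<Rightarrow> 's"
    and \<pi> :: "'s \<Rightarrow> 'h::second_countable_topology" and d :: "'h \<Rightarrow> 'h \<Rightarrow> real" and C :: "'h set"
    and z :: "nat \<Rightarrow> nat \<Rightarrow> 'h" and l :: "nat \<Rightarrow> real" and K :: "real \<Rightarrow> real" and L \<theta> :: real
    and b :: "nat \<Rightarrow> real" and \<phi> :: "real \<Rightarrow> real" and \<alpha>\<^sub>1 \<alpha>\<^sub>2 \<delta> c :: real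
  assumes iid: "iid_seq M P V" and \<pi>_meas[measurable]: "\<pi> \<in> borel_measurable P"
    and semimetric: "semimetric d" and C_borel[measurable]: "C \<in> sets borel"
    and V_in_C: "\<And>i \<omega>. i \<ge> 1 \<Longrightarrow> \<omega> \<in> space M \<Longrightarrow> \<pi> (V i \<omega>) \<in> C"
    and l_lim: "l \<longlonglongrightarrow> 0" and cover: "\<And>n. n \<ge> (1::nat) \<Longrightarrow> C \<subseteq> (\<Union>i. dball d (z n i) (l n))"
    and K_nonneg: "\<And>u. u \<ge> 0 \<Longrightarrow> K u \<ge> 0" and K_cont: "continuous_on {0..} K"
    and K_zero: "\<And>u. u \<ge> 1 \<Longrightarrow> K u = 0" and K_le: "\<And>u. u \<ge> 0 \<Longrightarrow> K u \<le> L"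
    and \<theta>_pos: "\<theta> > 0" and K_ge: "\<And>u. 0 \<le> u \<Longrightarrow> u < 1 \<Longrightarrow> \<theta> * (1 - u) < K u"
    and b_pos: "\<And>n. n \<ge> 1 \<Longrightarrow> b n > 0" and b_lim: "b \<longlonglongrightarrow> 0"
    and \<phi>_pos: "\<And>s. s > 0 \<Longrightarrow> \<phi> s > 0" and \<alpha>1: "\<alpha>\<^sub>1 > 0" and \<alpha>2: "\<alpha>\<^sub>2 > 0"
    and \<delta>: "0 < \<delta>" "\<delta> < 1" and c_pos: "c > 0" and ratio: "\<And>r. r > 0 \<Longrightarrow> c * \<phi> r \<le> \<phi> (\<delta> * r)"
    and ball_ge: "\<And>x r. x \<in> C \<Longrightarrow> r > 0 \<Longrightarrow> \<alpha>\<^sub>1 * \<phi> r \<le> measure P {u \<in> space P. \<pi> u \<in> dball d x r}"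
    and ball_le: "\<And>x r. x \<in> C \<Longrightarrow> r > 0 \<Longrightarrow> measure P {u \<in> space P. \<pi> u \<in> dball d x r} \<le> \<alpha>\<^sub>2 * \<phi> r"
    and rate: "filterlim (\<lambda>n. real n * \<phi> (b n)) at_top sequentially"
begin

sublocale M: prob_space M using iid by (rule iid_seq_prob_space)
sublocale P: prob_space P using iid by (rule iid_seq_prob_space)

lemma V_measurable: "i \<ge> 1 \<Longrightarrow> V i \<in> measurable M P"
  using iid by (simp add: iid_seq_def)

lemma d_nonneg: "0 \<le> d x y" and d_sym: "d x y = d y x" and d_self: "d x x = 0"
  and d_measurable[measurable]: "d x \<in> borel_measurable borel"
  using semimetric by (auto simp: semimetric_def)

lemma AE_in_C: "AE u in P. \<pi> u \<in> C"
proof -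
  have "distr M P (V 1) = P" using iid by (simp add: iid_seq_def)
  moreover have "AE u in distr M P (V 1). \<pi> u \<in> C"
    using V_in_C[of 1] V_measurable[of 1] by (subst AE_distr_iff) (auto intro!: AE_I2)
  ultimately show ?thesis by (simp only:)
qed

text \<open>A jointly measurable substitute for \<open>K (d x y / b n)\<close>, equal to it on
  \<open>C\<close> for n \<ge> 1 and cut off elsewhere. The \<open>n\<close> bound by the infimum
  numbers the covers and is distinct from the index of the bandwidth. The maximum with 0 makes
  continuity of \<open>K\<close> on the nonnegative half-line sufficient for measurability.\<close>

definition \<kappa> :: "nat \<Rightarrow> 'h \<Rightarrow> 'h \<Rightarrow> real" where
  "\<kappa> n x y = (if x \<in> C \<and> y \<in> C then K (max 0 ((INF (n, i). d (z n i) x + d (z n i) y) / b n)) else 0)"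

lemma \<kappa>_eq: "\<kappa> n x y = K (d x y / b n)" if "n \<ge> 1" "x \<in> C" "y \<in> C"
  using that semimetric_eq_INF[OF semimetric l_lim cover that(2), of y] b_pos[OF that(1)] d_nonneg[of x y]
  by (simp add: \<kappa>_def)

lemma \<kappa>_meas: "(\<lambda>(x, y). \<kappa> n x y) \<in> borel_measurable (borel \<Otimes>\<^sub>M borel)"
proof -
  have "continuous_on UNIV (\<lambda>u. K (max 0 u))"
    by (rule continuous_on_compose2[OF K_cont]) (auto intro!: continuous_intros)
  then have K[measurable]: "(\<lambda>u. K (max 0 u)) \<in> borel_measurable borel"
    by (rule borel_measurable_continuous_onI)
  have [measurable]: "(\<lambda>p. INF q. d (z (fst q) (snd q)) (fst p) + d (z (fst q) (snd q)) (snd p)) \<in> borel_measurable (borel \<Otimes>\<^sub>M borel)"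
    by (rule borel_measurable_cINF_real) auto
  have "(\<lambda>p. if fst p \<in> C \<and> snd p \<in> C then K (max 0 ((INF q. d (z (fst q) (snd q)) (fst p) + d (z (fst q) (snd q)) (snd p)) / b n)) else 0) \<in> borel_measurable (borel \<Otimes>\<^sub>M borel)"
    by measurable
  then show ?thesis by (simp add: \<kappa>_def case_prod_unfold)
qed

text \<open>On [0, \<delta>] the kernel is at least \<theta> (1 - \<delta>), so the ball of radius
  \<delta> b provides the lower bound on the mass, and the small-ball ratio expresses it through
  \<phi>(b). The support of the kernel lies in the ball of radius b.\<close>

lemma kernel_smoother:
  assumes n: "n \<ge> 1"
  shows "kernel_smoother P \<pi> (\<kappa> n) L (\<theta> * (1 - \<delta>)) (\<alpha>\<^sub>1 * c * \<phi> (b n)) (\<alpha>\<^sub>2 * \<phi> (b n))"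
proof (rule kernel_smoother.intro[OF P.prob_space_axioms], rule kernel_smoother_axioms.intro)
  note bn = b_pos[OF n]
  show L0: "\<kappa> n x y \<le> L" for x y using order_trans[OF K_nonneg[of 1] K_le[of 1]] K_le by (auto simp: \<kappa>_def)
  show "0 \<le> \<kappa> n x y" for x y using K_nonneg by (auto simp: \<kappa>_def)
  show pos: "0 < \<theta> * (1 - \<delta>)" using \<theta>_pos \<delta> by simp
  show "0 < \<alpha>\<^sub>1 * c * \<phi> (b n)" using \<alpha>1 c_pos \<phi>_pos[OF bn] by simp
  show "0 \<le> \<alpha>\<^sub>2 * \<phi> (b n)" using \<alpha>2 \<phi>_pos[OF bn] by simp
  show "\<theta> * (1 - \<delta>) \<le> \<kappa> n x x \<or> (\<forall>y. \<kappa> n x y = 0)" for x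
  proof (cases "x \<in> C")
    case True
    have "\<theta> * (1 - \<delta>) \<le> \<theta> * (1 - 0)" using \<theta>_pos \<delta> by (intro mult_left_mono) auto
    also have "\<dots> < K 0" using K_ge[of 0] by simp
    finally show ?thesis using \<kappa>_eq[OF n True True] by (simp add: d_self)
  qed (simp add: \<kappa>_def)
  show "\<alpha>\<^sub>1 * c * \<phi> (b n) \<le> P.prob {u \<in> space P. \<theta> * (1 - \<delta>) \<le> \<kappa> n x (\<pi> u)}" if "\<theta> * (1 - \<delta>) \<le> \<kappa> n x x" for x
  proof -
    have x: "x \<in> C" using that pos by (auto simp: \<kappa>_def split: if_splits)
    have "\<alpha>\<^sub>1 * c * \<phi> (b n) \<le> \<alpha>\<^sub>1 * \<phi> (\<delta> * b n)" using ratio[OF bn] \<alpha>1 by simp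
    also have "\<dots> \<le> P.prob {u \<in> space P. \<pi> u \<in> dball d x (\<delta> * b n)}" using x bn \<delta> by (intro ball_ge) auto
    \<comment> \<open>This inclusion of events is almost sure only: points outside \<open>C\<close>
      may lie in the ball, but there the substitute kernel is 0.\<close>
    also have "\<dots> \<le> P.prob {u \<in> space P. \<theta> * (1 - \<delta>) \<le> \<kappa> n x (\<pi> u)}"
    proof (rule P.finite_measure_mono_AE)
      have [measurable]: "(\<lambda>u. \<kappa> n x (\<pi> u)) \<in> borel_measurable P"
        using measurable_compose[OF _ \<kappa>_meas, of "\<lambda>u. (x, \<pi> u)" P] by simp
      show "{u \<in> space P. \<theta> * (1 - \<delta>) \<le> \<kappa> n x (\<pi> u)} \<in> P.events" by measurable
      show "AE u in P. u \<in> {u \<in> space P. \<pi> u \<in> dball d x (\<delta> * b n)} \<longrightarrow> u \<in> {u \<in> space P. \<theta> * (1 - \<delta>) \<le> \<kappa> n x (\<pi> u)}"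
        using AE_in_C
      proof eventually_elim
        case (elim u)
        show ?case
        proof
          assume u: "u \<in> {u \<in> space P. \<pi> u \<in> dball d x (\<delta> * b n)}"
          then have "d x (\<pi> u) / b n < \<delta>" using bn d_sym[of x "\<pi> u"] by (simp add: dball_def field_simps)
          moreover have "0 \<le> d x (\<pi> u) / b n" using d_nonneg bn by simp
          ultimately have "\<theta> * (1 - \<delta>) \<le> \<theta> * (1 - d x (\<pi> u) / b n)" "\<theta> * (1 - d x (\<pi> u) / b n) < K (d x (\<pi> u) / b n)"
            using \<theta>_pos \<delta> by (auto intro!: mult_left_mono K_ge)
          then show "u \<in> {u \<in> space P. \<theta> * (1 - \<delta>) \<le> \<kappa> n x (\<pi> u)}"
            using \<kappa>_eq[OF n x elim] u by simp
        qed
      qed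
    qed
    finally show ?thesis .
  qed
  show "P.prob {u \<in> space P. \<kappa> n (\<pi> u) y \<noteq> 0} \<le> \<alpha>\<^sub>2 * \<phi> (b n)" for y
  proof (cases "y \<in> C")
    case True
    have "P.prob {u \<in> space P. \<kappa> n (\<pi> u) y \<noteq> 0} \<le> P.prob {u \<in> space P. \<pi> u \<in> dball d y (b n)}"
    proof (rule P.finite_measure_mono)
      show "{u \<in> space P. \<kappa> n (\<pi> u) y \<noteq> 0} \<subseteq> {u \<in> space P. \<pi> u \<in> dball d y (b n)}"
      proof safe
        fix u assume u: "\<kappa> n (\<pi> u) y \<noteq> 0"
        then have "\<pi> u \<in> C" by (auto simp: \<kappa>_def split: if_splits)
        then have "K (d (\<pi> u) y / b n) \<noteq> 0" using u \<kappa>_eq[OF n _ True] by simp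
        then have "d (\<pi> u) y / b n < 1" using K_zero not_less by blast
        then show "\<pi> u \<in> dball d y (b n)" using bn by (simp add: dball_def)
      qed
      have "{u \<in> space P. d y (\<pi> u) < b n} \<in> P.events" by measurable
      then show "{u \<in> space P. \<pi> u \<in> dball d y (b n)} \<in> P.events" by (simp add: dball_def d_sym[of _ y])
    qed
    also have "\<dots> \<le> \<alpha>\<^sub>2 * \<phi> (b n)" using True bn by (rule ball_le)
    finally show ?thesis .
  qed (use \<alpha>2 \<phi>_pos[OF bn] in \<open>simp add: \<kappa>_def\<close>)
qed (simp_all add: \<kappa>_meas)

abbreviation wt where "wt n \<omega> i j \<equiv> kernel_weight K d (b n) n (\<lambda>i. \<pi> (V i \<omega>)) (\<pi> (V i \<omega>)) j"

lemma wt_eq_nw_weight: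
  assumes "i \<in> {1..n}" "j \<in> {1..n}" "\<omega> \<in> space M"
  shows "wt n \<omega> i j = nw_weight (\<kappa> n) {1..n} (\<lambda>l. \<pi> (V l \<omega>)) i j"
proof -
  have "\<kappa> n (\<pi> (V i \<omega>)) (\<pi> (V l \<omega>)) = K (d (\<pi> (V i \<omega>)) (\<pi> (V l \<omega>)) / b n)" if "l \<in> {1..n}" for l
    using assms that by (intro \<kappa>_eq V_in_C) auto
  then show ?thesis using assms by (simp add: kernel_weight_def nw_weight_def)
qed

text \<open>The second-moment bound for the smoother, here of order
  \<open>1 / (n \<phi>(b n))\<close>, tends to 0 by the rate condition; Markov's inequality turns
  this into convergence in probability.\<close>

lemma tendsto_smoothed_noise:
  fixes f :: "'s \<Rightarrow> real"
  assumes f: "f \<in> borel_measurable P" and f2: "integrable P (\<lambda>u. (f u)\<^sup>2)"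
    and orth: "centered_given P \<pi> f"
  shows "((\<lambda>(n, \<omega>). avg n (\<lambda>i. (\<Sum>j=1..n. wt n \<omega> i j * f (V j \<omega>))\<^sup>2)) \<longlongrightarrow> 0) (in_prob M)"
proof -
  define F where "F = (\<integral>u. (f u)\<^sup>2 \<partial>P)"
  define B where "B n = (L / (\<theta> * (1 - \<delta>)))\<^sup>2 * 48 * (1 / (real (n - 1) * (\<alpha>\<^sub>1 * c * \<phi> (b n)))\<^sup>2 +
    real n * (\<alpha>\<^sub>2 * \<phi> (b n)) / (real (n - 2) * (\<alpha>\<^sub>1 * c * \<phi> (b n)))\<^sup>2)" for n
  have F: "F \<ge> 0" by (simp add: F_def)
  define Q where "Q n \<omega> = avg n (\<lambda>i. (\<Sum>j=1..n. wt n \<omega> i j * f (V j \<omega>))\<^sup>2)" for n \<omega>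
  have Q: "integrable M (Q n)" "(\<integral>\<omega>. Q n \<omega> \<partial>M) \<le> B n * F" if n: "n \<ge> 3" for n
  proof -
    from n have n1: "n \<ge> 1" by simp
    interpret S: kernel_smoother P \<pi> "\<kappa> n" L "\<theta> * (1 - \<delta>)" "\<alpha>\<^sub>1 * c * \<phi> (b n)" "\<alpha>\<^sub>2 * \<phi> (b n)"
      using n1 by (rule kernel_smoother)
    define G where "G \<omega> = avg n (\<lambda>i. (\<Sum>j=1..n. nw_weight (\<kappa> n) {1..n} (\<lambda>l. \<pi> (V l \<omega>)) i j * f (V j \<omega>))\<^sup>2)" for \<omega>
    have G: "integrable M G"
      unfolding G_def by (rule S.integral_avg_smooth_square_le(1)[OF f f2 orth iid n])
    have "S.smooth_bound n = B n" unfolding S.smooth_bound_def B_def ..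
    then have G': "(\<integral>\<omega>. G \<omega> \<partial>M) \<le> B n * F"
      using S.integral_avg_smooth_square_le(2)[OF f f2 orth iid n] unfolding G_def F_def by (simp only:)
    have eq: "Q n \<omega> = G \<omega>" if "\<omega> \<in> space M" for \<omega>
      unfolding Q_def G_def avg_def using that
      by (intro arg_cong[where f="scaleR _"] sum.cong refl arg_cong[where f="\<lambda>x. x\<^sup>2"]) (simp add: wt_eq_nw_weight)
    show "integrable M (Q n)" using G eq by (simp cong: Bochner_Integration.integrable_cong)
    show "(\<integral>\<omega>. Q n \<omega> \<partial>M) \<le> B n * F" using G' eq by (simp cong: Bochner_Integration.integral_cong)
  qed
  have Qnn: "0 \<le> Q n \<omega>" for n \<omega> by (auto simp: Q_def avg_def intro!: sum_nonneg divide_nonneg_nonneg)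
  have "\<forall>\<^sub>F n in sequentially. integrable M (Q n) \<and> (\<forall>\<omega>\<in>space M. 0 \<le> Q n \<omega>) \<and> (\<integral>\<omega>. Q n \<omega> \<partial>M) \<le> B n * F"
    using eventually_ge_at_top[of 3] by eventually_elim (use Q Qnn in auto)
  moreover have "(\<lambda>n. B n * F) \<longlonglongrightarrow> 0"
  proof -
    define D where "D = (L / (\<theta> * (1 - \<delta>)))\<^sup>2 * 48"
    define e where "e = \<alpha>\<^sub>1 * c"
    have e: "e > 0" using \<alpha>1 c_pos by (simp add: e_def)
    have inv: "(\<lambda>n. inverse (real n * \<phi> (b n))) \<longlonglongrightarrow> 0"
      by (rule tendsto_inverse_0_at_top[OF rate])
    \<comment> \<open>Each 9 comes from \<open>n - 1\<close> and \<open>n - 2\<close> being at least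
      \<open>n / 3\<close> for n \<ge> 3, squared in the denominator.\<close>
    define U where "U n = D * (9 / e\<^sup>2 * (inverse (real n * \<phi> (b n)))\<^sup>2 + 9 * \<alpha>\<^sub>2 / e\<^sup>2 * inverse (real n * \<phi> (b n)))" for n
    have "(\<lambda>n. U n * F) \<longlonglongrightarrow> D * (9 / e\<^sup>2 * 0\<^sup>2 + 9 * \<alpha>\<^sub>2 / e\<^sup>2 * 0) * F"
      unfolding U_def by (intro tendsto_intros inv)
    then have U: "(\<lambda>n. U n * F) \<longlonglongrightarrow> 0" by simp
    show ?thesis
    proof (rule tendsto_0_sandwich[OF U])
      show "\<forall>\<^sub>F n in sequentially. \<bar>B n * F\<bar> \<le> U n * F"
        using eventually_ge_at_top[of 3]
      proof eventually_elim
        case (elim n)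
        define t where "t = \<phi> (b n)"
        have t: "t > 0" using \<phi>_pos b_pos elim by (simp add: t_def)
        define N where "N = real n"
        have N: "N > 0" "N / 3 \<le> real (n - 1)" "N / 3 \<le> real (n - 2)" using elim by (auto simp: N_def)
        have "1 / (real (n - 1) * (e * t))\<^sup>2 \<le> 1 / (N / 3 * (e * t))\<^sup>2"
          using N e t by (intro divide_left_mono power_mono mult_right_mono) auto
        also have "\<dots> = 9 / e\<^sup>2 * (inverse (N * t))\<^sup>2" using N e t by (simp add: field_simps power2_eq_square)
        finally have 1: "1 / (real (n - 1) * (e * t))\<^sup>2 \<le> 9 / e\<^sup>2 * (inverse (N * t))\<^sup>2" .
        have "N * (\<alpha>\<^sub>2 * t) / (real (n - 2) * (e * t))\<^sup>2 \<le> N * (\<alpha>\<^sub>2 * t) / (N / 3 * (e * t))\<^sup>2"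
          using N e t \<alpha>2 by (intro divide_left_mono power_mono mult_right_mono) auto
        also have "\<dots> = 9 * \<alpha>\<^sub>2 / e\<^sup>2 * inverse (N * t)" using N e t by (simp add: field_simps power2_eq_square)
        finally have 2: "N * (\<alpha>\<^sub>2 * t) / (real (n - 2) * (e * t))\<^sup>2 \<le> 9 * \<alpha>\<^sub>2 / e\<^sup>2 * inverse (N * t)" .
        have "B n \<le> U n"
          unfolding B_def U_def D_def[symmetric] e_def[symmetric] t_def[symmetric] N_def[symmetric]
          using 1 2 by (intro mult_left_mono add_mono) (auto simp: D_def)
        moreover have "0 \<le> B n"
          unfolding B_def using \<alpha>2 t by (auto simp: t_def intro!: mult_nonneg_nonneg add_nonneg_nonneg divide_nonneg_nonneg)
        ultimately show ?case using F by (simp add: abs_mult mult_right_mono)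
      qed
    qed
  qed
  ultimately show ?thesis unfolding Q_def[symmetric] by (rule tendsto_0_in_prob_L1[OF M.prob_space_axioms])
qed

text \<open>The denominator contains the positive number \<open>K 0\<close>, so the weights form a
  probability vector. They vanish at distances from \<open>b n\<close> on, and the Hoelder condition
  bounds each remaining difference.\<close>

lemma smoothed_regression_bound:
  fixes h :: "'h \<Rightarrow> real"
  assumes h: "\<And>u v. u \<in> C \<Longrightarrow> v \<in> C \<Longrightarrow> \<bar>h u - h v\<bar> \<le> D * d u v powr \<alpha>" and "\<alpha> > 0" "D \<ge> 0"
    and i: "i \<in> {1..n}" and \<omega>: "\<omega> \<in> space M"
  shows "(\<Sum>j=1..n. wt n \<omega> i j) = 1"
    and "\<bar>h (\<pi> (V i \<omega>)) - (\<Sum>j=1..n. wt n \<omega> i j * h (\<pi> (V j \<omega>)))\<bar> \<le> D * b n powr \<alpha>"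
proof -
  from i have n: "n \<ge> 1" by simp
  note bn = b_pos[OF n]
  have Kd: "0 \<le> K (d x y / b n)" for x y using d_nonneg bn by (intro K_nonneg) simp
  have "0 < K 0" using K_ge[of 0] \<theta>_pos by simp
  also have "K 0 = K (d (\<pi> (V i \<omega>)) (\<pi> (V i \<omega>)) / b n)" by (simp add: d_self)
  also have "\<dots> \<le> (\<Sum>j=1..n. K (d (\<pi> (V i \<omega>)) (\<pi> (V j \<omega>)) / b n))"
    using i Kd by (intro member_le_sum) auto
  finally have den: "0 < (\<Sum>j=1..n. K (d (\<pi> (V i \<omega>)) (\<pi> (V j \<omega>)) / b n))" .
  then show one: "(\<Sum>j=1..n. wt n \<omega> i j) = 1"
    unfolding kernel_weight_def sum_divide_distrib[symmetric] by simp
  have w0: "0 \<le> wt n \<omega> i j" for j unfolding kernel_weight_def using den Kd by simp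
  have "\<bar>h (\<pi> (V i \<omega>)) - (\<Sum>j=1..n. wt n \<omega> i j * h (\<pi> (V j \<omega>)))\<bar>
    = \<bar>\<Sum>j=1..n. wt n \<omega> i j * (h (\<pi> (V i \<omega>)) - h (\<pi> (V j \<omega>)))\<bar>"
    using one by (simp add: right_diff_distrib sum_subtractf sum_distrib_right[symmetric])
  also have "\<dots> \<le> (\<Sum>j=1..n. wt n \<omega> i j * (D * b n powr \<alpha>))"
  proof (rule order_trans[OF sum_abs], rule sum_mono)
    fix j assume j: "j \<in> {1..n}"
    show "\<bar>wt n \<omega> i j * (h (\<pi> (V i \<omega>)) - h (\<pi> (V j \<omega>)))\<bar> \<le> wt n \<omega> i j * (D * b n powr \<alpha>)"
    proof (cases "d (\<pi> (V i \<omega>)) (\<pi> (V j \<omega>)) \<le> b n")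
      case True
      have "\<bar>h (\<pi> (V i \<omega>)) - h (\<pi> (V j \<omega>))\<bar> \<le> D * d (\<pi> (V i \<omega>)) (\<pi> (V j \<omega>)) powr \<alpha>"
        using i j \<omega> by (intro h V_in_C) auto
      also have "\<dots> \<le> D * b n powr \<alpha>"
        using True d_nonneg \<open>\<alpha> > 0\<close> \<open>D \<ge> 0\<close> by (intro mult_left_mono powr_mono2) auto
      finally show ?thesis using w0[of j] by (simp add: abs_mult mult_left_mono)
    next
      case False
      then have "K (d (\<pi> (V i \<omega>)) (\<pi> (V j \<omega>)) / b n) = 0" using bn by (intro K_zero) simp
      then show ?thesis by (simp add: kernel_weight_def)
    qed
  qed
  also have "\<dots> = D * b n powr \<alpha>" using one by (simp add: sum_distrib_right[symmetric])
  finally show "\<bar>h (\<pi> (V i \<omega>)) - (\<Sum>j=1..n. wt n \<omega> i j * h (\<pi> (V j \<omega>)))\<bar> \<le> D * b n powr \<alpha>" .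
qed

text \<open>The first bracket is a bias, uniformly of order \<open>b n powr \<alpha>\<close>; the
  second is smoothed noise, small in quadratic mean. They are separated by (H - S)^2 \<le> 2 H^2 + 2
  S^2.\<close>

lemma tendsto_smoothing_error:
  fixes f :: "'s \<Rightarrow> real" and h :: "'h \<Rightarrow> real"
  assumes f: "f \<in> borel_measurable P" and f2: "integrable P (\<lambda>u. (f u)\<^sup>2)"
    and orth: "centered_given P \<pi> f"
    and h: "\<And>u v. u \<in> C \<Longrightarrow> v \<in> C \<Longrightarrow> \<bar>h u - h v\<bar> \<le> D * d u v powr \<alpha>" and \<alpha>: "\<alpha> > 0" and D: "D \<ge> 0"
  shows "((\<lambda>(n, \<omega>). avg n (\<lambda>i. ((h (\<pi> (V i \<omega>)) - (\<Sum>j=1..n. wt n \<omega> i j * h (\<pi> (V j \<omega>))))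
     - (\<Sum>j=1..n. wt n \<omega> i j * f (V j \<omega>)))\<^sup>2)) \<longlongrightarrow> 0) (in_prob M)"
proof -
  define S where "S n \<omega> i = (\<Sum>j=1..n. wt n \<omega> i j * f (V j \<omega>))" for n \<omega> i
  define H where "H n \<omega> i = h (\<pi> (V i \<omega>)) - (\<Sum>j=1..n. wt n \<omega> i j * h (\<pi> (V j \<omega>)))" for n \<omega> i
  have "(\<lambda>n. b n powr \<alpha>) \<longlonglongrightarrow> 0"
  proof (rule tendsto_zero_powrI[OF b_lim tendsto_const _ \<alpha>])
    show "\<forall>\<^sub>F n in sequentially. 0 \<le> b n"
      using eventually_ge_at_top[of 1] by eventually_elim (use b_pos in \<open>auto intro: less_imp_le\<close>)
  qed
  then have "(\<lambda>n. 2 * (D * b n powr \<alpha>)\<^sup>2) \<longlonglongrightarrow> 2 * (D * 0)\<^sup>2" by (intro tendsto_intros)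
  then have 1: "((\<lambda>(n, \<omega>). 2 * (D * b n powr \<alpha>)\<^sup>2) \<longlongrightarrow> 0) (in_prob M)"
    using tendsto_in_prob_deterministic[OF M.prob_space_axioms] by fastforce
  have 2: "((\<lambda>p. 2 * (case p of (n, \<omega>) \<Rightarrow> avg n (\<lambda>i. (S n \<omega> i)\<^sup>2))) \<longlongrightarrow> 2 * 0) (in_prob M)"
    unfolding S_def by (intro tendsto_intros tendsto_smoothed_noise f f2 orth)
  have le: "\<bar>avg n (\<lambda>i. (H n \<omega> i - S n \<omega> i)\<^sup>2)\<bar> \<le> 2 * (D * b n powr \<alpha>)\<^sup>2 + 2 * avg n (\<lambda>i. (S n \<omega> i)\<^sup>2)"
    if n: "n \<ge> 1" and \<omega>: "\<omega> \<in> space M" for n \<omega>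
  proof -
    have "(H n \<omega> i - S n \<omega> i)\<^sup>2 \<le> 2 * (D * b n powr \<alpha>)\<^sup>2 + 2 * (S n \<omega> i)\<^sup>2" if "i \<in> {1..n}" for i
    proof -
      have "0 \<le> (H n \<omega> i + S n \<omega> i)\<^sup>2" by simp
      then have "(H n \<omega> i - S n \<omega> i)\<^sup>2 \<le> 2 * (H n \<omega> i)\<^sup>2 + 2 * (S n \<omega> i)\<^sup>2" by (simp add: power2_eq_square algebra_simps)
      moreover have "\<bar>H n \<omega> i\<bar> \<le> D * b n powr \<alpha>"
        unfolding H_def using smoothed_regression_bound(2)[OF h \<alpha> D that \<omega>] by simp
      then have "\<bar>H n \<omega> i\<bar>\<^sup>2 \<le> (D * b n powr \<alpha>)\<^sup>2" by (intro power_mono) auto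
      ultimately show ?thesis by simp
    qed
    then have "(\<Sum>i=1..n. (H n \<omega> i - S n \<omega> i)\<^sup>2) \<le> (\<Sum>i=1..n. 2 * (D * b n powr \<alpha>)\<^sup>2 + 2 * (S n \<omega> i)\<^sup>2)"
      by (rule sum_mono)
    also have "\<dots> = real n * (2 * (D * b n powr \<alpha>)\<^sup>2) + 2 * (\<Sum>i=1..n. (S n \<omega> i)\<^sup>2)"
      by (simp add: sum.distrib sum_distrib_left)
    finally have "avg n (\<lambda>i. (H n \<omega> i - S n \<omega> i)\<^sup>2) \<le> 2 * (D * b n powr \<alpha>)\<^sup>2 + 2 * avg n (\<lambda>i. (S n \<omega> i)\<^sup>2)"
      using n by (simp add: avg_def field_simps)
    moreover have "0 \<le> avg n (\<lambda>i. (H n \<omega> i - S n \<omega> i)\<^sup>2)" by (simp add: avg_def sum_nonneg)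
    ultimately show ?thesis by simp
  qed
  have "((\<lambda>(n, \<omega>). avg n (\<lambda>i. (H n \<omega> i - S n \<omega> i)\<^sup>2)) \<longlongrightarrow> 0) (in_prob M)"
  proof (rule tendsto_0_sandwich)
    show "((\<lambda>p. (case p of (n, \<omega>) \<Rightarrow> 2 * (D * b n powr \<alpha>)\<^sup>2) +
       2 * (case p of (n, \<omega>) \<Rightarrow> avg n (\<lambda>i. (S n \<omega> i)\<^sup>2))) \<longlongrightarrow> 0) (in_prob M)"
      using tendsto_add[OF 1 2] by simp
    show "\<forall>\<^sub>F p in in_prob M. \<bar>case p of (n, \<omega>) \<Rightarrow> avg n (\<lambda>i. (H n \<omega> i - S n \<omega> i)\<^sup>2)\<bar>
      \<le> (case p of (n, \<omega>) \<Rightarrow> 2 * (D * b n powr \<alpha>)\<^sup>2) + 2 * (case p of (n, \<omega>) \<Rightarrow> avg n (\<lambda>i. (S n \<omega> i)\<^sup>2))"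
      by (intro eventually_in_probI[OF M.prob_space_axioms] eventually_mono[OF eventually_ge_at_top[of 1]])
        (use le in auto)
  qed
  then show ?thesis unfolding H_def S_def .
qed

end

text \<open>A Borel function of \<open>W\<close> is measurable for the sigma-algebra generated by
  \<open>W\<close>, so it may be moved in and out of the conditional expectation.\<close>

lemma
  fixes W :: "'w \<Rightarrow> 'a::topological_space" and f :: "'w \<Rightarrow> real"
  assumes "prob_space M" and W: "W \<in> borel_measurable M" and \<psi>: "\<psi> \<in> borel_measurable borel"
    and f: "f \<in> borel_measurable M" and int: "integrable M (\<lambda>\<omega>. \<psi> (W \<omega>) * f \<omega>)"
  shows integral_mult_cond_exp_given: "(\<integral>\<omega>. \<psi> (W \<omega>) * cond_exp_given M W f \<omega> \<partial>M) = (\<integral>\<omega>. \<psi> (W \<omega>) * f \<omega> \<partial>M)"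
    and integrable_mult_cond_exp_given: "integrable M (\<lambda>\<omega>. \<psi> (W \<omega>) * cond_exp_given M W f \<omega>)"
proof -
  interpret prob_space M by fact
  let ?F = "vimage_algebra (space M) W borel"
  have "subalgebra M ?F"
  proof -
    have "sets ?F \<subseteq> sets M"
      unfolding sets_vimage_algebra by (rule sets.sigma_sets_subset) (use measurable_sets[OF W] in auto)
    then show ?thesis by (simp add: subalgebra_def)
  qed
  then interpret finite_measure_subalgebra M ?F by unfold_locales
  have "W \<in> measurable ?F borel" by (rule measurable_vimage_algebra1) simp
  then have "(\<lambda>\<omega>. \<psi> (W \<omega>)) \<in> borel_measurable ?F" using \<psi> by (rule measurable_compose)
  from real_cond_exp_intg[OF int this f]
  show "(\<integral>\<omega>. \<psi> (W \<omega>) * cond_exp_given M W f \<omega> \<partial>M) = (\<integral>\<omega>. \<psi> (W \<omega>) * f \<omega> \<partial>M)"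
    "integrable M (\<lambda>\<omega>. \<psi> (W \<omega>) * cond_exp_given M W f \<omega>)"
    by (simp_all add: cond_exp_given_def)
qed

lemma borel_measurable_vec_nth':
  fixes f :: "'a \<Rightarrow> real ^ 'n"
  shows "f \<in> borel_measurable M \<Longrightarrow> (\<lambda>x. f x $ k) \<in> borel_measurable M"
  by (rule borel_measurable_continuous_on[where f="\<lambda>v. v $ k"]) (auto intro!: continuous_intros)

lemma det_scaled_nonzero:
  fixes A :: "real ^ 'n ^ 'n"
  assumes "det A \<noteq> 0" "r \<noteq> 0"
  shows "det (\<chi> i j. r * A $ i $ j) \<noteq> 0"
proof -
  have "(\<chi> i j. r * A $ i $ j) = (\<chi> i. r *s A $ i)" by (simp add: vec_eq_iff)
  then have "det (\<chi> i j. r * A $ i $ j) = prod (\<lambda>_. r) (UNIV :: 'n set) * det A"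
    using det_rows_mul[of "\<lambda>_. r" "\<lambda>i. A $ i"] by simp
  then show ?thesis using assms by simp
qed

lemma matrix_inv_mult_eq_iff:
  fixes A :: "real ^ 'n ^ 'n"
  assumes "det A \<noteq> 0"
  shows "matrix_inv A *v v = x \<longleftrightarrow> A *v x = v"
  using cramer[OF assms, of x v] assms by (auto simp: matrix_inv_mult_Cramer[of A v])

text \<open>Normal equations: the estimation error solves them with the noise in place of the response.\<close>

lemma least_squares_error:
  fixes n :: nat and zt :: "nat \<Rightarrow> real ^ 'n" and \<beta> :: "real ^ 'n"
  defines "A \<equiv> (\<chi> k l. avg n (\<lambda>i. zt i $ k * zt i $ l))"
  assumes n: "n \<ge> 1" and A: "det A \<noteq> 0" and yt: "\<And>i. i \<in> {1..n} \<Longrightarrow> yt i = zt i \<bullet> \<beta> + v i"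
  shows "matrix_inv (\<chi> k l. \<Sum>i=1..n. zt i $ k * zt i $ l) *v (\<chi> k. \<Sum>i=1..n. zt i $ k * yt i)
    = \<beta> + matrix_inv A *v (\<chi> k. avg n (\<lambda>i. zt i $ k * v i))"
proof -
  let ?S = "\<chi> k l. \<Sum>i=1..n. zt i $ k * zt i $ l"
  let ?c = "\<chi> k. avg n (\<lambda>i. zt i $ k * v i)"
  define x where "x = matrix_inv A *v ?c"
  have Ax: "A *v x = ?c" unfolding x_def using matrix_inv_mult_eq_iff[OF A] by blast
  have S: "?S = (\<chi> k l. real n * A $ k $ l)" using n by (simp add: A_def avg_def)
  have "?S *v (\<beta> + x) = (\<chi> k. \<Sum>i=1..n. zt i $ k * yt i)"
  proof (rule vec_eq_iff[THEN iffD2], rule allI)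
    fix k
    have "(?S *v \<beta>) $ k = (\<Sum>i=1..n. zt i $ k * (zt i \<bullet> \<beta>))"
      by (simp add: matrix_vector_mult_def inner_vec_def sum_distrib_left sum_distrib_right sum.swap[of _ _ UNIV] mult_ac)
    moreover have "(?S *v x) $ k = real n * (A *v x) $ k"
      unfolding S by (simp add: matrix_vector_mult_def sum_distrib_left mult_ac)
    moreover have "real n * (A *v x) $ k = (\<Sum>i=1..n. zt i $ k * v i)"
      unfolding Ax using n by (simp add: avg_def)
    moreover have "(\<Sum>i=1..n. zt i $ k * yt i) = (\<Sum>i=1..n. zt i $ k * (zt i \<bullet> \<beta>)) + (\<Sum>i=1..n. zt i $ k * v i)"
      unfolding sum.distrib[symmetric] by (intro sum.cong) (simp_all add: yt algebra_simps)
    ultimately show "(?S *v (\<beta> + x)) $ k = (\<chi> k. \<Sum>i=1..n. zt i $ k * yt i) $ k"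
      by (simp add: matrix_vector_right_distrib)
  qed
  moreover have "det ?S \<noteq> 0" unfolding S using A n by (intro det_scaled_nonzero) auto
  ultimately show ?thesis using matrix_inv_mult_eq_iff[of ?S] by (simp add: x_def)
qed

text \<open>The error of the model as a function of one observation (y, z, x).\<close>

definition noise :: "real ^ 'p \<Rightarrow> ('h \<Rightarrow> real) \<Rightarrow> real \<times> (real ^ 'p) \<times> 'h \<Rightarrow> real" where
  "noise \<beta> m u = fst u - fst (snd u) \<bullet> \<beta> - m (snd (snd u))"

text \<open>The component \<open>\<eta>\<^sub>k\<close> of the covariate residual as a function of
  one observation.\<close>

definition cov_noise :: "('p \<Rightarrow> 'h \<Rightarrow> real) \<Rightarrow> 'p \<Rightarrow> real \<times> (real ^ 'p) \<times> 'h \<Rightarrow> real" where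
  "cov_noise g k u = fst (snd u) $ k - g k (snd (snd u))"

text \<open>The conditions on the model are stated for the law \<open>P\<close> of one observation.
  The orthogonality \<open>noise_cov_noise\<close> makes the limit of the score vanish, and
  \<open>pos_def\<close> makes the limit of the Gram matrix invertible.\<close>

locale partially_linear_regression =
  kernel_regression M P V "\<lambda>u. snd (snd u)" d C z l K L \<theta> b \<phi> \<alpha>\<^sub>1 \<alpha>\<^sub>2 \<delta> c
  for M :: "'w measure" and P :: "(real \<times> (real ^ 'p) \<times> 'h::{real_inner, banach, second_countable_topology}) measure"
    and V d C z l K L \<theta> b \<phi> \<alpha>\<^sub>1 \<alpha>\<^sub>2 \<delta> c +
  fixes \<beta> :: "real ^ 'p" and m :: "'h \<Rightarrow> real" and g :: "'p \<Rightarrow> 'h \<Rightarrow> real" and D \<alpha> :: real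
  assumes sets_P[measurable_cong]: "sets P = sets borel"
    and m_meas[measurable]: "m \<in> borel_measurable borel" and g_meas[measurable]: "\<And>k. g k \<in> borel_measurable borel"
    and \<alpha>_pos: "\<alpha> > 0" and D_nonneg: "D \<ge> 0"
    and m_Hoelder: "\<And>u v. u \<in> C \<Longrightarrow> v \<in> C \<Longrightarrow> \<bar>m u - m v\<bar> \<le> D * d u v powr \<alpha>"
    and g_Hoelder: "\<And>k u v. u \<in> C \<Longrightarrow> v \<in> C \<Longrightarrow> \<bar>g k u - g k v\<bar> \<le> D * d u v powr \<alpha>"
    and noise_sq: "integrable P (\<lambda>u. (noise \<beta> m u)\<^sup>2)"
    and cov_noise_sq: "\<And>k. integrable P (\<lambda>u. (cov_noise g k u)\<^sup>2)"
    and noise_centered: "centered_given P (\<lambda>u. snd (snd u)) (noise \<beta> m)"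
    and cov_noise_centered: "\<And>k. centered_given P (\<lambda>u. snd (snd u)) (cov_noise g k)"
    and noise_cov_noise: "\<And>k. (\<integral>u. cov_noise g k u * noise \<beta> m u \<partial>P) = 0"
    and pos_def: "pos_def_matrix (\<chi> k l. \<integral>u. cov_noise g k u * cov_noise g l u \<partial>P)"
begin

abbreviation estimator where
  "estimator n \<omega> \<equiv> beta_tilde K d (b n) n (\<lambda>i. fst (V i \<omega>)) (\<lambda>i. fst (snd (V i \<omega>))) (\<lambda>i. snd (snd (V i \<omega>)))"

lemma fst_snd_measurable:
  "fst \<in> borel_measurable P" "(\<lambda>u. fst (snd u)) \<in> borel_measurable P" "(\<lambda>u. snd (snd u)) \<in> borel_measurable P"
  unfolding measurable_cong_sets[OF sets_P refl]
  by (intro borel_measurable_continuous_onI continuous_intros)+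

lemma noise_measurable[measurable]: "noise \<beta> m \<in> borel_measurable P"
  unfolding noise_def[abs_def] using fst_snd_measurable by measurable

lemma cov_noise_measurable[measurable]: "cov_noise g k \<in> borel_measurable P"
  unfolding cov_noise_def[abs_def]
  by (intro borel_measurable_diff borel_measurable_vec_nth' fst_snd_measurable measurable_compose[OF fst_snd_measurable(3) g_meas])

text \<open>What separates the smoothed residual of the covariates from \<open>cov_noise\<close>:
  the bias of smoothing \<open>g k\<close> minus the smoothed noise. \<open>ry\<close> plays the
  same part for the response.\<close>

abbreviation rz where
  "rz k n \<omega> i \<equiv> (g k (snd (snd (V i \<omega>))) - (\<Sum>j=1..n. wt n \<omega> i j * g k (snd (snd (V j \<omega>)))))
     - (\<Sum>j=1..n. wt n \<omega> i j * cov_noise g k (V j \<omega>))"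

abbreviation ry where
  "ry n \<omega> i \<equiv> (m (snd (snd (V i \<omega>))) - (\<Sum>j=1..n. wt n \<omega> i j * m (snd (snd (V j \<omega>)))))
     - (\<Sum>j=1..n. wt n \<omega> i j * noise \<beta> m (V j \<omega>))"

abbreviation zt where
  "zt n \<omega> \<equiv> smooth_resid K d (b n) n (\<lambda>i. snd (snd (V i \<omega>))) (\<lambda>i. fst (snd (V i \<omega>)))"

abbreviation yt where
  "yt n \<omega> \<equiv> smooth_resid K d (b n) n (\<lambda>i. snd (snd (V i \<omega>))) (\<lambda>i. fst (V i \<omega>))"

lemma zt_eq: "zt n \<omega> i $ k = cov_noise g k (V i \<omega>) + rz k n \<omega> i"
  by (simp add: smooth_resid_def cov_noise_def right_diff_distrib sum_subtractf)

lemma yt_eq: "yt n \<omega> i = zt n \<omega> i \<bullet> \<beta> + (noise \<beta> m (V i \<omega>) + ry n \<omega> i)"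
  by (simp add: smooth_resid_def noise_def right_diff_distrib sum_subtractf inner_diff_left inner_sum_left)

lemma tendsto_rz: "((\<lambda>(n, \<omega>). avg n (\<lambda>i. (rz k n \<omega> i)\<^sup>2)) \<longlongrightarrow> 0) (in_prob M)"
  by (rule tendsto_smoothing_error[OF cov_noise_measurable cov_noise_sq cov_noise_centered g_Hoelder \<alpha>_pos D_nonneg])

lemma tendsto_ry: "((\<lambda>(n, \<omega>). avg n (\<lambda>i. (ry n \<omega> i)\<^sup>2)) \<longlongrightarrow> 0) (in_prob M)"
  by (rule tendsto_smoothing_error[OF noise_measurable noise_sq noise_centered m_Hoelder \<alpha>_pos D_nonneg])

abbreviation gram where
  "gram n \<omega> \<equiv> (\<chi> k l. avg n (\<lambda>i. zt n \<omega> i $ k * zt n \<omega> i $ l))"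

abbreviation score where
  "score n \<omega> \<equiv> (\<chi> k. avg n (\<lambda>i. zt n \<omega> i $ k * (noise \<beta> m (V i \<omega>) + ry n \<omega> i)))"

lemma tendsto_gram:
  "((\<lambda>p. gram (fst p) (snd p) $ k $ r) \<longlongrightarrow> (\<integral>u. cov_noise g k u * cov_noise g r u \<partial>P)) (in_prob M)"
proof -
  note w = weak_law_of_large_numbers[OF iid, unfolded case_prod_unfold]
  have "((\<lambda>p. avg (fst p) (\<lambda>i. (cov_noise g k (V i (snd p)) + rz k (fst p) (snd p) i) *
      (cov_noise g r (V i (snd p)) + rz r (fst p) (snd p) i)))
    \<longlongrightarrow> (\<integral>u. cov_noise g k u * cov_noise g r u \<partial>P)) (in_prob M)"
    by (rule tendsto_avg_mult_perturbed[OF w[OF cov_noise_sq] w[OF cov_noise_sq]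
        tendsto_rz[unfolded case_prod_unfold] tendsto_rz[unfolded case_prod_unfold] w])
      (intro integrable_mult_square_integrable cov_noise_measurable cov_noise_sq)
  then show ?thesis unfolding zt_eq vec_lambda_beta .
qed

lemma tendsto_score: "((\<lambda>p. score (fst p) (snd p) $ k) \<longlongrightarrow> 0) (in_prob M)"
proof -
  note w = weak_law_of_large_numbers[OF iid, unfolded case_prod_unfold]
  have "((\<lambda>p. avg (fst p) (\<lambda>i. (cov_noise g k (V i (snd p)) + rz k (fst p) (snd p) i) *
      (noise \<beta> m (V i (snd p)) + ry (fst p) (snd p) i)))
    \<longlongrightarrow> (\<integral>u. cov_noise g k u * noise \<beta> m u \<partial>P)) (in_prob M)"
    by (rule tendsto_avg_mult_perturbed[OF w[OF cov_noise_sq] w[OF noise_sq]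
        tendsto_rz[unfolded case_prod_unfold] tendsto_ry[unfolded case_prod_unfold] w])
      (intro integrable_mult_square_integrable cov_noise_measurable cov_noise_sq noise_measurable noise_sq)
  then show ?thesis unfolding zt_eq vec_lambda_beta noise_cov_noise .
qed

text \<open>The estimation error is the inverse Gram matrix applied to the score. The Gram matrix
  tends to the positive definite covariance of the residuals, and the score tends to their
  covariance with the noise, which is 0.\<close>

theorem estimator_consistent: "((\<lambda>p. estimator (fst p) (snd p)) \<longlongrightarrow> \<beta>) (in_prob M)"
proof -
  let ?B = "\<chi> k l. \<integral>u. cov_noise g k u * cov_noise g l u \<partial>P"
  have B: "det ?B \<noteq> 0" using pos_def by (rule pos_def_matrix_det_nonzero)
  have gram: "((\<lambda>p. gram (fst p) (snd p) $ k $ r) \<longlongrightarrow> ?B $ k $ r) (in_prob M)" for k r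
    using tendsto_gram[of k r] by simp
  have "((\<lambda>p. matrix_inv (gram (fst p) (snd p)) *v score (fst p) (snd p)) \<longlongrightarrow> 0) (in_prob M)"
    by (rule tendsto_matrix_inv_mult_0[OF gram tendsto_score B])
  then have lim: "((\<lambda>p. \<beta> + matrix_inv (gram (fst p) (snd p)) *v score (fst p) (snd p)) \<longlongrightarrow> \<beta>) (in_prob M)"
    using tendsto_add[OF tendsto_const[of \<beta>]] by fastforce
  have "((\<lambda>p. det (gram (fst p) (snd p))) \<longlongrightarrow> det ?B) (in_prob M)"
    by (rule tendsto_det[OF gram])
  \<comment> \<open>The formula for the estimation error requires a nonsingular Gram matrix, which
    is available with probability tending to 1.\<close>
  then have nz: "\<forall>\<^sub>F p in in_prob M. det (gram (fst p) (snd p)) \<noteq> 0" using B by (rule tendsto_imp_eventually_ne)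
  have "\<forall>\<^sub>F p in in_prob M. fst p \<ge> 1"
    using eventually_ge_at_top[of "1::nat"] by (intro eventually_in_probI[OF M.prob_space_axioms]) (auto elim: eventually_mono)
  with nz have "\<forall>\<^sub>F p in in_prob M. \<beta> + matrix_inv (gram (fst p) (snd p)) *v score (fst p) (snd p) = estimator (fst p) (snd p)"
  proof eventually_elim
    case (elim p)
    show ?case
      unfolding beta_tilde_def Let_def
      by (rule least_squares_error[OF elim(2,1) yt_eq, symmetric])
  qed
  with lim show ?thesis by (rule Lim_transform_eventually)
qed

text \<open>Measurability of \<open>d\<close> in each argument separately says nothing about its
  value at two random points, so the weights are first rewritten with the jointly measurable
  \<open>\<kappa>\<close>.\<close>

lemma wt_measurable:
  assumes "i \<in> {1..n}" "j \<in> {1..n}"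
  shows "(\<lambda>\<omega>. wt n \<omega> i j) \<in> borel_measurable M"
proof -
  have X: "(\<lambda>\<omega>. snd (snd (V l \<omega>))) \<in> borel_measurable M" if "l \<in> {1..n}" for l
    using measurable_compose[OF V_measurable fst_snd_measurable(3)] that by simp
  have "(\<lambda>\<omega>. \<kappa> n (snd (snd (V i \<omega>))) (snd (snd (V l \<omega>)))) \<in> borel_measurable M" if "l \<in> {1..n}" for l
    using measurable_compose[OF measurable_Pair[OF X[OF assms(1)] X[OF that]] \<kappa>_meas] by simp
  then have "(\<lambda>\<omega>. nw_weight (\<kappa> n) {1..n} (\<lambda>l. snd (snd (V l \<omega>))) i j) \<in> borel_measurable M"
    unfolding nw_weight_def using assms by (intro borel_measurable_divide borel_measurable_sum) auto
  then show ?thesis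
    by (rule measurable_cong[THEN iffD2, rotated]) (rule wt_eq_nw_weight[OF assms])
qed

lemma estimator_measurable: "estimator n \<in> borel_measurable M"
proof -
  have y: "(\<lambda>\<omega>. fst (V i \<omega>)) \<in> borel_measurable M" and zz: "(\<lambda>\<omega>. fst (snd (V i \<omega>))) \<in> borel_measurable M"
    if "i \<in> {1..n}" for i
    using measurable_compose[OF V_measurable fst_snd_measurable(1)]
      measurable_compose[OF V_measurable fst_snd_measurable(2)] that by auto
  have zk: "(\<lambda>\<omega>. fst (snd (V i \<omega>)) $ k) \<in> borel_measurable M" if "i \<in> {1..n}" for i k
    by (intro borel_measurable_vec_nth' zz that)
  have zt: "(\<lambda>\<omega>. zt n \<omega> i $ k) \<in> borel_measurable M" if "i \<in> {1..n}" for i k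
    unfolding smooth_resid_def vector_minus_component sum_component vector_scaleR_component real_scaleR_def
    by (intro borel_measurable_diff borel_measurable_sum borel_measurable_times wt_measurable zk that)
  have yt: "(\<lambda>\<omega>. yt n \<omega> i) \<in> borel_measurable M" if "i \<in> {1..n}" for i
    unfolding smooth_resid_def real_scaleR_def
    by (intro borel_measurable_diff borel_measurable_sum borel_measurable_times wt_measurable y that)
  show ?thesis
    unfolding beta_tilde_def Let_def
    by (rule borel_measurable_matrix_inv_mult; unfold vec_lambda_beta;
        intro borel_measurable_sum borel_measurable_times zt yt)
qed

end

subsection \<open>The residual process\<close>

text \<open>A strict inequality persists on a short interval to the right, which contains a
  rational. This turns the exceptional event into a countable union.\<close>

lemma right_continuous_ex_rational:
  fixes \<psi> :: "real \<Rightarrow> real"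
  assumes "\<And>x. (\<psi> \<longlongrightarrow> \<psi> x) (at_right x)"
  shows "(\<exists>x. \<bar>\<psi> x\<bar> > e) \<longleftrightarrow> (\<exists>x\<in>\<rat>. \<bar>\<psi> x\<bar> > e)"
proof
  assume "\<exists>x. \<bar>\<psi> x\<bar> > e"
  then obtain x where "\<bar>\<psi> x\<bar> > e" ..
  moreover have "((\<lambda>y. \<bar>\<psi> y\<bar>) \<longlongrightarrow> \<bar>\<psi> x\<bar>) (at_right x)" by (intro tendsto_rabs assms)
  ultimately have "\<forall>\<^sub>F y in at_right x. \<bar>\<psi> y\<bar> > e" by (rule order_tendstoD(1)[rotated])
  then obtain b where b: "b > x" "\<And>y. y > x \<Longrightarrow> y < b \<Longrightarrow> \<bar>\<psi> y\<bar> > e"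
    unfolding eventually_at_right_field by blast
  obtain r where "r \<in> \<rat>" "x < r" "r < b" using Rats_dense_in_real[OF b(1)] by blast
  with b show "\<exists>x\<in>\<rat>. \<bar>\<psi> x\<bar> > e" by blast
qed blast

lemma tendsto_indicator_atMost_at_right:
  fixes t x :: real
  shows "((\<lambda>y. indicat_real {..y} t) \<longlongrightarrow> indicat_real {..x} t) (at_right x)"
proof (rule tendsto_eventually)
  show "\<forall>\<^sub>F y in at_right x. indicat_real {..y} t = indicat_real {..x} t"
  proof (cases "t \<le> x")
    case True
    have "\<forall>\<^sub>F y in at_right x. x < y" by (simp add: eventually_at_right_less)
    then show ?thesis by eventually_elim (use True in \<open>simp add: indicator_def\<close>)
  next
    case False
    then have "\<forall>\<^sub>F y in at_right x. y < t" by (intro eventually_at_rightI[of x t]) auto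
    then show ?thesis by eventually_elim (use False in \<open>simp add: indicator_def\<close>)
  qed
qed

lemma tendsto_integral_indicator_atMost_at_right:
  fixes f T :: "'a \<Rightarrow> real"
  assumes f: "integrable P f" and T[measurable]: "T \<in> borel_measurable P"
  shows "((\<lambda>y. \<integral>u. indicat_real {..y} (T u) * f u \<partial>P) \<longlongrightarrow> (\<integral>u. indicat_real {..x} (T u) * f u \<partial>P)) (at_right x)"
proof (rule tendsto_at_right_sequentially[of x "x + 1"])
  have [measurable]: "f \<in> borel_measurable P" using f by auto
  fix S :: "nat \<Rightarrow> real" assume S: "\<And>n. x < S n" "S \<longlonglongrightarrow> x"
  have "filterlim S (at_right x) sequentially"
    unfolding filterlim_at using S(2) less_imp_neq[OF S(1), THEN not_sym] S(1) by simp
  then have lim: "(\<lambda>n. indicat_real {..S n} t) \<longlonglongrightarrow> indicat_real {..x} t" for t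
    by (rule filterlim_compose[OF tendsto_indicator_atMost_at_right])
  show "(\<lambda>n. \<integral>u. indicat_real {..S n} (T u) * f u \<partial>P) \<longlonglongrightarrow> (\<integral>u. indicat_real {..x} (T u) * f u \<partial>P)"
  proof (rule integral_dominated_convergence[where w="\<lambda>u. \<bar>f u\<bar>"])
    show "AE u in P. (\<lambda>n. indicat_real {..S n} (T u) * f u) \<longlonglongrightarrow> indicat_real {..x} (T u) * f u"
      by (intro AE_I2 tendsto_mult lim tendsto_const)
    show "AE u in P. norm (indicat_real {..S n} (T u) * f u) \<le> \<bar>f u\<bar>" for n
      by (intro AE_I2) (simp add: indicator_def)
  qed (use f in auto)
qed simp

text \<open>The limit along \<open>in_prob\<close> supplies only a small event containing the
  exceptional set. Right continuity in x makes that set itself measurable, so its probability is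
  bounded by monotonicity.\<close>

lemma unif_tendsto_in_probI:
  fixes F :: "nat \<Rightarrow> real \<Rightarrow> 'w \<Rightarrow> real"
  assumes "prob_space M"
    and lim: "uniform_limit UNIV (\<lambda>(n, \<omega>) x. F n x \<omega>) G (in_prob M)"
    and meas: "\<And>n x. F n x \<in> borel_measurable M"
    and rcF: "\<And>n \<omega> x. ((\<lambda>y. F n y \<omega>) \<longlongrightarrow> F n x \<omega>) (at_right x)"
    and rcG: "\<And>x. (G \<longlongrightarrow> G x) (at_right x)"
  shows "unif_tendsto_in_prob M F G"
  unfolding unif_tendsto_in_prob_def
proof (intro allI impI conjI)
  interpret prob_space M by fact
  fix e :: real assume e: "e > 0"
  define E where "E n = {\<omega> \<in> space M. \<exists>x. \<bar>F n x \<omega> - G x\<bar> > e}" for n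
  have E: "E n \<in> sets M" for n
  proof -
    have "E n = (\<Union>x\<in>\<rat>. {\<omega> \<in> space M. \<bar>F n x \<omega> - G x\<bar> > e})"
      unfolding E_def using right_continuous_ex_rational[of "\<lambda>x. F n x _ - G x" e, OF tendsto_diff[OF rcF rcG]] by auto
    also have "\<dots> \<in> sets M"
    proof (rule sets.countable_UN''[OF countable_rat])
      fix x
      have [measurable]: "F n x \<in> borel_measurable M" by (rule meas)
      show "{\<omega> \<in> space M. \<bar>F n x \<omega> - G x\<bar> > e} \<in> sets M" by measurable
    qed
    finally show ?thesis .
  qed
  then show "{\<omega> \<in> space M. \<exists>x. \<bar>F n x \<omega> - G x\<bar> > e} \<in> sets M" for n by (simp add: E_def)
  have "(\<lambda>n. prob (E n)) \<longlonglongrightarrow> 0"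
  proof (rule order_tendstoI)
    fix a :: real assume "a < 0"
    then show "\<forall>\<^sub>F n in sequentially. a < prob (E n)"
      by (intro always_eventually allI less_le_trans[OF _ measure_nonneg])
  next
    fix a :: real assume a: "0 < a"
    from uniform_limitD[OF lim e] a
    have "\<forall>\<^sub>F n in sequentially. \<exists>A\<in>sets M. prob A < a \<and>
      (\<forall>\<omega>\<in>space M - A. \<forall>x\<in>UNIV. dist ((case (n, \<omega>) of (n, \<omega>) \<Rightarrow> \<lambda>x. F n x \<omega>) x) (G x) < e)"
      unfolding eventually_in_prob[OF assms(1)] by blast
    then show "\<forall>\<^sub>F n in sequentially. prob (E n) < a"
    proof eventually_elim
      case (elim n)
      then obtain A where A: "A \<in> sets M" "prob A < a"
        "\<forall>\<omega>\<in>space M - A. \<forall>x\<in>UNIV. dist ((case (n, \<omega>) of (n, \<omega>) \<Rightarrow> \<lambda>x. F n x \<omega>) x) (G x) < e" by blast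
      have "E n \<subseteq> A"
      proof
        fix \<omega> assume "\<omega> \<in> E n"
        then obtain x where x: "\<omega> \<in> space M" "\<bar>F n x \<omega> - G x\<bar> > e" by (auto simp: E_def)
        show "\<omega> \<in> A"
        proof (rule ccontr)
          assume "\<omega> \<notin> A"
          then have "\<bar>F n x \<omega> - G x\<bar> < e" using A(3) x(1) by (auto simp: dist_real_def)
          then show False using x(2) by simp
        qed
      qed
      then show ?case using finite_measure_mono[of "E n" A] A by simp
    qed
  qed
  then show "(\<lambda>n. prob {\<omega> \<in> space M. \<exists>x. \<bar>F n x \<omega> - G x\<bar> > e}) \<longlonglongrightarrow> 0"
    by (simp add: E_def)
qed

text \<open>Either t \<le> s or t^3 > s^3, so t \<le> s + t^4/s^3 for every s > 0. Integrated, this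
  bounds the mean by s plus a multiple of the vanishing fourth moment.\<close>

lemma L4_rate_imp_L1:
  fixes f :: "nat \<Rightarrow> 'w \<Rightarrow> real"
  assumes "prob_space M" and nonneg: "\<And>n \<omega>. 0 \<le> f n \<omega>"
    and int: "\<forall>\<^sub>F n in sequentially. integrable M (\<lambda>\<omega>. f n \<omega> ^ 4)"
    and O: "(\<lambda>n. \<integral>\<omega>. f n \<omega> ^ 4 \<partial>M) \<in> O(\<lambda>n. 1 / (real n)\<^sup>2)"
  shows "\<forall>\<^sub>F n in sequentially. integrable M (f n)" and "(\<lambda>n. \<integral>\<omega>. f n \<omega> \<partial>M) \<longlonglongrightarrow> 0"
proof -
  interpret prob_space M by fact
  have bound: "t \<le> s + t ^ 4 / s ^ 3" if "t \<ge> 0" "s > 0" for s t :: real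
  proof (cases "t \<le> s")
    case True then show ?thesis using that by (simp add: add_increasing2)
  next
    case False
    then have "t * s ^ 3 \<le> t * t ^ 3" using that by (intro mult_left_mono power_mono) auto
    also have "t * t ^ 3 = t ^ 4" by (simp add: power_numeral_reduce)
    finally have "t \<le> t ^ 4 / s ^ 3" using that by (simp add: field_simps)
    then show ?thesis using that by simp
  qed
  have *: "integrable M (f n) \<and> (\<forall>s>0. (\<integral>\<omega>. f n \<omega> \<partial>M) \<le> s + (\<integral>\<omega>. f n \<omega> ^ 4 \<partial>M) / s ^ 3)"
    if i: "integrable M (\<lambda>\<omega>. f n \<omega> ^ 4)" for n
  proof -
    \<comment> \<open>Integrability of the fourth power yields measurability of \<open>f n\<close>,
      which two square roots recover because it is nonnegative.\<close>
    have "(\<lambda>\<omega>. sqrt (sqrt (f n \<omega> ^ 4))) \<in> borel_measurable M" using i by measurable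
    moreover have "sqrt (sqrt (f n \<omega> ^ 4)) = f n \<omega>" for \<omega>
    proof -
      have "f n \<omega> ^ 4 = ((f n \<omega>)\<^sup>2)\<^sup>2" by (simp add: power_mult[symmetric])
      then show ?thesis by (simp only: real_sqrt_abs abs_power2 abs_of_nonneg[OF nonneg])
    qed
    ultimately have m: "f n \<in> borel_measurable M" by simp
    have "integrable M (\<lambda>\<omega>. ((f n \<omega>)\<^sup>2)\<^sup>2)" using i by (simp only: power_mult[symmetric], simp)
    then have I: "integrable M (f n)"
      by (rule square_integrable_imp_integrable[OF m square_integrable_imp_integrable[OF borel_measurable_power[OF m]]])
    have "(\<integral>\<omega>. f n \<omega> \<partial>M) \<le> s + (\<integral>\<omega>. f n \<omega> ^ 4 \<partial>M) / s ^ 3" if s: "s > 0" for s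
    proof -
      have "(\<integral>\<omega>. f n \<omega> \<partial>M) \<le> (\<integral>\<omega>. s + f n \<omega> ^ 4 / s ^ 3 \<partial>M)"
        using I i bound[OF nonneg s] by (intro integral_mono) auto
      then show ?thesis using i by (simp add: prob_space)
    qed
    with I show ?thesis by blast
  qed
  show "\<forall>\<^sub>F n in sequentially. integrable M (f n)"
    using int by eventually_elim (use * in blast)
  have lim: "(\<lambda>n. 1 / (real n)\<^sup>2) \<longlonglongrightarrow> 0"
    by (intro tendsto_divide_0[OF tendsto_const] filterlim_at_top_imp_at_infinity
        filterlim_pow_at_top filterlim_real_sequentially) simp
  have "(\<lambda>n. 1 / (real n)\<^sup>2) \<in> o(\<lambda>_. 1)" by (rule smalloI_tendsto) (use lim in simp_all)
  from smalloD_tendsto[OF landau_o.big_small_trans[OF O this]]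
  have m4: "(\<lambda>n. \<integral>\<omega>. f n \<omega> ^ 4 \<partial>M) \<longlonglongrightarrow> 0" by simp
  show "(\<lambda>n. \<integral>\<omega>. f n \<omega> \<partial>M) \<longlonglongrightarrow> 0"
  proof (rule tendstoI)
    fix e :: real assume e: "e > 0"
    \<comment> \<open>Divided by the third power of \<open>s = e / 2\<close>, this threshold leaves
      \<open>e / 2\<close>, the other half of \<open>e\<close>.\<close>
    have "\<forall>\<^sub>F n in sequentially. (\<integral>\<omega>. f n \<omega> ^ 4 \<partial>M) < (e / 2) ^ 4" using m4 e by (intro order_tendstoD) auto
    with int show "\<forall>\<^sub>F n in sequentially. dist (\<integral>\<omega>. f n \<omega> \<partial>M) 0 < e"
    proof eventually_elim
      case (elim n)
      have "(\<integral>\<omega>. f n \<omega> \<partial>M) \<le> e / 2 + (\<integral>\<omega>. f n \<omega> ^ 4 \<partial>M) / (e / 2) ^ 3" using * elim(1) e by simp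
      also have "\<dots> < e / 2 + (e / 2) ^ 4 / (e / 2) ^ 3"
        using elim(2) e by (intro add_strict_left_mono divide_strict_right_mono) auto
      also have "\<dots> = e" using e by (simp add: power_numeral_reduce)
      finally show ?case using nonneg by (simp add: integral_nonneg_AE)
    qed
  qed
qed

lemma square_le_1_plus_powr:
  fixes x q :: real
  assumes "q \<ge> 2" shows "x\<^sup>2 \<le> 1 + \<bar>x\<bar> powr q"
proof (cases "\<bar>x\<bar> \<le> 1")
  case True
  then have "x\<^sup>2 \<le> 1" by (simp add: abs_square_le_1)
  then show ?thesis by (simp add: add_increasing2)
next
  case False
  then have "\<bar>x\<bar> powr 2 \<le> \<bar>x\<bar> powr q" using assms by (intro powr_mono) auto
  then show ?thesis using False by simp
qed

theorem theorem3p2: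
  fixes M :: "'w measure"
    and d :: "'h::{real_inner, banach, second_countable_topology} \<Rightarrow> 'h \<Rightarrow> real"
    and Y eps :: "'w \<Rightarrow> real" and Z :: "'w \<Rightarrow> real ^ 'p" and X :: "'w \<Rightarrow> 'h"
    and Ys epss :: "nat \<Rightarrow> 'w \<Rightarrow> real" and Zs :: "nat \<Rightarrow> 'w \<Rightarrow> real ^ 'p"
    and Xs :: "nat \<Rightarrow> 'w \<Rightarrow> 'h"
    and \<beta> :: "real ^ 'p" and m :: "'h \<Rightarrow> real" and g :: "'p \<Rightarrow> 'h \<Rightarrow> real"
    and \<eta> :: "nat \<Rightarrow> 'w \<Rightarrow> real ^ 'p"
    and lam :: "nat \<Rightarrow> real" and e :: "nat \<Rightarrow> 'h" and \<xi> :: "nat \<Rightarrow> 'w \<Rightarrow> real"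
    and lamh :: "nat \<Rightarrow> 'w \<Rightarrow> nat \<Rightarrow> real" and eh :: "nat \<Rightarrow> 'w \<Rightarrow> nat \<Rightarrow> 'h"
    and b c :: "nat \<Rightarrow> real" and k :: "nat \<Rightarrow> nat" and K :: "real \<Rightarrow> real"
    and betat :: "nat \<Rightarrow> 'w \<Rightarrow> real ^ 'p" and rhoh :: "nat \<Rightarrow> 'w \<Rightarrow> 'h"
    and \<rho> h :: 'h
    and \<C> :: "'h set" and \<sigma>\<^sub>\<epsilon> \<alpha> q :: real and \<phi> :: "real \<Rightarrow> real"
  \<comment> \<open>model\<close>
  assumes prob: "prob_space M"
    and semimetric: "semimetric d"
    and m_meas: "m \<in> borel_measurable borel"
    and model: "\<And>\<omega>. \<omega> \<in> space M \<Longrightarrow> Y \<omega> = Z \<omega> \<bullet> \<beta> + m (X \<omega>) + eps \<omega>"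
    and model_obs: "\<And>i \<omega>. i \<ge> 1 \<Longrightarrow> \<omega> \<in> space M \<Longrightarrow>
          Ys i \<omega> = Zs i \<omega> \<bullet> \<beta> + m (Xs i \<omega>) + epss i \<omega>"
    and iid: "iid_copies M (\<lambda>\<omega>. (Y \<omega>, Z \<omega>, X \<omega>)) (\<lambda>i \<omega>. (Ys i \<omega>, Zs i \<omega>, Xs i \<omega>))"
    and g_meas: "\<And>j. g j \<in> borel_measurable borel"
    and g: "\<And>j. AE \<omega> in M. cond_exp_given M X (\<lambda>\<omega>. Z \<omega> $ j) \<omega> = g j (X \<omega>)"
    and \<eta>: "\<And>i \<omega>. \<eta> i \<omega> = (\<chi> j. Zs i \<omega> $ j - g j (Xs i \<omega>))"
  \<comment> \<open>covariance operator\<close>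
    and lam_decr: "\<And>j. j \<ge> 1 \<Longrightarrow> lam (j + 1) < lam j" and lam_pos: "\<And>j. j \<ge> 1 \<Longrightarrow> lam j > 0"
    and e_orthonormal: "orthonormal_seq e"
    and e_eigen: "\<And>j. j \<ge> 1 \<Longrightarrow> cov_op M X (e j) = lam j *\<^sub>R e j"
    and \<xi>_meas: "\<And>j. j \<ge> 1 \<Longrightarrow> \<xi> j \<in> borel_measurable M"
    and X_expansion: "AE \<omega> in M.
          (\<lambda>j. (sqrt (lam (Suc j)) * \<xi> (Suc j) \<omega>) *\<^sub>R e (Suc j)) sums X \<omega>"
    and \<xi>_centered: "\<And>j. j \<ge> 1 \<Longrightarrow> integrable M (\<xi> j) \<and> (\<integral>\<omega>. \<xi> j \<omega> \<partial>M) = 0"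
    and \<xi>_uncorrelated: "\<And>i j. i \<ge> 1 \<Longrightarrow> j \<ge> 1 \<Longrightarrow> integrable M (\<lambda>\<omega>. \<xi> i \<omega> * \<xi> j \<omega>) \<and>
          (\<integral>\<omega>. \<xi> i \<omega> * \<xi> j \<omega> \<partial>M) = (if i = j then 1 else 0)"
    and \<rho>: "cov_op M X \<rho> = (\<integral>\<omega>. (Y \<omega> - Z \<omega> \<bullet> \<beta>) *\<^sub>R X \<omega> \<partial>M)"
  \<comment> \<open>estimators\<close>
    and b_pos: "\<And>n. n \<ge> 1 \<Longrightarrow> b n > 0" and b_lim: "b \<longlonglongrightarrow> 0"
    and K_nonneg: "\<And>u. u \<ge> 0 \<Longrightarrow> K u \<ge> 0"
    and betat: "\<And>n \<omega>. betat n \<omega> =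
          beta_tilde K d (b n) n (\<lambda>i. Ys i \<omega>) (\<lambda>i. Zs i \<omega>) (\<lambda>i. Xs i \<omega>)"
    and c_range: "\<And>n. n \<ge> 1 \<Longrightarrow> 0 < c n \<and> c n < lam 1" and c_lim: "c \<longlonglongrightarrow> 0"
    and k: "\<And>n. k n = cutoff lam (c n)"
    and emp_eigensystem: "\<And>n \<omega>. n \<ge> 1 \<Longrightarrow> \<omega> \<in> space M \<Longrightarrow>
          eigensystem (emp_cov_op n (\<lambda>i. Xs i \<omega>)) (lamh n \<omega>) (eh n \<omega>)"
    and lamh_meas: "\<And>n j. (\<lambda>\<omega>. lamh n \<omega> j) \<in> borel_measurable M"
    and eh_meas: "\<And>n j. (\<lambda>\<omega>. eh n \<omega> j) \<in> borel_measurable M"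
    and rhoh: "\<And>n \<omega>. rhoh n \<omega> = rho_hat (k n) (lamh n \<omega>) (eh n \<omega>) n
          (\<lambda>i. Ys i \<omega>) (\<lambda>i. Zs i \<omega>) (\<lambda>i. Xs i \<omega>) (betat n \<omega>)"
  \<comment> \<open>projected alternative\<close>
    and alternative: "\<And>\<rho>'. \<not> (AE \<omega> in M. cond_exp_given M (\<lambda>\<omega>. X \<omega> \<bullet> h)
          (\<lambda>\<omega>. Y \<omega> - X \<omega> \<bullet> \<rho>' - Z \<omega> \<bullet> \<beta>) \<omega> = 0)"
  \<comment> \<open>conditions\<close>
    and A1: "\<And>j::nat. j \<ge> 1 \<Longrightarrow> integrable M (\<lambda>\<omega>. norm (X \<omega>) ^ j)"
            "\<not> summable (\<lambda>j. (\<integral>\<omega>. norm (X \<omega>) ^ Suc j \<partial>M) powr (- 1 / real (Suc j)))"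
    and A2: "integrable M eps"
            "AE \<omega> in M. cond_exp_given M (\<lambda>\<omega>. (X \<omega>, Z \<omega>)) eps \<omega> = 0"
            "integrable M (\<lambda>\<omega>. (eps \<omega>)\<^sup>2)"
            "AE \<omega> in M. cond_exp_given M (\<lambda>\<omega>. (X \<omega>, Z \<omega>)) (\<lambda>\<omega>. (eps \<omega>)\<^sup>2) \<omega> = \<sigma>\<^sub>\<epsilon>\<^sup>2"
    and B1: "compact \<C>"
            "\<And>i \<omega>. i \<ge> 1 \<Longrightarrow> \<omega> \<in> space M \<Longrightarrow> Xs i \<omega> \<in> \<C>"
            "\<exists>(\<tau> :: nat \<Rightarrow> nat) (l :: nat \<Rightarrow> real) \<gamma> C. \<gamma> > 0 \<and> C > 0 \<and>
               (\<forall>n\<ge>1. l n > 0 \<and> real (\<tau> n) * l n powr \<gamma> = C \<and>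
                  (\<exists>x. \<C> \<subseteq> (\<Union>i\<in>{1..\<tau> n}. dball d (x i) (l n)))) \<and>
               filterlim \<tau> at_top sequentially \<and> l \<longlonglongrightarrow> 0"
    and B2: "\<alpha> > 0"
            "\<exists>C. \<forall>f \<in> insert m (range g). \<forall>u\<in>\<C>. \<forall>v\<in>\<C>. \<bar>f u - f v\<bar> \<le> C * d u v powr \<alpha>"
            "q \<ge> 3" "integrable M (\<lambda>\<omega>. \<bar>epss 1 \<omega>\<bar> powr q)"
            "\<And>j. integrable M (\<lambda>\<omega>. \<bar>\<eta> 1 \<omega> $ j\<bar> powr q)"
            "pos_def_matrix (\<chi> i j. \<integral>\<omega>. \<eta> 1 \<omega> $ i * \<eta> 1 \<omega> $ j \<partial>M)"
    and B3: "\<And>s. s > 0 \<Longrightarrow> \<phi> s > 0"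
            "\<exists>\<alpha>\<^sub>0 \<alpha>\<^sub>1 \<alpha>\<^sub>2. \<alpha>\<^sub>0 > 0 \<and> \<alpha>\<^sub>1 > 0 \<and> \<alpha>\<^sub>2 > 0 \<and>
               (\<forall>r>0. (\<lambda>s. \<phi> (r * s)) integrable_on {0..1} \<and>
                  integral {0..1} (\<lambda>s. \<phi> (r * s)) > \<alpha>\<^sub>0 * \<phi> r) \<and>
               (\<forall>x\<in>\<C>. \<forall>r>0.
                  \<alpha>\<^sub>1 * \<phi> r \<le> measure M {\<omega> \<in> space M. X \<omega> \<in> dball d x r} \<and>
                  measure M {\<omega> \<in> space M. X \<omega> \<in> dball d x r} \<le> \<alpha>\<^sub>2 * \<phi> r)"
    and B4: "closure {u. u \<ge> 0 \<and> K u \<noteq> 0} = {0..1}"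
            "\<exists>L. L-lipschitz_on {0..} K"
            \<comment> \<open>one-sided derivatives at the end points: a two-sided one at 1 would be 0\<close>
            "\<exists>\<theta>>0. \<forall>u\<in>{0..1}. \<exists>D. (K has_real_derivative D) (at u within {0..1}) \<and> - D > \<theta>"
            "(\<lambda>n. real n * b n powr (4 * \<alpha>)) \<longlonglongrightarrow> 0"
            "\<exists>a>0. 2 / q + a > 1 / 2 \<and>
               (\<forall>\<^sub>F n in sequentially. \<phi> (b n) \<ge> real n powr (2 / q + a - 1) / (ln (real n))\<^sup>2)"
    and C1: "\<And>W. W = Y \<or> (\<exists>j. W = (\<lambda>\<omega>. Z \<omega> $ j)) \<Longrightarrow> integrable M (\<lambda>\<omega>. W \<omega> *\<^sub>R X \<omega>) \<and>
               summable (\<lambda>j. ((\<integral>\<omega>. W \<omega> *\<^sub>R X \<omega> \<partial>M) \<bullet> e (Suc j))\<^sup>2 / (lam (Suc j))\<^sup>2)"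
    and C2: "{z. cov_op M X z = 0} = {0}"
    and C3: "integrable M (\<lambda>\<omega>. (norm (X \<omega>))\<^sup>2)" "integrable M (\<lambda>\<omega>. (norm (Z \<omega>))\<^sup>2)"
    and C4: "summable (\<lambda>l. \<bar>\<rho> \<bullet> e (Suc l)\<bar>)"
    and C5: "\<exists>f :: real \<Rightarrow> real. convex_on {0<..} f \<and> (\<forall>x>0. f x > 0) \<and>
               (\<forall>\<^sub>F j in sequentially. lam j = f (real j))"
    and C6: "(\<lambda>n. lam n * real n ^ 4 / ln (real n)) \<in> O(\<lambda>_. 1)"
    and C7: "(\<lambda>n. min \<bar>\<rho> \<bullet> e (k n)\<bar> (lam (k n) / sqrt (real (k n) * ln (real (k n)))))
               \<in> O(\<lambda>n. 1 / sqrt (real n))"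
    and C8: "\<exists>B\<ge>1. \<forall>j\<ge>1. integrable M (\<lambda>\<omega>. \<bar>\<xi> j \<omega>\<bar> ^ 5) \<and> (\<integral>\<omega>. \<bar>\<xi> j \<omega>\<bar> ^ 5 \<partial>M) \<le> B"
    and C9: "\<exists>C\<^sub>1>0. \<exists>C\<^sub>2>0. \<forall>n\<ge>1. C\<^sub>1 / sqrt (real n) < c n \<and> c n < C\<^sub>2 / sqrt (real n)"
    and i: "\<And>x. convergent (\<lambda>n. sqrt (\<Sum>j=1..k n. (partial_mean M X h x \<bullet> e j)\<^sup>2 / lam j))"
    and ii: "\<forall>\<^sub>F n in sequentially. integrable M (\<lambda>\<omega>. norm (rhoh n \<omega> - \<rho>) ^ 4)"
            "(\<lambda>n. \<integral>\<omega>. norm (rhoh n \<omega> - \<rho>) ^ 4 \<partial>M) \<in> O(\<lambda>n. 1 / (real n)\<^sup>2)"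
  shows "\<exists>\<rho>'. (\<forall>\<^sub>F n in sequentially. integrable M (\<lambda>\<omega>. norm (rhoh n \<omega> - \<rho>'))) \<and>
           (\<lambda>n. \<integral>\<omega>. norm (rhoh n \<omega> - \<rho>') \<partial>M) \<longlonglongrightarrow> 0 \<and>
           unif_tendsto_in_prob M
             (\<lambda>n x \<omega>. (1 / sqrt (real n)) *
                resid_process n (\<lambda>i. Ys i \<omega>) (\<lambda>i. Zs i \<omega>) (\<lambda>i. Xs i \<omega>) (betat n \<omega>) (rhoh n \<omega>) h x)
             (\<lambda>x. \<integral>\<omega>. (m (X \<omega>) - X \<omega> \<bullet> \<rho>') * indicat_real {\<omega>. X \<omega> \<bullet> h \<le> x} \<omega> \<partial>M)"
proof -
  interpret prob_space M by (rule prob)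
  let ?ball = "\<lambda>x r. measure M {\<omega> \<in> space M. X \<omega> \<in> dball d x r}"
  let ?B = "borel :: (real \<times> (real ^ 'p) \<times> 'h) measure"

  \<comment> \<open>Law of one observation and transfer of integrals\<close>
  define U where "U \<omega> = (Y \<omega>, Z \<omega>, X \<omega>)" for \<omega>
  define V where "V i \<omega> = (Ys i \<omega>, Zs i \<omega>, Xs i \<omega>)" for i \<omega>
  define P where "P = distr M borel U"
  have U_meas: "U \<in> borel_measurable M" and indep: "indep_vars (\<lambda>_. borel) V {1..}"
    and V_distr: "\<And>i. i \<ge> 1 \<Longrightarrow> distr M borel (V i) = P"
    using iid unfolding iid_copies_def U_def[abs_def] V_def[abs_def] P_def by auto
  have sets_P: "sets P = sets borel" by (simp add: P_def)
  have V_meas: "V i \<in> borel_measurable M" if "i \<ge> 1" for i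
    using indep that unfolding indep_vars_def by auto
  have fsts: "fst \<in> borel_measurable ?B"
    "(\<lambda>u. fst (snd u)) \<in> borel_measurable ?B"
    "(\<lambda>u. snd (snd u)) \<in> borel_measurable ?B"
    by (intro borel_measurable_continuous_onI continuous_intros)+
  have Y_meas: "Y \<in> borel_measurable M" and Z_meas: "Z \<in> borel_measurable M" and X_meas[measurable]: "X \<in> borel_measurable M"
    using measurable_compose[OF U_meas fsts(1)] measurable_compose[OF U_meas fsts(2)]
      measurable_compose[OF U_meas fsts(3)] by (simp_all add: U_def)
  have Ys_meas: "Ys i \<in> borel_measurable M" and Zs_meas: "Zs i \<in> borel_measurable M" and Xs_meas: "Xs i \<in> borel_measurable M"
    if "i \<ge> 1" for i
    using measurable_compose[OF V_meas[OF that] fsts(1)] measurable_compose[OF V_meas[OF that] fsts(2)]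
      measurable_compose[OF V_meas[OF that] fsts(3)] by (simp_all add: V_def)
  have bmP: "borel_measurable P = borel_measurable borel"
    by (rule measurable_cong_sets[OF sets_P refl])
  note fstsP = fsts[folded bmP]

  have iid': "iid_seq M P V"
    unfolding iid_seq_def
  proof (intro conjI allI impI)
    show "indep_vars (\<lambda>_. P) V {1..}"
      using indep unfolding indep_vars_def measurable_cong_sets[OF refl sets_P] sets_P .
    fix i :: nat assume i: "i \<ge> 1"
    show "V i \<in> measurable M P" unfolding measurable_cong_sets[OF refl sets_P] by (rule V_meas[OF i])
    have "distr M P (V i) = distr M borel (V i)" by (rule distr_cong) (simp_all add: sets_P)
    then show "distr M P (V i) = P" using V_distr[OF i] by simp
  qed (rule prob)
  have integral_P: "(\<integral>u. f u \<partial>P) = (\<integral>\<omega>. f (U \<omega>) \<partial>M)" if "f \<in> borel_measurable P" for f :: "_ \<Rightarrow> real"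
    unfolding P_def by (rule integral_distr[OF U_meas that[unfolded bmP]])
  have integrable_P: "integrable P f \<longleftrightarrow> integrable M (\<lambda>\<omega>. f (U \<omega>))" if "f \<in> borel_measurable P" for f :: "_ \<Rightarrow> real"
    unfolding P_def by (rule integrable_distr_eq[OF U_meas that[unfolded bmP]])
  have integrable_P1: "integrable P f \<longleftrightarrow> integrable M (\<lambda>\<omega>. f (V 1 \<omega>))"
    and integral_P1: "(\<integral>u. f u \<partial>P) = (\<integral>\<omega>. f (V 1 \<omega>) \<partial>M)" if "f \<in> borel_measurable P" for f :: "_ \<Rightarrow> real"
    using integrable_distr_eq[OF V_meas that[unfolded bmP], of 1] integral_distr[OF V_meas that[unfolded bmP], of 1]
    by (simp_all only: V_distr order_refl)

  \<comment> \<open>The compact set and its covers\<close>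
  have C_borel: "\<C> \<in> sets borel" by (intro borel_closed compact_imp_closed B1(1))
  obtain \<tau> :: "nat \<Rightarrow> nat" and l \<gamma> Cc where B1': "\<gamma> > 0 \<and> Cc > 0 \<and>
       (\<forall>n\<ge>1. l n > 0 \<and> real (\<tau> n) * l n powr \<gamma> = Cc \<and>
          (\<exists>x. \<C> \<subseteq> (\<Union>i\<in>{1..\<tau> n}. dball d (x i) (l n)))) \<and>
       filterlim \<tau> at_top sequentially \<and> l \<longlonglongrightarrow> 0"
    using B1(3) by (elim exE)
  from B1' have l_lim: "l \<longlonglongrightarrow> 0" by simp
  from B1' have cov: "\<And>n. n \<ge> 1 \<Longrightarrow> \<exists>x. \<C> \<subseteq> (\<Union>i\<in>{1..\<tau> n}. dball d (x i) (l n))" by simp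
  obtain z where z: "\<And>n. n \<ge> 1 \<Longrightarrow> \<C> \<subseteq> (\<Union>i\<in>{1..\<tau> n}. dball d (z n i) (l n))" using cov by metis
  have cover: "\<C> \<subseteq> (\<Union>i. dball d (z n i) (l n))" if "n \<ge> 1" for n
    using z[OF that] by blast
  \<comment> \<open>An observed covariate shows that \<C> is nonempty. It is the centre of the balls
    that compare values of \<phi>, and the base point for bounding \<open>m\<close> on \<C>.\<close>
  obtain \<omega>0 where \<omega>0: "\<omega>0 \<in> space M" using not_empty by blast
  define x0 where "x0 = Xs 1 \<omega>0"
  have x0: "x0 \<in> \<C>" unfolding x0_def using B1(2) \<omega>0 by simp
  have d_nonneg: "0 \<le> d x y" and d_sym: "d x y = d y x"
    and d_triangle: "d x w \<le> d x y + d y w" and d_meas: "d x \<in> borel_measurable borel" for x y w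
    using semimetric unfolding semimetric_def by blast+
  \<comment> \<open>Compactness refers to the norm and does not bound the semi-metric; the finite
    cover for n = 1 does. The sum over all its centres bounds the distance of each of them to
    \<open>x0\<close>.\<close>
  obtain Dm where Dm: "\<And>u. u \<in> \<C> \<Longrightarrow> d u x0 \<le> Dm"
  proof
    fix u assume "u \<in> \<C>"
    then obtain i where i: "i \<in> {1..\<tau> 1}" "d u (z 1 i) < l 1" using z[of 1] by (auto simp: dball_def)
    have "d u x0 \<le> d u (z 1 i) + d (z 1 i) x0" by (rule d_triangle)
    also have "\<dots> \<le> l 1 + (\<Sum>i\<in>{1..\<tau> 1}. d (z 1 i) x0)"
      using i d_nonneg by (intro add_mono member_le_sum) auto
    finally show "d u x0 \<le> l 1 + (\<Sum>i\<in>{1..\<tau> 1}. d (z 1 i) x0)" .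
  qed

  \<comment> \<open>Small balls, kernel bounds and the Hoelder constant\<close>
  obtain \<alpha>\<^sub>0 \<alpha>\<^sub>1 \<alpha>\<^sub>2 where B3': "\<alpha>\<^sub>0 > 0 \<and> \<alpha>\<^sub>1 > 0 \<and> \<alpha>\<^sub>2 > 0 \<and>
       (\<forall>r>0. (\<lambda>s. \<phi> (r * s)) integrable_on {0..1} \<and> integral {0..1} (\<lambda>s. \<phi> (r * s)) > \<alpha>\<^sub>0 * \<phi> r) \<and>
       (\<forall>x\<in>\<C>. \<forall>r>0. \<alpha>\<^sub>1 * \<phi> r \<le> ?ball x r \<and>
          ?ball x r \<le> \<alpha>\<^sub>2 * \<phi> r)"
    using B3(2) by (elim exE)
  from B3' have \<alpha>: "\<alpha>\<^sub>0 > 0" "\<alpha>\<^sub>1 > 0" "\<alpha>\<^sub>2 > 0" by simp_all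
  from B3' have \<phi>_int: "(\<lambda>s. \<phi> (r * s)) integrable_on {0..1} \<and> integral {0..1} (\<lambda>s. \<phi> (r * s)) > \<alpha>\<^sub>0 * \<phi> r"
    if "r > 0" for r using that by simp
  from B3' have ball: "\<alpha>\<^sub>1 * \<phi> r \<le> ?ball x r \<and>
      ?ball x r \<le> \<alpha>\<^sub>2 * \<phi> r" if "x \<in> \<C>" "r > 0" for x r
    using that by simp
  have ball_borel: "dball d x r \<in> sets borel" for x r
  proof -
    have "{x'. d x x' < r} \<in> sets borel" using borel_measurable_less[OF d_meas[of x] borel_measurable_const[of r]] by simp
    then show ?thesis by (simp add: dball_def d_sym[of _ x])
  qed
  \<comment> \<open>\<phi> itself need not be monotone, but up to the factors
    \<open>\<alpha>\<^sub>1\<close> and \<open>\<alpha>\<^sub>2\<close> it is the mass of a ball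
    around \<open>x0\<close>, which is.\<close>
  have almost_mono: "\<phi> s \<le> \<alpha>\<^sub>2 / \<alpha>\<^sub>1 * \<phi> r" if "0 < s" "s \<le> r" for s r
  proof -
    have "\<alpha>\<^sub>1 * \<phi> s \<le> ?ball x0 s" using ball[OF x0] that by blast
    also have "\<dots> \<le> ?ball x0 r"
      using that measurable_sets[OF X_meas ball_borel[of x0 r]]
      by (intro finite_measure_mono) (auto simp: dball_def vimage_def Int_def conj_commute)
    also have "\<dots> \<le> \<alpha>\<^sub>2 * \<phi> r" using ball[OF x0] that by simp
    finally show ?thesis using \<alpha> by (simp add: field_simps)
  qed
  have "\<exists>\<delta> c'. 0 < \<delta> \<and> \<delta> < 1 \<and> c' > 0 \<and> (\<forall>r>0. c' * \<phi> r \<le> \<phi> (\<delta> * r))"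
    by (rule small_ball_ratio[of \<phi> \<alpha>\<^sub>0 "\<alpha>\<^sub>2 / \<alpha>\<^sub>1"]) (fact B3(1) \<alpha>(1) almost_mono \<phi>_int)+
  then obtain \<delta> c' where \<delta>': "0 < \<delta> \<and> \<delta> < 1 \<and> c' > 0 \<and> (\<forall>r>0. c' * \<phi> r \<le> \<phi> (\<delta> * r))"
    by (elim exE)
  then have \<delta>: "0 < \<delta>" "\<delta> < 1" "c' > 0" "\<And>r. r > 0 \<Longrightarrow> c' * \<phi> r \<le> \<phi> (\<delta> * r)" by simp_all
  obtain a where a: "2 / q + a > 1 / 2"
    "\<forall>\<^sub>F n in sequentially. \<phi> (b n) \<ge> real n powr (2 / q + a - 1) / (ln (real n))\<^sup>2"
    using B4(5) by (elim exE conjE)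
  have rate: "filterlim (\<lambda>n. real n * \<phi> (b n)) at_top sequentially"
    by (rule polynomial_rate_at_top[OF a])
  obtain L where L: "L-lipschitz_on {0..} K" using B4(2) by (elim exE)
  obtain \<theta> where \<theta>: "\<theta> > 0" "\<forall>u\<in>{0..1}. \<exists>D. (K has_real_derivative D) (at u within {0..1}) \<and> - D > \<theta>"
    using B4(3) by (elim exE conjE)
  have "\<forall>u\<ge>0. K u \<ge> 0" using K_nonneg by simp
  note K_bounds = kernel_bounds[OF this B4(1) L \<theta>(2)]
  obtain D where D: "D \<ge> 0"
    "\<And>f u v. f \<in> insert m (range g) \<Longrightarrow> u \<in> \<C> \<Longrightarrow> v \<in> \<C> \<Longrightarrow> \<bar>f u - f v\<bar> \<le> D * d u v powr \<alpha>"
  proof -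
    obtain D0 where D0': "\<forall>f \<in> insert m (range g). \<forall>u\<in>\<C>. \<forall>v\<in>\<C>. \<bar>f u - f v\<bar> \<le> D0 * d u v powr \<alpha>"
      using B2(2) by (elim exE)
    have D0: "\<bar>f u - f v\<bar> \<le> D0 * d u v powr \<alpha>" if "f \<in> insert m (range g)" "u \<in> \<C>" "v \<in> \<C>" for f u v
      using bspec[OF bspec[OF bspec[OF D0' that(1)] that(2)] that(3)] .
    have "\<bar>f u - f v\<bar> \<le> \<bar>D0\<bar> * d u v powr \<alpha>" if "f \<in> insert m (range g)" "u \<in> \<C>" "v \<in> \<C>" for f u v
      by (rule order_trans[OF D0[OF that]]) (intro mult_right_mono, auto)
    then show ?thesis by (intro that[of "\<bar>D0\<bar>"] abs_ge_zero)
  qed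

  \<comment> \<open>Moments and orthogonality of the noise variables\<close>
  let ?f\<epsilon> = "noise \<beta> m :: real \<times> (real ^ 'p) \<times> 'h \<Rightarrow> real"
  have noise_meas: "?f\<epsilon> \<in> borel_measurable P"
    unfolding noise_def[abs_def]
    by (intro borel_measurable_diff borel_measurable_inner borel_measurable_const fstsP measurable_compose[OF fstsP(3) m_meas])
  have cov_meas: "cov_noise g k \<in> borel_measurable P" for k
    unfolding cov_noise_def[abs_def]
    by (intro borel_measurable_diff borel_measurable_vec_nth' fstsP measurable_compose[OF fstsP(3) g_meas])
  have noise_U: "?f\<epsilon> (U \<omega>) = eps \<omega>" if "\<omega> \<in> space M" for \<omega>
    using model[OF that] by (simp add: noise_def U_def)
  have cov_U: "cov_noise g k (U \<omega>) = Z \<omega> $ k - g k (X \<omega>)" for k \<omega>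
    by (simp add: cov_noise_def U_def)
  have cov_V: "cov_noise g k (V 1 \<omega>) = \<eta> 1 \<omega> $ k" for k \<omega>
    by (simp add: cov_noise_def V_def \<eta>)
  have noise_sq: "integrable P (\<lambda>u. (?f\<epsilon> u)\<^sup>2)"
    using A2(3) noise_U noise_meas
    by (subst integrable_P) (auto cong: Bochner_Integration.integrable_cong)
  \<comment> \<open>The moment condition speaks of the first observation, so the integral is pulled
    back along \<open>V 1\<close> instead of \<open>U\<close>.\<close>
  have cov_sq: "integrable P (\<lambda>u. (cov_noise g k u)\<^sup>2)" for k
  proof (subst integrable_P1)
    show "(\<lambda>u. (cov_noise g k u)\<^sup>2) \<in> borel_measurable P" using cov_meas by measurable
    show "integrable M (\<lambda>\<omega>. (cov_noise g k (V 1 \<omega>))\<^sup>2)"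
    proof (rule Bochner_Integration.integrable_bound)
      show "integrable M (\<lambda>\<omega>. 1 + \<bar>\<eta> 1 \<omega> $ k\<bar> powr q)" using B2(5)[of k] by simp
      show "(\<lambda>\<omega>. (cov_noise g k (V 1 \<omega>))\<^sup>2) \<in> borel_measurable M"
        using measurable_compose[OF V_meas[of 1] cov_meas[unfolded bmP]] by simp
      show "AE \<omega> in M. norm ((cov_noise g k (V 1 \<omega>))\<^sup>2) \<le> norm (1 + \<bar>\<eta> 1 \<omega> $ k\<bar> powr q)"
        unfolding cov_V using square_le_1_plus_powr[of q] B2(3) by (intro AE_I2) simp
    qed
  qed
  \<comment> \<open>Stated for integrable products instead of bounded \<psi>, because it is also
    applied to \<open>Z $ k - g k X\<close>, which is merely square integrable.\<close>
  have eps_orth: "(\<integral>\<omega>. \<psi> (X \<omega>, Z \<omega>) * eps \<omega> \<partial>M) = 0"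
    if \<psi>: "\<psi> \<in> borel_measurable borel" and int: "integrable M (\<lambda>\<omega>. \<psi> (X \<omega>, Z \<omega>) * eps \<omega>)" for \<psi>
  proof -
    have W: "(\<lambda>\<omega>. (X \<omega>, Z \<omega>)) \<in> borel_measurable M"
      unfolding borel_prod[symmetric] using X_meas Z_meas by (intro measurable_Pair)
    have "(\<integral>\<omega>. \<psi> (X \<omega>, Z \<omega>) * eps \<omega> \<partial>M)
      = (\<integral>\<omega>. \<psi> (X \<omega>, Z \<omega>) * cond_exp_given M (\<lambda>\<omega>. (X \<omega>, Z \<omega>)) eps \<omega> \<partial>M)"
      using integral_mult_cond_exp_given[OF prob W \<psi> _ int] A2(1) by auto
    also have "\<dots> = (\<integral>\<omega>. 0 \<partial>M)"
    proof (rule integral_cong_AE)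
      have "integrable M (\<lambda>\<omega>. \<psi> (X \<omega>, Z \<omega>) * cond_exp_given M (\<lambda>\<omega>. (X \<omega>, Z \<omega>)) eps \<omega>)"
        using A2(1) by (intro integrable_mult_cond_exp_given[OF prob W \<psi> _ int]) auto
      then show "(\<lambda>\<omega>. \<psi> (X \<omega>, Z \<omega>) * cond_exp_given M (\<lambda>\<omega>. (X \<omega>, Z \<omega>)) eps \<omega>) \<in> borel_measurable M" by auto
      show "AE \<omega> in M. \<psi> (X \<omega>, Z \<omega>) * cond_exp_given M (\<lambda>\<omega>. (X \<omega>, Z \<omega>)) eps \<omega> = 0"
        using A2(2) by eventually_elim simp
    qed simp
    finally show ?thesis by simp
  qed
  have fst_borel: "(fst :: 'h \<times> (real ^ 'p) \<Rightarrow> 'h) \<in> borel_measurable borel"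
    and snd_borel: "(snd :: 'h \<times> (real ^ 'p) \<Rightarrow> real ^ 'p) \<in> borel_measurable borel"
    by (intro borel_measurable_continuous_onI continuous_intros)+
  have eps_orth_X: "(\<integral>\<omega>. \<psi> (X \<omega>) * eps \<omega> \<partial>M) = 0"
    if \<psi>: "\<psi> \<in> borel_measurable borel" and bd: "\<And>y. \<bar>\<psi> y\<bar> \<le> 1" for \<psi>
  proof -
    have "integrable M (\<lambda>\<omega>. \<psi> (X \<omega>) * eps \<omega>)"
      by (rule integrable_bounded_mult[OF A2(1) measurable_compose[OF X_meas \<psi>] bd])
    then show ?thesis using eps_orth[of "\<lambda>w. \<psi> (fst w)"] measurable_compose[OF fst_borel \<psi>] by simp
  qed
  have noise_centered: "centered_given P (\<lambda>u. snd (snd u)) ?f\<epsilon>"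
    unfolding centered_given_def
  proof (intro ballI impI)
    fix \<psi> :: "'h \<Rightarrow> real" assume \<psi>: "\<psi> \<in> borel_measurable borel" and bd: "\<forall>y. \<bar>\<psi> y\<bar> \<le> 1"
    have "(\<integral>u. \<psi> (snd (snd u)) * ?f\<epsilon> u \<partial>P) = (\<integral>\<omega>. \<psi> (snd (snd (U \<omega>))) * ?f\<epsilon> (U \<omega>) \<partial>M)"
      by (intro integral_P borel_measurable_times noise_meas measurable_compose[OF fstsP(3) \<psi>])
    also have "\<dots> = (\<integral>\<omega>. \<psi> (X \<omega>) * eps \<omega> \<partial>M)"
      using noise_U by (intro Bochner_Integration.integral_cong) (auto simp: U_def)
    finally show "(\<integral>u. \<psi> (snd (snd u)) * ?f\<epsilon> u \<partial>P) = 0" using eps_orth_X[OF \<psi>] bd by simp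
  qed
  have Zk_meas: "(\<lambda>\<omega>. Z \<omega> $ k) \<in> borel_measurable M" for k
    using Z_meas by (rule borel_measurable_vec_nth')
  have Z_int: "integrable M (\<lambda>\<omega>. norm (Z \<omega>))"
    using Z_meas by (intro square_integrable_imp_integrable[OF _ C3(2)]) measurable
  have Zk_int: "integrable M (\<lambda>\<omega>. Z \<omega> $ k)" for k
    by (rule Bochner_Integration.integrable_bound[OF Z_int Zk_meas]) (simp add: component_le_norm_cart)
  have cov_centered: "centered_given P (\<lambda>u. snd (snd u)) (cov_noise g k)" for k
    unfolding centered_given_def
  proof (intro ballI impI)
    fix \<psi> :: "'h \<Rightarrow> real" assume \<psi>: "\<psi> \<in> borel_measurable borel" and bd: "\<forall>y. \<bar>\<psi> y\<bar> \<le> 1"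
    have \<psi>X: "(\<lambda>\<omega>. \<psi> (X \<omega>)) \<in> borel_measurable M" using X_meas \<psi> by (rule measurable_compose)
    have int: "integrable M (\<lambda>\<omega>. \<psi> (X \<omega>) * Z \<omega> $ k)"
      using bd by (intro integrable_bounded_mult[OF Zk_int \<psi>X]) simp
    note ce = integral_mult_cond_exp_given[OF prob X_meas \<psi> Zk_meas int]
      integrable_mult_cond_exp_given[OF prob X_meas \<psi> Zk_meas int]
    have gX: "(\<lambda>\<omega>. \<psi> (X \<omega>) * g k (X \<omega>)) \<in> borel_measurable M"
      by (intro borel_measurable_times \<psi>X measurable_compose[OF X_meas g_meas])
    have ae: "AE \<omega> in M. \<psi> (X \<omega>) * cond_exp_given M X (\<lambda>\<omega>. Z \<omega> $ k) \<omega> = \<psi> (X \<omega>) * g k (X \<omega>)"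
      using g[of k] by eventually_elim simp
    have gi: "integrable M (\<lambda>\<omega>. \<psi> (X \<omega>) * g k (X \<omega>))"
      using integrable_cong_AE_imp[OF ce(2) gX] ae by (auto elim: eventually_mono)
    have "(\<integral>\<omega>. \<psi> (X \<omega>) * g k (X \<omega>) \<partial>M) = (\<integral>\<omega>. \<psi> (X \<omega>) * Z \<omega> $ k \<partial>M)"
      using integral_cong_AE[OF _ gX ae] ce by auto
    then have "(\<integral>\<omega>. \<psi> (X \<omega>) * (Z \<omega> $ k - g k (X \<omega>)) \<partial>M) = 0"
      using int gi by (simp add: right_diff_distrib)
    moreover have "(\<integral>u. \<psi> (snd (snd u)) * cov_noise g k u \<partial>P)
      = (\<integral>\<omega>. \<psi> (snd (snd (U \<omega>))) * cov_noise g k (U \<omega>) \<partial>M)"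
      by (intro integral_P borel_measurable_times cov_meas measurable_compose[OF fstsP(3) \<psi>])
    ultimately show "(\<integral>u. \<psi> (snd (snd u)) * cov_noise g k u \<partial>P) = 0" by (simp add: cov_U) (simp add: U_def)
  qed
  \<comment> \<open>The covariate residual is a function of X and Z together, so centering of the
    error given both is what makes this covariance vanish.\<close>
  have noise_cov: "(\<integral>u. cov_noise g k u * ?f\<epsilon> u \<partial>P) = 0" for k
  proof -
    have \<psi>: "(\<lambda>w. snd w $ k - g k (fst w)) \<in> borel_measurable (borel :: ('h \<times> (real ^ 'p)) measure)"
      by (intro borel_measurable_diff borel_measurable_vec_nth' snd_borel measurable_compose[OF fst_borel g_meas])
    have "integrable P (\<lambda>u. cov_noise g k u * ?f\<epsilon> u)"
      by (intro integrable_mult_square_integrable cov_meas noise_meas cov_sq noise_sq)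
    then have "integrable M (\<lambda>\<omega>. cov_noise g k (U \<omega>) * ?f\<epsilon> (U \<omega>))"
      using cov_meas noise_meas by (subst (asm) integrable_P) auto
    then have int: "integrable M (\<lambda>\<omega>. (Z \<omega> $ k - g k (X \<omega>)) * eps \<omega>)"
      using noise_U by (simp add: cov_U cong: Bochner_Integration.integrable_cong)
    have "(\<integral>u. cov_noise g k u * ?f\<epsilon> u \<partial>P) = (\<integral>\<omega>. cov_noise g k (U \<omega>) * ?f\<epsilon> (U \<omega>) \<partial>M)"
      by (intro integral_P borel_measurable_times cov_meas noise_meas)
    also have "\<dots> = (\<integral>\<omega>. (Z \<omega> $ k - g k (X \<omega>)) * eps \<omega> \<partial>M)"
      using noise_U by (intro Bochner_Integration.integral_cong) (auto simp: cov_U)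
    also have "\<dots> = 0" using eps_orth[OF \<psi>] int by simp
    finally show ?thesis .
  qed

  \<comment> \<open>Consistency of the estimators of \<beta> and \<rho>\<close>
  interpret R: partially_linear_regression M P V d \<C> z l K L \<theta> b \<phi> \<alpha>\<^sub>1 \<alpha>\<^sub>2 \<delta> c' \<beta> m g D \<alpha>
  proof (rule partially_linear_regression.intro[OF kernel_regression.intro partially_linear_regression_axioms.intro])
    show "(\<lambda>u. snd (snd u)) \<in> borel_measurable P" by (rule fstsP)
    show "continuous_on {0..} K" by (rule lipschitz_on_continuous_on[OF L])
    have V_C: "snd (snd (V i \<omega>)) \<in> \<C>" if "i \<ge> 1" "\<omega> \<in> space M" for i \<omega>
      using B1(2)[OF that] by (simp add: V_def)
    then show "snd (snd (V i \<omega>)) \<in> \<C>" if "i \<ge> 1" "\<omega> \<in> space M" for i \<omega> using that .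
    have ballP: "measure P {u \<in> space P. snd (snd u) \<in> dball d x r} = ?ball x r" for x r
    proof -
      have A: "{u. snd (snd u) \<in> dball d x r} \<in> sets ?B"
        using measurable_sets[OF fsts(3) ball_borel[of x r]] by (simp add: vimage_def)
      have "measure P {u \<in> space P. snd (snd u) \<in> dball d x r} = measure (distr M borel U) {u. snd (snd u) \<in> dball d x r}"
        by (simp add: P_def)
      also have "\<dots> = measure M (U -` {u. snd (snd u) \<in> dball d x r} \<inter> space M)"
        using A by (intro measure_distr U_meas)
      also have "U -` {u. snd (snd u) \<in> dball d x r} \<inter> space M = {\<omega> \<in> space M. X \<omega> \<in> dball d x r}"
        by (auto simp: U_def)
      finally show ?thesis .
    qed
    show "\<alpha>\<^sub>1 * \<phi> r \<le> measure P {u \<in> space P. snd (snd u) \<in> dball d x r}"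
      "measure P {u \<in> space P. snd (snd u) \<in> dball d x r} \<le> \<alpha>\<^sub>2 * \<phi> r" if "x \<in> \<C>" "r > 0" for x r
      unfolding ballP using ball[OF that] by auto
    show "pos_def_matrix (\<chi> k j. \<integral>u. cov_noise g k u * cov_noise g j u \<partial>P)"
    proof -
      have "(\<integral>u. cov_noise g k u * cov_noise g j u \<partial>P) = (\<integral>\<omega>. \<eta> 1 \<omega> $ k * \<eta> 1 \<omega> $ j \<partial>M)" for k j
        unfolding cov_V[symmetric] by (intro integral_P1 borel_measurable_times cov_meas)
      then show ?thesis using B2(6) by simp
    qed
    show "\<bar>m u - m v\<bar> \<le> D * d u v powr \<alpha>" "\<bar>g k u - g k v\<bar> \<le> D * d u v powr \<alpha>" if "u \<in> \<C>" "v \<in> \<C>" for k u v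
      using D(2) that by auto
  qed (fact iid' semimetric C_borel l_lim cover K_nonneg K_bounds \<theta>(1) b_pos b_lim B3(1) \<alpha> \<delta> rate
      sets_P m_meas g_meas B2(1) D(1) noise_sq cov_sq noise_centered cov_centered noise_cov)+

  have betat_eq: "betat n \<omega> = R.estimator n \<omega>" for n \<omega> by (simp add: betat V_def)
  have betat_lim: "((\<lambda>p. betat (fst p) (snd p)) \<longlongrightarrow> \<beta>) (in_prob M)"
    using R.estimator_consistent by (simp add: betat_eq)
  have betat_meas: "betat n \<in> borel_measurable M" for n
    using R.estimator_measurable[of n] by (simp add: betat_eq[abs_def])
  have rhoh_meas: "rhoh n \<in> borel_measurable M" for n
  proof -
    define S where "S \<omega> = (1 / real n) *\<^sub>R (\<Sum>i=1..n. (Ys i \<omega> - Zs i \<omega> \<bullet> betat n \<omega>) *\<^sub>R Xs i \<omega>)" for \<omega>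
    have S: "S \<in> borel_measurable M"
      unfolding S_def[abs_def]
      by (intro borel_measurable_scaleR borel_measurable_const borel_measurable_sum borel_measurable_diff
          borel_measurable_inner Ys_meas Zs_meas Xs_meas betat_meas) auto
    have "rhoh n = (\<lambda>\<omega>. \<Sum>j=1..k n. inverse (lamh n \<omega> j) *\<^sub>R (S \<omega> \<bullet> eh n \<omega> j) *\<^sub>R eh n \<omega> j)"
      by (simp add: rhoh[abs_def] rho_hat_def trunc_pinv_def tensor_def S_def)
    then show ?thesis
      by (simp only:) (intro borel_measurable_sum borel_measurable_scaleR borel_measurable_inverse borel_measurable_inner lamh_meas eh_meas S)
  qed
  have rho_int: "\<forall>\<^sub>F n in sequentially. integrable M (\<lambda>\<omega>. norm (rhoh n \<omega> - \<rho>))"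
    and rho_mean: "(\<lambda>n. \<integral>\<omega>. norm (rhoh n \<omega> - \<rho>) \<partial>M) \<longlonglongrightarrow> 0"
    using L4_rate_imp_L1[OF prob _ ii] by auto
  have rho_lim: "((\<lambda>(n, \<omega>). norm (rhoh n \<omega> - \<rho>)) \<longlongrightarrow> 0) (in_prob M)"
    using rho_int by (intro tendsto_0_in_prob_L1[OF prob _ rho_mean]) (auto elim: eventually_mono)

  \<comment> \<open>The limit function\<close>
  obtain R where R: "\<And>x. x \<in> \<C> \<Longrightarrow> norm x \<le> R" using compact_imp_bounded[OF B1(1)] by (auto simp: bounded_iff)
  have AE_XC: "AE \<omega> in M. X \<omega> \<in> \<C>"
  proof -
    have "AE u in distr M borel U. snd (snd u) \<in> \<C>" using R.AE_in_C unfolding P_def .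
    moreover have "{u \<in> space borel. snd (snd u) \<in> \<C>} \<in> sets ?B"
      using measurable_sets[OF fsts(3) C_borel] by (simp add: vimage_def)
    ultimately show ?thesis using AE_distr_iff[OF U_meas] by (simp add: U_def)
  qed
  \<comment> \<open>The integrand is almost surely bounded: \<open>m\<close> by its Hoelder
    condition relative to \<open>x0\<close>, the inner product by the norm bound on \<C>.\<close>
  have mX: "integrable M (\<lambda>\<omega>. m (X \<omega>) - X \<omega> \<bullet> \<rho>)"
  proof (rule integrable_const_bound)
    show "(\<lambda>\<omega>. m (X \<omega>) - X \<omega> \<bullet> \<rho>) \<in> borel_measurable M"
      by (intro borel_measurable_diff borel_measurable_inner X_meas borel_measurable_const measurable_compose[OF X_meas m_meas])
    show "AE \<omega> in M. norm (m (X \<omega>) - X \<omega> \<bullet> \<rho>) \<le> (\<bar>m x0\<bar> + D * Dm powr \<alpha>) + R * norm \<rho>"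
      using AE_XC
    proof eventually_elim
      case (elim \<omega>)
      have "\<bar>m (X \<omega>) - m x0\<bar> \<le> D * d (X \<omega>) x0 powr \<alpha>" using D(2) elim x0 by blast
      also have "\<dots> \<le> D * Dm powr \<alpha>" using D(1) Dm[OF elim] d_nonneg B2(1) by (intro mult_left_mono powr_mono2) auto
      finally have "\<bar>m (X \<omega>)\<bar> \<le> \<bar>m x0\<bar> + D * Dm powr \<alpha>" by linarith
      moreover have "\<bar>X \<omega> \<bullet> \<rho>\<bar> \<le> norm (X \<omega>) * norm \<rho>" by (rule Cauchy_Schwarz_ineq2)
      moreover have "norm (X \<omega>) * norm \<rho> \<le> R * norm \<rho>" using R[OF elim] by (intro mult_right_mono) auto
      ultimately show ?case by simp
    qed
  qed
  define T where "T u = snd (snd u) \<bullet> h" for u :: "real \<times> (real ^ 'p) \<times> 'h"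
  define f where "f u = fst u - fst (snd u) \<bullet> \<beta> - snd (snd u) \<bullet> \<rho>" for u :: "real \<times> (real ^ 'p) \<times> 'h"
  have T_meas: "T \<in> borel_measurable P"
    unfolding T_def[abs_def] by (intro borel_measurable_inner fstsP borel_measurable_const)
  have f_meas: "f \<in> borel_measurable P"
    unfolding f_def[abs_def] by (intro borel_measurable_diff borel_measurable_inner fstsP borel_measurable_const)
  have f_U: "f (U \<omega>) = eps \<omega> + (m (X \<omega>) - X \<omega> \<bullet> \<rho>)" if "\<omega> \<in> space M" for \<omega>
    using model[OF that] by (simp add: f_def U_def)
  have f_int: "integrable P f"
    using Bochner_Integration.integrable_add[OF A2(1) mX] f_U
    by (subst integrable_P[OF f_meas]) (simp cong: Bochner_Integration.integrable_cong)
  define G where "G x = (\<integral>\<omega>. (m (X \<omega>) - X \<omega> \<bullet> \<rho>) * indicat_real {\<omega>. X \<omega> \<bullet> h \<le> x} \<omega> \<partial>M)" for x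
  \<comment> \<open>The half-space indicator is a bounded function of X, hence orthogonal to the
    error, and only m(X) minus the linear part survives.\<close>
  have G_eq: "(\<integral>u. indicat_real {..x} (T u) * f u \<partial>P) = G x" for x
  proof -
    have ind: "(\<lambda>y. indicat_real {..x} (y \<bullet> h)) \<in> borel_measurable (borel :: 'h measure)"
      by measurable
    have indX: "(\<lambda>\<omega>. indicat_real {..x} (X \<omega> \<bullet> h)) \<in> borel_measurable M" by measurable
    have i1: "integrable M (\<lambda>\<omega>. indicat_real {..x} (X \<omega> \<bullet> h) * eps \<omega>)"
      by (rule integrable_bounded_mult[OF A2(1) indX]) (simp add: indicator_def)
    have i2: "integrable M (\<lambda>\<omega>. indicat_real {..x} (X \<omega> \<bullet> h) * (m (X \<omega>) - X \<omega> \<bullet> \<rho>))"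
      by (rule integrable_bounded_mult[OF mX indX]) (simp add: indicator_def)
    have "(\<integral>u. indicat_real {..x} (T u) * f u \<partial>P) = (\<integral>\<omega>. indicat_real {..x} (T (U \<omega>)) * f (U \<omega>) \<partial>M)"
      by (intro integral_P borel_measurable_times f_meas measurable_compose[OF T_meas] borel_measurable_indicator) simp
    also have "\<dots> = (\<integral>\<omega>. indicat_real {..x} (X \<omega> \<bullet> h) * eps \<omega> + indicat_real {..x} (X \<omega> \<bullet> h) * (m (X \<omega>) - X \<omega> \<bullet> \<rho>) \<partial>M)"
      by (intro Bochner_Integration.integral_cong refl) (simp only: f_U distrib_left, simp add: T_def U_def)
    also have "\<dots> = (\<integral>\<omega>. indicat_real {..x} (X \<omega> \<bullet> h) * (m (X \<omega>) - X \<omega> \<bullet> \<rho>) \<partial>M)"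
      using i1 i2 eps_orth_X[OF ind] by (simp add: indicator_def)
    also have "\<dots> = G x"
      unfolding G_def by (intro Bochner_Integration.integral_cong) (auto simp: indicator_def)
    finally show ?thesis .
  qed

  \<comment> \<open>The residual process as an average\<close>
  define F where "F n x \<omega> = (1 / sqrt (real n)) *
     resid_process n (\<lambda>i. Ys i \<omega>) (\<lambda>i. Zs i \<omega>) (\<lambda>i. Xs i \<omega>) (betat n \<omega>) (rhoh n \<omega>) h x" for n x \<omega>
  \<comment> \<open>The two factors 1/sqrt n combine to 1/n; for n = 0 both sides are 0.\<close>
  have F_eq: "F n x \<omega> = (1 / real n) * (\<Sum>i=1..n. indicat_real {..x} (Xs i \<omega> \<bullet> h) *
     (Ys i \<omega> - Zs i \<omega> \<bullet> betat n \<omega> - Xs i \<omega> \<bullet> rhoh n \<omega>))" for n x \<omega>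
  proof -
    have "(1 / sqrt (real n)) * ((1 / sqrt (real n)) * S) = (1 / real n) * S" for S
      by (simp add: real_sqrt_mult[symmetric])
    moreover have "(\<Sum>i=1..n. (if Xs i \<omega> \<bullet> h \<le> x then 1 else 0) * (Ys i \<omega> - Zs i \<omega> \<bullet> betat n \<omega> - Xs i \<omega> \<bullet> rhoh n \<omega>))
      = (\<Sum>i=1..n. indicat_real {..x} (Xs i \<omega> \<bullet> h) * (Ys i \<omega> - Zs i \<omega> \<bullet> betat n \<omega> - Xs i \<omega> \<bullet> rhoh n \<omega>))"
      by (intro sum.cong) (auto simp: indicator_def)
    ultimately show ?thesis unfolding F_def resid_process_def by simp
  qed
  have F_meas: "F n x \<in> borel_measurable M" for n x
  proof -
    have "(\<lambda>\<omega>. indicat_real {..x} (Xs i \<omega> \<bullet> h)) \<in> borel_measurable M" if "i \<in> {1..n}" for i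
    proof -
      have [measurable]: "Xs i \<in> borel_measurable M" using that by (intro Xs_meas) simp
      show ?thesis by measurable
    qed
    then show ?thesis
      unfolding F_eq[abs_def]
      by (intro borel_measurable_times borel_measurable_const borel_measurable_sum borel_measurable_diff
          borel_measurable_inner Ys_meas Zs_meas Xs_meas betat_meas rhoh_meas) auto
  qed
  have F_rc: "((\<lambda>y. F n y \<omega>) \<longlongrightarrow> F n x \<omega>) (at_right x)" for n x \<omega>
    unfolding F_eq by (intro tendsto_mult tendsto_const tendsto_sum tendsto_indicator_atMost_at_right)
  have G_rc: "(G \<longlongrightarrow> G x) (at_right x)" for x
    using tendsto_integral_indicator_atMost_at_right[OF f_int T_meas, of x] unfolding G_eq .

  \<comment> \<open>Replacing the estimated coefficients by the true ones\<close>
  define r where "r p = avg (fst p) (\<lambda>i. norm (Zs i (snd p))) * norm (betat (fst p) (snd p) - \<beta>)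
     + R * norm (rhoh (fst p) (snd p) - \<rho>)" for p
  have r_lim: "(r \<longlongrightarrow> 0) (in_prob M)"
  proof -
    have nm: "(\<lambda>u. norm (fst (snd u))) \<in> borel_measurable P"
      by (rule borel_measurable_continuous_on[where f=norm, OF continuous_on_norm_id fstsP(2)])
    have "integrable P (\<lambda>u. norm (fst (snd u)))"
      using Z_int by (subst integrable_P[OF nm]) (simp add: U_def)
    from weak_law_of_large_numbers[OF iid' this]
    have 1: "((\<lambda>p. avg (fst p) (\<lambda>i. norm (Zs i (snd p)))) \<longlongrightarrow> (\<integral>u. norm (fst (snd u)) \<partial>P)) (in_prob M)"
      by (simp add: V_def case_prod_unfold)
    have 2: "((\<lambda>p. norm (betat (fst p) (snd p) - \<beta>)) \<longlongrightarrow> 0) (in_prob M)"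
      using betat_lim by (intro tendsto_norm_zero) (simp add: LIM_zero)
    have 3: "((\<lambda>p. norm (rhoh (fst p) (snd p) - \<rho>)) \<longlongrightarrow> 0) (in_prob M)"
      using rho_lim by (simp add: case_prod_unfold)
    have "(r \<longlongrightarrow> (\<integral>u. norm (fst (snd u)) \<partial>P) * 0 + R * 0) (in_prob M)"
      unfolding r_def by (intro tendsto_add tendsto_mult tendsto_const 1 2 3)
    then show ?thesis by simp
  qed
  let ?A = "\<lambda>n \<omega> x. avg n (\<lambda>i. indicat_real {..x} (T (V i \<omega>)) * f (V i \<omega>))"
  \<comment> \<open>The indicator is at most 1, so the bound does not depend on x. The covariate Z
    may be unbounded and enters through the average of its norms, which converges; X enters through
    the radius of \<C>.\<close>
  have dev: "\<bar>F n x \<omega> - ?A n \<omega> x\<bar> \<le> r (n, \<omega>)"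
    if n: "n \<ge> 1" and \<omega>: "\<omega> \<in> space M" for n x \<omega>
  proof -
    have "F n x \<omega> - ?A n \<omega> x
      = (1 / real n) * (\<Sum>i=1..n. - (indicat_real {..x} (Xs i \<omega> \<bullet> h) * (Zs i \<omega> \<bullet> (betat n \<omega> - \<beta>) + Xs i \<omega> \<bullet> (rhoh n \<omega> - \<rho>))))"
      unfolding F_eq avg_def real_scaleR_def right_diff_distrib[symmetric] sum_subtractf[symmetric]
      by (intro arg_cong[where f="(*) _"] sum.cong) (simp_all add: T_def f_def V_def inner_diff_right algebra_simps)
    also have "\<bar>\<dots>\<bar> \<le> (1 / real n) * (\<Sum>i=1..n. norm (Zs i \<omega>) * norm (betat n \<omega> - \<beta>) + R * norm (rhoh n \<omega> - \<rho>))"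
      unfolding abs_mult
    proof (intro mult_mono order_trans[OF sum_abs] sum_mono)
      fix i assume i: "i \<in> {1..n}"
      have "\<bar>Zs i \<omega> \<bullet> (betat n \<omega> - \<beta>)\<bar> \<le> norm (Zs i \<omega>) * norm (betat n \<omega> - \<beta>)" by (rule Cauchy_Schwarz_ineq2)
      moreover have "\<bar>Xs i \<omega> \<bullet> (rhoh n \<omega> - \<rho>)\<bar> \<le> R * norm (rhoh n \<omega> - \<rho>)"
        using R[OF B1(2)[of i \<omega>]] i \<omega> by (intro order_trans[OF Cauchy_Schwarz_ineq2] mult_right_mono) auto
      moreover have "\<bar>- (indicat_real {..x} (Xs i \<omega> \<bullet> h) * s)\<bar> \<le> \<bar>s\<bar>" for s by (simp add: indicator_def)
      ultimately show "\<bar>- (indicat_real {..x} (Xs i \<omega> \<bullet> h) * (Zs i \<omega> \<bullet> (betat n \<omega> - \<beta>) + Xs i \<omega> \<bullet> (rhoh n \<omega> - \<rho>)))\<bar>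
        \<le> norm (Zs i \<omega>) * norm (betat n \<omega> - \<beta>) + R * norm (rhoh n \<omega> - \<rho>)"
        by (smt (verit))
    qed auto
    also have "\<dots> = r (n, \<omega>)"
      using n by (simp add: r_def avg_def sum.distrib sum_distrib_right add_divide_distrib)
    finally show ?thesis .
  qed
  have F_lim: "uniform_limit UNIV (\<lambda>(n, \<omega>) x. F n x \<omega>) G (in_prob M)"
  proof (rule uniform_limitI)
    fix e :: real assume e: "e > 0"
    have "\<forall>\<^sub>F p in in_prob M. \<forall>x\<in>UNIV. dist ((case p of (n, \<omega>) \<Rightarrow> \<lambda>x. ?A n \<omega> x) x) (G x) < e / 2"
      using uniform_limitD[OF weighted_Glivenko_Cantelli[OF iid' f_int T_meas, unfolded G_eq], of "e / 2"] e by simp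
    moreover have "\<forall>\<^sub>F p in in_prob M. dist (r p) 0 < e / 2" using tendstoD[OF r_lim, of "e / 2"] e by simp
    moreover have "\<forall>\<^sub>F p in in_prob M. fst p \<ge> 1 \<and> snd p \<in> space M"
      using eventually_ge_at_top[of "1::nat"] by (intro eventually_in_probI[OF prob]) (auto elim: eventually_mono)
    ultimately show "\<forall>\<^sub>F p in in_prob M. \<forall>x\<in>UNIV. dist ((case p of (n, \<omega>) \<Rightarrow> \<lambda>x. F n x \<omega>) x) (G x) < e"
    proof eventually_elim
      case (elim p)
      obtain n \<omega> where p: "p = (n, \<omega>)" by (cases p)
      show ?case
      proof
        fix x :: real
        have "\<bar>F n x \<omega> - ?A n \<omega> x\<bar> < e / 2"
          using dev[of n \<omega> x] elim(2,3) by (auto simp: p)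
        moreover have "\<bar>?A n \<omega> x - G x\<bar> < e / 2"
          using elim(1) by (auto simp: p dist_real_def)
        ultimately show "dist ((case p of (n, \<omega>) \<Rightarrow> \<lambda>x. F n x \<omega>) x) (G x) < e"
          unfolding p prod.case dist_real_def by linarith
      qed
    qed
  qed
  have "unif_tendsto_in_prob M F G"
    by (rule unif_tendsto_in_probI[OF prob F_lim F_meas F_rc G_rc])
  then show ?thesis
    using rho_int rho_mean unfolding F_def[abs_def] G_def[abs_def] by blast
qed

end
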